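(* Let $n\ge1$, let $p\ge0$ be an integer, let $L,L',h_0\in\mathbb R$ satisfy $0<L+\frac32h_0\sqrt n<L'$ and $0<h_0\le1$, and let $\boldsymbol\alpha\in\mathbb R^n$ with $|\boldsymbol\alpha|_\infty\le1/2$. Let $v\in C_c^\infty(B_L)$, let $\ell\in C^\infty((-L',L')\times\mathbb S^{n-1})$ be bounded, let $\gamma>-n$, and let $$f(\mathbf x)=s(\mathbf x-h\boldsymbol\alpha)\,v(\mathbf x),\qquad s(\mathbf x)=|\mathbf x|^\gamma\,\ell\!\left(|\mathbf x|,\frac{\mathbf x}{|\mathbf x|}\right),$$ with $0<h<h_0$, so that the singular point is $\mathbf x_0=h\boldsymbol\alpha$. Then the $p$-th order composite corrected trapezoidal rule $\mathcal Q_h^p$ (defined in the context) satisfies $$\mathcal I[f]-\mathcal Q_h^p[f]=\mathcal O(h^{\gamma+n+p+1}).$$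
   Context: $|\cdot|$ is the Euclidean norm on $\mathbb R^n$, $|\mathbf x|_\infty=\max_i|x_i|$, $B_r=\{\mathbf x\in\mathbb R^n:|\mathbf x|<r\}$, $\mathbb S^{n-1}$ is the unit sphere. $\mathcal I[f]:=\int_{\mathbb R^n}f\,d\mathbf x$ and the punctured trapezoidal rule is $T_h^0[f]:=h^n\sum_{\mathbf y\in h\mathbb Z^n\setminus\{\mathbf 0\}}f(\mathbf y)$. $v$, and products of functions with the factor $v$, are extended by zero outside $B_L$. $\mathcal O(\cdot)$ refers to $h\to0^+$ with all data other than $h$ (in particular $\boldsymbol\alpha,\gamma,\ell,v,p$ and the correction node sets) fixed. $\psi\in C_c^\infty(\mathbb R^n)$ is a fixed function with $\psi(\mathbf x)=1$ for $|\mathbf x|_\infty\le\frac34$ and $\psi(\mathbf x)=0$ for $|\mathbf x|_\infty\ge1$. $\pi(q)=\sum_{j=0}^q\binom{j+n-1}{n-1}$ is the number of multi-indices $\nu\in\mathbb N_0^n$ with $|\nu|\le q$; enumerate them as $\nu_1,\dots,\nu_{\pi(q)}$. Corrected trapezoidal rule $\mathcal S_h^q$. Let $q\ge0$ be an integer, $\delta>-n$, $\phi\in C^\infty(\mathbb S^{n-1})$, $s_0(\mathbf x)=|\mathbf x|^\delta\phi(\mathbf x/|\mathbf x|)$ and $g(\mathbf x)=s_0(\mathbf x-h\boldsymbol\alpha)v(\mathbf x)$. Fix correction nodes $\mathbf c_1,\dots,\mathbf c_{\pi(q)}\in\mathbb Z^n$ such that the $\pi(q)\times\pi(q)$ matrix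 $K$ with entries $K_{ji}=(\mathbf c_i-\boldsymbol\alpha)^{\nu_j}$ is invertible (standing assumption for each order $q$ used), and a constant $\Lambda>0$ with $\Lambda\ge\frac43h_0\max_i|\mathbf c_i|$. Put $$P_\beta(\mathbf x):=\mathbf x^\beta\psi(\mathbf x/\Lambda),\qquad R_\beta(h):=\frac{(\mathcal I-T_h^0)\big[s_0(\cdot-h\boldsymbol\alpha)P_\beta(\cdot-h\boldsymbol\alpha)\big]}{h^{\delta+n+|\beta|}},$$ let $\omega(h)$ solve $K\omega(h)=(R_{\nu_1}(h),\dots,R_{\nu_{\pi(q)}}(h))^T$, and let $\omega_i:=\lim_{h\to0^+}\omega_i(h)$. Then $$\mathcal S_h^q[g]:=T_h^0[g]+h^{\delta+n}\sum_{i=1}^{\pi(q)}\omega_i\,v(h\mathbf c_i).$$ Composite corrected trapezoidal rule. For $k=0,\dots,p$ let $\phi_k(\mathbf u):=\frac1{k!}\partial_r^k\ell(0,\mathbf u)$, where $\ell=\ell(r,\mathbf u)$, and let $$g_k(\mathbf x):=|\mathbf x-h\boldsymbol\alpha|^{\gamma+k}\phi_k\!\left(\frac{\mathbf x-h\boldsymbol\alpha}{|\mathbf x-h\boldsymbol\alpha|}\right)v(\mathbf x).$$ The $p$-th order composite corrected trapezoidal rule is $$\mathcal Q_h^p[f]:=\sum_{k=0}^p\mathcal S_h^{p-k}[g_k]+T_h^0\Big[f-\sum_{k=0}^pg_k\Big],$$ where $\mathcal S_h^{p-k}[g_k]$ is the corrected rule of order $q=p-k$ with $\delta=\gamma+k$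 and $\phi=\phi_k$. *)

theory Defs
  imports
    "HOL-Analysis.Analysis"
    "HOL-Library.Landau_Symbols"
    "Jordan_Normal_Form.Matrix"
begin

(* "$" is reserved for the components of vectors in real ^ 'n; components of the
   dynamically sized vectors of Jordan_Normal_Form are written vec_index. *)
no_notation Matrix.vec_index (infixl \<open>$\<close> 100)

text \<open>Smoothness.\<close>

(* On an open set U: all iterated directional derivatives up to order k exist and are continuous. *)
fun Ck_on :: "nat \<Rightarrow> 'a::euclidean_space set \<Rightarrow> ('a \<Rightarrow> real) \<Rightarrow> bool" where
  "Ck_on 0 U f \<longleftrightarrow> continuous_on U f"
| "Ck_on (Suc k) U f \<longleftrightarrow>
     (\<forall>x\<in>U. f differentiable (at x)) \<and>
     (\<forall>w. Ck_on k U (\<lambda>x. frechet_derivative f (at x) w))"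

definition Cinf_on :: "'a::euclidean_space set \<Rightarrow> ('a \<Rightarrow> real) \<Rightarrow> bool" where
  "Cinf_on U f \<longleftrightarrow> (\<forall>k. Ck_on k U f)"

(* Smoothness on an arbitrary subset of a Euclidean space, by local smooth extension.
   For a submanifold such as the unit sphere, or an open interval times the sphere,
   these are the smooth functions on the manifold; for open A it is Cinf_on A. *)
definition smooth_on_subset :: "'a::euclidean_space set \<Rightarrow> ('a \<Rightarrow> real) \<Rightarrow> bool" where
  "smooth_on_subset A f \<longleftrightarrow>
     (\<forall>x\<in>A. \<exists>U F. open U \<and> x \<in> U \<and> Cinf_on U F \<and> (\<forall>y\<in>U \<inter> A. F y = f y))"

(* C_c^inf(U); the functions are given on the whole space, extended by zero outside U. *)
definition test_function_on :: "'a::euclidean_space set \<Rightarrow> ('a \<Rightarrow> real) \<Rightarrow> bool" where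
  "test_function_on U v \<longleftrightarrow>
     Cinf_on UNIV v \<and> compact (closure {x. v x \<noteq> 0}) \<and> closure {x. v x \<noteq> 0} \<subseteq> U"

text \<open>The integral and the punctured trapezoidal rule.\<close>

definition full_integral :: "(real ^ 'n \<Rightarrow> real) \<Rightarrow> real" where
  "full_integral f = (\<integral>x. f x \<partial>lborel)"

definition int_lattice :: "(real ^ 'n) set" where
  "int_lattice = {z. \<forall>i. z $ i \<in> \<int>}"

definition punctured_trapezoidal :: "real \<Rightarrow> (real ^ 'n \<Rightarrow> real) \<Rightarrow> real" where
  "punctured_trapezoidal h f =
     h ^ CARD('n) * (\<Sum>\<^sub>\<infinity>y\<in>(\<lambda>z. h *\<^sub>R z) ` int_lattice - {0}. f y)"

text \<open>Multi-indices.\<close>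

definition mi_order :: "nat ^ 'n \<Rightarrow> nat" where
  "mi_order \<beta> = (\<Sum>i\<in>UNIV. \<beta> $ i)"

definition mi_power :: "real ^ 'n \<Rightarrow> nat ^ 'n \<Rightarrow> real" where
  "mi_power x \<beta> = (\<Prod>i\<in>UNIV. (x $ i) ^ (\<beta> $ i))"

(* pi(q), for dimension n *)
definition num_mi :: "nat \<Rightarrow> nat \<Rightarrow> nat" where
  "num_mi n q = (\<Sum>j=0..q. (j + n - 1) choose (n - 1))"

text \<open>
  The corrected trapezoidal rule. Throughout, \<open>c\<close> lists the correction nodes and \<open>\<nu>\<close> the
  multi-indices of order at most \<open>q\<close>, both indexed by \<open>0, \<dots>, \<pi>(q) - 1\<close>.
\<close>

(* s_0; its value at 0 is 0 *)
definition homogeneous_sing :: "real \<Rightarrow> (real ^ 'n \<Rightarrow> real) \<Rightarrow> real ^ 'n \<Rightarrow> real" where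
  "homogeneous_sing \<delta> \<phi> x = norm x powr \<delta> * \<phi> (x /\<^sub>R norm x)"

definition node_matrix ::
  "real ^ 'n \<Rightarrow> (nat \<Rightarrow> real ^ 'n) \<Rightarrow> (nat \<Rightarrow> nat ^ 'n) \<Rightarrow> nat \<Rightarrow> real mat" where
  "node_matrix \<alpha> c \<nu> q =
     (let N = num_mi CARD('n) q in Matrix.mat N N (\<lambda>(j, i). mi_power (c i - \<alpha>) (\<nu> j)))"

definition cutoff_monomial ::
  "(real ^ 'n \<Rightarrow> real) \<Rightarrow> real \<Rightarrow> nat ^ 'n \<Rightarrow> real ^ 'n \<Rightarrow> real" where
  "cutoff_monomial \<psi> \<Lambda> \<beta> x = mi_power x \<beta> * \<psi> (x /\<^sub>R \<Lambda>)"

definition scaled_error ::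
  "(real ^ 'n \<Rightarrow> real) \<Rightarrow> real \<Rightarrow> real ^ 'n \<Rightarrow> real \<Rightarrow> (real ^ 'n \<Rightarrow> real) \<Rightarrow> nat ^ 'n \<Rightarrow> real \<Rightarrow> real"
where
  "scaled_error \<psi> \<Lambda> \<alpha> \<delta> \<phi> \<beta> h =
     (let F = (\<lambda>x. homogeneous_sing \<delta> \<phi> (x - h *\<^sub>R \<alpha>) * cutoff_monomial \<psi> \<Lambda> \<beta> (x - h *\<^sub>R \<alpha>))
      in (full_integral F - punctured_trapezoidal h F)
           / h powr (\<delta> + real CARD('n) + real (mi_order \<beta>)))"

(* omega(h), the solution of K omega(h) = R(h) (unique as K is assumed invertible) *)
definition weights_at ::
  "(real ^ 'n \<Rightarrow> real) \<Rightarrow> real \<Rightarrow> real ^ 'n \<Rightarrow> (nat \<Rightarrow> real ^ 'n) \<Rightarrow> (nat \<Rightarrow> nat ^ 'n) \<Rightarrow> nat \<Rightarrow>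
   real \<Rightarrow> (real ^ 'n \<Rightarrow> real) \<Rightarrow> real \<Rightarrow> real Matrix.vec"
where
  "weights_at \<psi> \<Lambda> \<alpha> c \<nu> q \<delta> \<phi> h =
     (let N = num_mi CARD('n) q in
      THE w. w \<in> carrier_vec N \<and>
        mult_mat_vec (node_matrix \<alpha> c \<nu> q) w
          = Matrix.vec N (\<lambda>j. scaled_error \<psi> \<Lambda> \<alpha> \<delta> \<phi> (\<nu> j) h))"

definition weight ::
  "(real ^ 'n \<Rightarrow> real) \<Rightarrow> real \<Rightarrow> real ^ 'n \<Rightarrow> (nat \<Rightarrow> real ^ 'n) \<Rightarrow> (nat \<Rightarrow> nat ^ 'n) \<Rightarrow> nat \<Rightarrow>
   real \<Rightarrow> (real ^ 'n \<Rightarrow> real) \<Rightarrow> nat \<Rightarrow> real"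
where
  "weight \<psi> \<Lambda> \<alpha> c \<nu> q \<delta> \<phi> i =
     Lim (at_right 0) (\<lambda>h. vec_index (weights_at \<psi> \<Lambda> \<alpha> c \<nu> q \<delta> \<phi> h) i)"

(* S_h^q[g] for g(x) = s_0(x - h alpha) v(x) *)
definition corrected_trapezoidal ::
  "(real ^ 'n \<Rightarrow> real) \<Rightarrow> real \<Rightarrow> real ^ 'n \<Rightarrow> (nat \<Rightarrow> real ^ 'n) \<Rightarrow> (nat \<Rightarrow> nat ^ 'n) \<Rightarrow> nat \<Rightarrow>
   real \<Rightarrow> (real ^ 'n \<Rightarrow> real) \<Rightarrow> (real ^ 'n \<Rightarrow> real) \<Rightarrow> real \<Rightarrow> real"
where
  "corrected_trapezoidal \<psi> \<Lambda> \<alpha> c \<nu> q \<delta> \<phi> v h =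
     punctured_trapezoidal h (\<lambda>x. homogeneous_sing \<delta> \<phi> (x - h *\<^sub>R \<alpha>) * v x)
     + h powr (\<delta> + real CARD('n)) *
       (\<Sum>i<num_mi CARD('n) q. weight \<psi> \<Lambda> \<alpha> c \<nu> q \<delta> \<phi> i * v (h *\<^sub>R c i))"

text \<open>The composite rule.\<close>

definition general_sing :: "real \<Rightarrow> (real \<times> (real ^ 'n) \<Rightarrow> real) \<Rightarrow> real ^ 'n \<Rightarrow> real" where
  "general_sing \<gamma> l x = norm x powr \<gamma> * l (norm x, x /\<^sub>R norm x)"

definition sing_integrand ::
  "real \<Rightarrow> (real \<times> (real ^ 'n) \<Rightarrow> real) \<Rightarrow> real ^ 'n \<Rightarrow> (real ^ 'n \<Rightarrow> real) \<Rightarrow> real \<Rightarrow> real ^ 'n \<Rightarrow> real"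
where
  "sing_integrand \<gamma> l \<alpha> v h x = general_sing \<gamma> l (x - h *\<^sub>R \<alpha>) * v x"

(* phi_k(u) = (1/k!) d^k l / d r^k (0, u) *)
definition radial_coeff :: "(real \<times> (real ^ 'n) \<Rightarrow> real) \<Rightarrow> nat \<Rightarrow> real ^ 'n \<Rightarrow> real" where
  "radial_coeff l k u = (deriv ^^ k) (\<lambda>r. l (r, u)) 0 / fact k"

(* Q_h^p[f] for f = sing_integrand gamma l alpha v h. The nodes, the enumeration of the
   multi-indices and Lambda may depend on the order q of the rule S_h^q, whence c q, nu q, Lambda q. *)
definition composite_rule ::
  "(real ^ 'n \<Rightarrow> real) \<Rightarrow> (nat \<Rightarrow> real) \<Rightarrow> real ^ 'n \<Rightarrow> (nat \<Rightarrow> nat \<Rightarrow> real ^ 'n) \<Rightarrow>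
   (nat \<Rightarrow> nat \<Rightarrow> nat ^ 'n) \<Rightarrow> real \<Rightarrow> (real \<times> (real ^ 'n) \<Rightarrow> real) \<Rightarrow> (real ^ 'n \<Rightarrow> real) \<Rightarrow>
   nat \<Rightarrow> real \<Rightarrow> real"
where
  "composite_rule \<psi> \<Lambda> \<alpha> c \<nu> \<gamma> l v p h =
     (\<Sum>k=0..p. corrected_trapezoidal \<psi> (\<Lambda> (p - k)) \<alpha> (c (p - k)) (\<nu> (p - k)) (p - k)
                  (\<gamma> + real k) (radial_coeff l k) v h)
     + punctured_trapezoidal h
         (\<lambda>x. sing_integrand \<gamma> l \<alpha> v h x
              - (\<Sum>k=0..p. homogeneous_sing (\<gamma> + real k) (radial_coeff l k) (x - h *\<^sub>R \<alpha>) * v x))"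

end

theory Submission
  imports Defs
begin

text \<open>
  Write \<open>y = x - h\<alpha>\<close>. The sampled function \<open>f\<close> enters the composite rule only through the punctured
  trapezoidal sum, since the sums over the \<open>g\<^sub>k\<close> cancel; what remains of the correction are the node
  terms \<open>h\<^bsup>\<gamma>+k+n\<^esup> \<Sum>\<^sub>i \<omega>\<^sub>i v(h c\<^sub>i)\<close>. So the claim is that these terms reproduce the error of the punctured
  rule on \<open>f\<close> up to \<open>O(h\<^bsup>\<gamma>+n+p+1\<^esup>)\<close>.

  The basic estimate (\<open>quad_error_bound\<close>) says that the punctured rule has error \<open>O(h\<^bsup>d+n\<^esup>)\<close> on a compactly
  supported function that behaves like \<open>|y|\<^sup>d\<close>, with \<open>d > -n\<close>, in the sense of symbols: derivatives of order
  \<open>j\<close> are \<open>O(|y|\<^bsup>d-j\<^esup>)\<close>. It is proved after scaling to step one. Let \<open>A\<close> average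
  a function over the unit cell. The lattice sum of \<open>A F\<close> is the integral of \<open>F\<close>, and \<open>A\<close> preserves
  integrals; hence the error on \<open>F\<close> is, up to sign, the lattice sum of \<open>(A - 1)\<^sup>m F\<close> for every \<open>m \<ge> 1\<close>
  (\<open>lattice_error_cell_dev\<close>). Now \<open>(A - 1)\<^sup>m F\<close> is an average of \<open>m\<close>-fold differences, which are
  \<open>O(|y|\<^bsup>d-m\<^esup>)\<close> away from the singularity and therefore summable for large \<open>m\<close>, while the finitely many
  lattice points near it are controlled by the local integrability of \<open>|y|\<^sup>d\<close>.

  The singular factor and \<open>v\<close> are expanded together, along rays: with a cutoff \<open>\<psi>\<close> that isolates the
  singularity, the function \<open>t \<mapsto> \<psi> |y|\<^sup>\<gamma> l(t|y|, y/|y|) v(ty + h\<alpha>)\<close> is expanded at \<open>t = 0\<close> to order \<open>p\<close> and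
  evaluated at \<open>t = 1\<close>. Its derivative of order \<open>p + 1\<close> is a symbol of degree \<open>\<gamma> + p + 1\<close>, so the remainder
  contributes \<open>O(h\<^bsup>\<gamma>+n+p+1\<^esup>)\<close>; the same holds for the part of \<open>f\<close> away from the singularity, which
  is a symbol of any degree. The Taylor polynomial is a sum of terms \<open>b(h\<alpha>) H(y) \<psi>\<close> with
  \<open>H(y) = |y|\<^bsup>\<gamma>+k\<^esup> \<phi>\<^sub>k(y/|y|) y\<^sup>\<beta>\<close> homogeneous and \<open>k + |\<beta>| \<le> p\<close>.

  For homogeneous \<open>H\<close> of degree \<open>d\<close>, scaling turns the error on \<open>H \<psi>(\<cdot>/\<Lambda>)\<close> into \<open>h\<^bsup>d+n\<^esup>\<close> times a number
  depending only on \<open>\<Lambda>/h\<close>. Two such numbers differ by the error of a function that vanishes on a large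
  ball, which is smaller than any power of its radius; so they converge faster than any power of \<open>h\<close> to
  a limit that does not depend on \<open>\<Lambda>\<close> (\<open>dilation_error_limit\<close>). These limits are exactly the moments
  \<open>\<Sum>\<^sub>i \<omega>\<^sub>i (c\<^sub>i - \<alpha>)\<^sup>\<beta>\<close> of the weights (\<open>weight_moments\<close>), so inserting the Taylor expansion of \<open>v(h c\<^sub>i)\<close> at \<open>h\<alpha>\<close>
  into the correction terms gives the same sum (\<open>correction_sum_error\<close>).
\<close>

no_notation Matrix.scalar_prod (infix \<open>\<bullet>\<close> 70)

section \<open>Calculus of smooth functions\<close>

lemma has_derivative_cong_open:
  assumes "open U" "x \<in> U" "\<And>y. y \<in> U \<Longrightarrow> f y = g y"
  shows "(f has_derivative f') (at x) \<longleftrightarrow> (g has_derivative f') (at x)"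
  using assms has_derivative_transform_within_open[of f f' x UNIV U g]
    has_derivative_transform_within_open[of g f' x UNIV U f] by auto

lemma frechet_derivative_cong_open:
  assumes "open U" "x \<in> U" "\<And>y. y \<in> U \<Longrightarrow> f y = g y"
  shows "frechet_derivative f (at x) = frechet_derivative g (at x)"
  unfolding frechet_derivative_def using has_derivative_cong_open[OF assms] by simp

lemma frechet_derivative_eqI: "(f has_derivative f') (at x) \<Longrightarrow> frechet_derivative f (at x) = f'"
  using frechet_derivative_at by metis

lemma Ck_on_cong:
  assumes "open U" "\<And>x. x \<in> U \<Longrightarrow> f x = g x"
  shows "Ck_on k U f \<longleftrightarrow> Ck_on k U g"
  using assms(2)
proof (induction k arbitrary: f g)
  case 0
  then show ?case by (auto intro: continuous_on_cong[THEN iffD1])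
next
  case (Suc k)
  have "f differentiable at x \<longleftrightarrow> g differentiable at x" if "x \<in> U" for x
    unfolding differentiable_def using has_derivative_cong_open[OF assms(1) that Suc.prems] by simp
  moreover have "Ck_on k U (\<lambda>x. frechet_derivative f (at x) w)
      \<longleftrightarrow> Ck_on k U (\<lambda>x. frechet_derivative g (at x) w)" for w
    using frechet_derivative_cong_open[OF assms(1) _ Suc.prems] by (intro Suc.IH) auto
  ultimately show ?case by simp
qed

text \<open>
  The definition of \<open>Ck_on\<close> speaks of \<open>frechet_derivative\<close>, which is given by choice; on an open set
  any explicit formula for the derivative may be used instead.
\<close>

lemma Ck_on_SucI:
  assumes "open U" "\<And>x. x \<in> U \<Longrightarrow> (f has_derivative f' x) (at x)"
    "\<And>w. Ck_on k U (\<lambda>x. f' x w)"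
  shows "Ck_on (Suc k) U f"
proof -
  have "Ck_on k U (\<lambda>x. frechet_derivative f (at x) w)" for w
    using assms(3)[of w] frechet_derivative_eqI[OF assms(2)]
    by (subst Ck_on_cong[OF assms(1)]) auto
  then show ?thesis using assms(2) by (auto simp: differentiable_def)
qed

lemma Ck_on_has_derivative:
  "Ck_on (Suc k) U f \<Longrightarrow> x \<in> U \<Longrightarrow> (f has_derivative frechet_derivative f (at x)) (at x)"
  by (simp add: frechet_derivative_works)

lemma Ck_on_imp_continuous_on:
  assumes "Ck_on k U f" shows "continuous_on U f"
proof (cases k)
  case 0 then show ?thesis using assms by simp
next
  case (Suc j)
  then show ?thesis using assms
    by (auto intro!: continuous_at_imp_continuous_on differentiable_imp_continuous_within)
qed

lemma Ck_on_SucD: "Ck_on (Suc k) U f \<Longrightarrow> Ck_on k U f"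
proof (induction k arbitrary: f)
  case 0 then show ?case using Ck_on_imp_continuous_on[OF 0] by simp
next
  case (Suc k)
  then show ?case by (subst Ck_on.simps) (auto simp del: Ck_on.simps(1) simp: Ck_on.simps(2))
qed

lemma Ck_on_subset: "Ck_on k U f \<Longrightarrow> V \<subseteq> U \<Longrightarrow> Ck_on k V f"
  by (induction k arbitrary: f) (auto intro: continuous_on_subset)

lemma Ck_on_local:
  assumes "\<And>x. x \<in> U \<Longrightarrow> \<exists>V. open V \<and> x \<in> V \<and> Ck_on k V f"
  shows "Ck_on k U f"
  using assms
proof (induction k arbitrary: f)
  case 0
  have "continuous (at x) f" if "x \<in> U" for x
    using 0[OF that] continuous_on_eq_continuous_at by auto
  then show ?case by (simp add: continuous_at_imp_continuous_on)
next
  case (Suc k)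
  show ?case
  proof (simp, intro conjI ballI allI)
    fix x assume "x \<in> U" then show "f differentiable at x" using Suc.prems by fastforce
  next
    fix w show "Ck_on k U (\<lambda>x. frechet_derivative f (at x) w)"
      by (rule Suc.IH) (use Suc.prems in fastforce)
  qed
qed

lemma Ck_on_const: "Ck_on k U (\<lambda>x. c)"
proof (induction k arbitrary: c)
  case (Suc k)
  have "frechet_derivative (\<lambda>x::'a. c) (at x) = (\<lambda>_. 0)" for x
    by (rule frechet_derivative_eqI) simp
  then show ?case using Suc.IH[of 0] by simp
qed simp

lemma Ck_on_inner: 
  assumes "open U" shows "Ck_on k U (\<lambda>x. x \<bullet> b)"
proof (cases k)
  case 0 then show ?thesis by (auto intro: continuous_intros)
next
  case (Suc j)
  show ?thesis unfolding Suc
    by (rule Ck_on_SucI[where f'="\<lambda>x w. w \<bullet> b"]) (auto intro!: assms derivative_eq_intros Ck_on_const)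
qed

lemma Ck_on_add:
  assumes "open U"
  shows "Ck_on k U f \<Longrightarrow> Ck_on k U g \<Longrightarrow> Ck_on k U (\<lambda>x. f x + g x)"
proof (induction k arbitrary: f g)
  case 0 then show ?case by (auto intro: continuous_intros)
next
  case (Suc k)
  show ?case
  proof (rule Ck_on_SucI[OF assms])
    fix x assume "x \<in> U"
    then show "((\<lambda>x. f x + g x) has_derivative
        (\<lambda>w. frechet_derivative f (at x) w + frechet_derivative g (at x) w)) (at x)"
      using Suc.prems by (intro has_derivative_add Ck_on_has_derivative)
  qed (use Suc in auto)
qed

lemma Ck_on_mult:
  assumes "open U"
  shows "Ck_on k U f \<Longrightarrow> Ck_on k U g \<Longrightarrow> Ck_on k U (\<lambda>x. f x * g x)"
proof (induction k arbitrary: f g)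
  case 0 then show ?case by (auto intro: continuous_intros)
next
  case (Suc k)
  show ?case
  proof (rule Ck_on_SucI[OF assms])
    fix x assume "x \<in> U"
    then show "((\<lambda>x. f x * g x) has_derivative
        (\<lambda>w. f x * frechet_derivative g (at x) w + frechet_derivative f (at x) w * g x)) (at x)"
      using Suc.prems by (intro has_derivative_mult Ck_on_has_derivative)
  next
    fix w
    show "Ck_on k U (\<lambda>x. f x * frechet_derivative g (at x) w + frechet_derivative f (at x) w * g x)"
      using Suc.prems by (intro Ck_on_add assms Suc.IH) (auto intro: Ck_on_SucD)
  qed
qed

lemma Ck_on_sum:
  assumes "open U" "\<And>i. i \<in> I \<Longrightarrow> Ck_on k U (f i)"
  shows "Ck_on k U (\<lambda>x. \<Sum>i\<in>I. f i x)"
  using assms(2) by (induction I rule: infinite_finite_induct) (auto intro: Ck_on_const Ck_on_add assms(1))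

lemma Ck_on_prod:
  assumes "open U" "\<And>i. i \<in> I \<Longrightarrow> Ck_on k U (f i)"
  shows "Ck_on k U (\<lambda>x. \<Prod>i\<in>I. f i x)"
  using assms(2) by (induction I rule: infinite_finite_induct) (auto intro: Ck_on_const Ck_on_mult assms(1))

lemma Ck_on_power:
  assumes "open U" "Ck_on k U f"
  shows "Ck_on k U (\<lambda>x. f x ^ j)"
  by (induction j) (auto intro: Ck_on_const Ck_on_mult assms)

text \<open>
  Induction on the order: by the chain rule the derivative of \<open>f \<circ> g\<close> is a sum of products of
  \<open>(\<partial>\<^sub>b f) \<circ> g\<close>, to which the induction hypothesis applies, with derivatives of the components of \<open>g\<close>.
\<close>

lemma Ck_on_compose:
  fixes f :: "'b::euclidean_space \<Rightarrow> real" and g :: "'a::euclidean_space \<Rightarrow> 'b"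
  assumes "open U"
  shows "Ck_on k V f \<Longrightarrow> (\<And>b. b \<in> Basis \<Longrightarrow> Ck_on k U (\<lambda>x. g x \<bullet> b)) \<Longrightarrow> (\<And>x. x \<in> U \<Longrightarrow> g x \<in> V)
    \<Longrightarrow> Ck_on k U (\<lambda>x. f (g x))"
proof (induction k arbitrary: f)
  case 0
  have "continuous_on U g" using 0(2) by (simp add: continuous_on_componentwise[of U g])
  then show ?case using 0 by (auto intro: continuous_on_compose2[of V f])
next
  case (Suc k)
  let ?g' = "\<lambda>b x. frechet_derivative (\<lambda>x. g x \<bullet> b) (at x)"
  show ?case
  proof (rule Ck_on_SucI[OF assms])
    fix x assume x: "x \<in> U"
    have "(g has_derivative (\<lambda>w. \<Sum>b\<in>Basis. ?g' b x w *\<^sub>R b)) (at x)"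
    proof (subst has_derivative_componentwise_within, intro ballI)
      fix c :: 'b assume "c \<in> Basis"
      then show "((\<lambda>x. g x \<bullet> c) has_derivative (\<lambda>w. (\<Sum>b\<in>Basis. ?g' b x w *\<^sub>R b) \<bullet> c)) (at x)"
        using Ck_on_has_derivative[OF Suc.prems(2) x] by simp
    qed
    then have "((\<lambda>x. f (g x)) has_derivative (\<lambda>w. frechet_derivative f (at (g x)) (\<Sum>b\<in>Basis. ?g' b x w *\<^sub>R b))) (at x)"
      using Ck_on_has_derivative[OF Suc.prems(1) Suc.prems(3)[OF x]] by (rule has_derivative_compose)
    moreover have "linear (frechet_derivative f (at (g x)))"
      using Ck_on_has_derivative[OF Suc.prems(1) Suc.prems(3)[OF x]] has_derivative_linear by blast
    ultimately show "((\<lambda>x. f (g x)) has_derivative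
        (\<lambda>w. \<Sum>b\<in>Basis. ?g' b x w * frechet_derivative f (at (g x)) b)) (at x)"
      by (simp add: linear_sum linear_cmul)
  next
    fix w
    have "Ck_on k U (\<lambda>x. frechet_derivative f (at (g x)) b)" for b
      by (rule Suc.IH) (use Suc.prems in \<open>auto intro: Ck_on_SucD\<close>)
    then show "Ck_on k U (\<lambda>x. \<Sum>b\<in>Basis. ?g' b x w * frechet_derivative f (at (g x)) b)"
      using Suc.prems(2) by (intro Ck_on_sum Ck_on_mult assms) auto
  qed
qed

lemma Ck_on_powr: "Ck_on k {0<..} (\<lambda>x::real. x powr a)"
proof (induction k arbitrary: a)
  case 0 show ?case by (auto intro!: continuous_intros)
next
  case (Suc k)
  show ?case
  proof (rule Ck_on_SucI)
    fix x :: real assume "x \<in> {0<..}"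
    then show "((\<lambda>x. x powr a) has_derivative (\<lambda>w. a * x powr (a - 1) * w)) (at x)"
      using has_real_derivative_powr[of x a] by (simp add: has_field_derivative_def)
  qed (auto intro!: Ck_on_mult Ck_on_const Suc)
qed

text \<open>
  The norm is a power of the positive polynomial \<open>\<Sum>\<^sub>b (g x \<bullet> b)\<^sup>2\<close>.
\<close>

lemma Cinf_on_norm_powr:
  assumes "open U" "\<And>b. b \<in> Basis \<Longrightarrow> Cinf_on U (\<lambda>x. g x \<bullet> b)" "\<And>x. x \<in> U \<Longrightarrow> g x \<noteq> 0"
  shows "Cinf_on U (\<lambda>x. norm (g x :: 'b::euclidean_space) powr a)"
  unfolding Cinf_on_def
proof
  fix k
  have eq: "norm (g x) powr a = (\<Sum>b\<in>Basis. (g x \<bullet> b) * (g x \<bullet> b)) powr (a / 2)" if "x \<in> U" for x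
  proof -
    have "norm (g x) powr a = ((norm (g x))\<^sup>2) powr (a / 2)"
      using assms(3)[OF that] by (simp add: powr_powr flip: powr_numeral)
    also have "(norm (g x))\<^sup>2 = (\<Sum>b\<in>Basis. (g x \<bullet> b) * (g x \<bullet> b))"
      by (subst power2_norm_eq_inner) (rule euclidean_inner)
    finally show ?thesis .
  qed
  have pos: "(\<Sum>b\<in>Basis. (g x \<bullet> b) * (g x \<bullet> b)) \<in> {0<..}" if "x \<in> U" for x
    using assms(3)[OF that] euclidean_inner[of "g x" "g x"] inner_gt_zero_iff[of "g x"] by simp
  have "Ck_on k U (\<lambda>x. (\<Sum>b\<in>Basis. (g x \<bullet> b) * (g x \<bullet> b)) powr (a / 2))"
  proof (rule Ck_on_compose[OF assms(1) Ck_on_powr])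
    fix c :: real assume "c \<in> Basis"
    then show "Ck_on k U (\<lambda>x. (\<Sum>b\<in>Basis. (g x \<bullet> b) * (g x \<bullet> b)) \<bullet> c)"
      using assms(2) by (auto simp: Cinf_on_def intro!: Ck_on_sum Ck_on_mult assms(1))
  qed (use pos in auto)
  then show "Ck_on k U (\<lambda>x. norm (g x) powr a)"
    by (subst Ck_on_cong[OF assms(1) eq])
qed

lemma Cinf_on_frechet: "Cinf_on U f \<Longrightarrow> Cinf_on U (\<lambda>x. frechet_derivative f (at x) w)"
  unfolding Cinf_on_def by (metis Ck_on.simps(2))

lemma Cinf_on_has_derivative:
  "Cinf_on U f \<Longrightarrow> x \<in> U \<Longrightarrow> (f has_derivative frechet_derivative f (at x)) (at x)"
  unfolding Cinf_on_def using Ck_on_has_derivative by blast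

lemma Cinf_on_imp_continuous_on: "Cinf_on U f \<Longrightarrow> continuous_on U f"
  unfolding Cinf_on_def using Ck_on_imp_continuous_on by blast

lemma Cinf_on_compose:
  fixes f :: "'b::euclidean_space \<Rightarrow> real" and g :: "'a::euclidean_space \<Rightarrow> 'b"
  assumes "open U" "Cinf_on V f" "\<And>b. b \<in> Basis \<Longrightarrow> Cinf_on U (\<lambda>x. g x \<bullet> b)" "\<And>x. x \<in> U \<Longrightarrow> g x \<in> V"
  shows "Cinf_on U (\<lambda>x. f (g x))"
  using assms Ck_on_compose unfolding Cinf_on_def by blast

lemma Cinf_on_mult: "open U \<Longrightarrow> Cinf_on U f \<Longrightarrow> Cinf_on U g \<Longrightarrow> Cinf_on U (\<lambda>x. f x * g x)"
  unfolding Cinf_on_def using Ck_on_mult by blast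

section \<open>Uniform symbol estimates\<close>

text \<open>
  Estimates of derivatives have to be uniform in parameters such as \<open>h\<close>. Therefore a whole family \<open>F\<close> is
  considered at once, on a set \<open>D\<close> of pairs of a parameter and a point. Existence of some derivative,
  instead of a fixed choice of it, lets the closure properties below supply explicit formulas.
\<close>

fun symbol_on ::
  "nat \<Rightarrow> real \<Rightarrow> ('i \<times> 'a::euclidean_space) set \<Rightarrow> ('i \<Rightarrow> 'a \<Rightarrow> real) \<Rightarrow> bool" where
  "symbol_on 0 d D F \<longleftrightarrow> (\<exists>C. \<forall>(i, y)\<in>D. \<bar>F i y\<bar> \<le> C * norm y powr d)"
| "symbol_on (Suc m) d D F \<longleftrightarrow> symbol_on 0 d D F \<and>
     (\<exists>F'. (\<forall>(i, y)\<in>D. (F i has_derivative F' i y) (at y)) \<and>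
           (\<forall>w. symbol_on m (d - 1) D (\<lambda>i y. F' i y w)))"

text \<open>
  With open slices the values on \<open>D\<close> determine the derivatives on \<open>D\<close>.
\<close>

definition open_slices :: "('i \<times> 'a::topological_space) set \<Rightarrow> bool" where
  "open_slices D \<longleftrightarrow> (\<forall>i. open {y. (i, y) \<in> D})"

lemma open_slices_Times: "open U \<Longrightarrow> open_slices (I \<times> U)"
  unfolding open_slices_def
proof
  fix i assume "open U" then show "open {y. (i, y) \<in> I \<times> U}" by (cases "i \<in> I") auto
qed

lemma symbol_on_0I: "(\<And>i y. (i, y) \<in> D \<Longrightarrow> \<bar>F i y\<bar> \<le> C * norm y powr d) \<Longrightarrow> symbol_on 0 d D F"
  by auto

lemma symbol_on_0E:
  assumes "symbol_on 0 d D F"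
  obtains C where "C \<ge> 0" "\<And>i y. (i, y) \<in> D \<Longrightarrow> \<bar>F i y\<bar> \<le> C * norm y powr d"
proof -
  from assms obtain C where C: "\<And>i y. (i, y) \<in> D \<Longrightarrow> \<bar>F i y\<bar> \<le> C * norm y powr d" by auto
  show thesis
  proof (rule that[of "\<bar>C\<bar>"])
    fix i y assume "(i, y) \<in> D"
    then have "\<bar>F i y\<bar> \<le> C * norm y powr d" by (rule C)
    also have "\<dots> \<le> \<bar>C\<bar> * norm y powr d" by (intro mult_right_mono) auto
    finally show "\<bar>F i y\<bar> \<le> \<bar>C\<bar> * norm y powr d" .
  qed simp
qed

lemma symbol_on_0: "symbol_on m d D F \<Longrightarrow> symbol_on 0 d D F"
  by (cases m) auto

lemma symbol_on_SucI:
  assumes "symbol_on 0 d D F" "\<And>i y. (i, y) \<in> D \<Longrightarrow> (F i has_derivative F' i y) (at y)"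
    "\<And>w. symbol_on m (d - 1) D (\<lambda>i y. F' i y w)"
  shows "symbol_on (Suc m) d D F"
  using assms by (auto simp del: symbol_on.simps(1) simp: symbol_on.simps(2))

lemma symbol_on_SucE:
  assumes "symbol_on (Suc m) d D F"
  obtains F' where "\<And>i y. (i, y) \<in> D \<Longrightarrow> (F i has_derivative F' i y) (at y)"
    "\<And>w. symbol_on m (d - 1) D (\<lambda>i y. F' i y w)" "symbol_on 0 d D F"
  using assms by (auto simp del: symbol_on.simps(1) simp: symbol_on.simps(2))

lemma symbol_on_cong:
  assumes "open_slices D" "\<And>i y. (i, y) \<in> D \<Longrightarrow> F i y = G i y" "symbol_on m d D F"
  shows "symbol_on m d D G"
proof (cases m)
  case 0
  obtain C where "\<And>i y. (i, y) \<in> D \<Longrightarrow> \<bar>F i y\<bar> \<le> C * norm y powr d"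
    using assms(3) symbol_on_0E unfolding 0 by metis
  then show ?thesis unfolding 0 using assms(2) by (intro symbol_on_0I[of _ _ C]) auto
next
  case (Suc k)
  obtain F' where F': "\<And>i y. (i, y) \<in> D \<Longrightarrow> (F i has_derivative F' i y) (at y)"
    "\<And>w. symbol_on k (d - 1) D (\<lambda>i y. F' i y w)" "symbol_on 0 d D F"
    using assms(3) symbol_on_SucE unfolding Suc by metis
  obtain C where "\<And>i y. (i, y) \<in> D \<Longrightarrow> \<bar>F i y\<bar> \<le> C * norm y powr d"
    using F'(3) symbol_on_0E by metis
  then have "symbol_on 0 d D G" using assms(2) by (intro symbol_on_0I[of _ _ C]) auto
  then show ?thesis unfolding Suc
  proof (rule symbol_on_SucI[OF _ _ F'(2)])
    fix i y assume iy: "(i, y) \<in> D"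
    show "(G i has_derivative F' i y) (at y)"
      using has_derivative_cong_open[of "{y. (i, y) \<in> D}" y "F i" "G i" "F' i y"] assms(1,2) F'(1) iy
      by (simp add: open_slices_def)
  qed
qed

lemma symbol_on_SucD: "symbol_on (Suc m) d D F \<Longrightarrow> symbol_on m d D F"
proof (induction m arbitrary: d F)
  case 0 then show ?case by (simp only: symbol_on.simps(2))
next
  case (Suc m)
  from Suc.prems obtain F' where F': "\<And>i y. (i, y) \<in> D \<Longrightarrow> (F i has_derivative F' i y) (at y)"
    "\<And>w. symbol_on (Suc m) (d - 1) D (\<lambda>i y. F' i y w)" "symbol_on 0 d D F" using symbol_on_SucE by metis
  show ?case by (rule symbol_on_SucI[OF F'(3,1) Suc.IH[OF F'(2)]])
qed

lemma symbol_on_add: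
  assumes "symbol_on m d D F" "symbol_on m d D G"
  shows "symbol_on m d D (\<lambda>i y. F i y + G i y)"
proof -
  have base: "symbol_on 0 d D (\<lambda>i y. F i y + G i y)" if "symbol_on 0 d D F" "symbol_on 0 d D G" for d F G
  proof -
    from that(1) obtain C where C: "\<And>i y. (i, y) \<in> D \<Longrightarrow> \<bar>F i y\<bar> \<le> C * norm y powr d" using symbol_on_0E by metis
    from that(2) obtain C' where C': "\<And>i y. (i, y) \<in> D \<Longrightarrow> \<bar>G i y\<bar> \<le> C' * norm y powr d" using symbol_on_0E by metis
    have "\<bar>F i y + G i y\<bar> \<le> (C + C') * norm y powr d" if "(i, y) \<in> D" for i y
      using C[OF that] C'[OF that] by (simp add: algebra_simps)
    then show ?thesis by (rule symbol_on_0I)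
  qed
  show ?thesis using assms
  proof (induction m arbitrary: d F G)
    case (Suc m)
    obtain F' where F': "\<And>i y. (i, y) \<in> D \<Longrightarrow> (F i has_derivative F' i y) (at y)"
      "\<And>w. symbol_on m (d - 1) D (\<lambda>i y. F' i y w)" "symbol_on 0 d D F" using Suc.prems(1) symbol_on_SucE by metis
    obtain G' where G': "\<And>i y. (i, y) \<in> D \<Longrightarrow> (G i has_derivative G' i y) (at y)"
      "\<And>w. symbol_on m (d - 1) D (\<lambda>i y. G' i y w)" "symbol_on 0 d D G" using Suc.prems(2) symbol_on_SucE by metis
    show ?case
      by (rule symbol_on_SucI[OF base[OF F'(3) G'(3)], where F'="\<lambda>i y w. F' i y w + G' i y w"])
        (use Suc.IH F' G' in \<open>auto intro: has_derivative_add\<close>)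
  qed (rule base)
qed

lemma symbol_on_uminus:
  assumes "symbol_on m d D F" shows "symbol_on m d D (\<lambda>i y. - F i y)"
proof -
  have base: "symbol_on 0 d D (\<lambda>i y. - F i y)" if "symbol_on 0 d D F" for d F
    using that by simp
  show ?thesis using assms
  proof (induction m arbitrary: d F)
    case (Suc m)
    from Suc.prems obtain F' where F': "\<And>i y. (i, y) \<in> D \<Longrightarrow> (F i has_derivative F' i y) (at y)"
      "\<And>w. symbol_on m (d - 1) D (\<lambda>i y. F' i y w)" "symbol_on 0 d D F" using symbol_on_SucE by metis
    show ?case
      by (rule symbol_on_SucI[OF base[OF F'(3)] has_derivative_minus[OF F'(1)] Suc.IH[OF F'(2)]])
  qed (rule base)
qed

lemma symbol_on_zero: "symbol_on m d D (\<lambda>i y. 0)"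
proof -
  have base: "symbol_on 0 d D (\<lambda>i y. 0)" for d by (rule symbol_on_0I[of _ _ 0]) auto
  show ?thesis
  proof (induction m arbitrary: d)
    case (Suc m)
    show ?case by (rule symbol_on_SucI[OF base, where F'="\<lambda>i y w. 0"]) (use Suc in auto)
  qed (rule base)
qed

lemma symbol_on_sum:
  assumes "\<And>j. j \<in> J \<Longrightarrow> symbol_on m d D (F j)"
  shows "symbol_on m d D (\<lambda>i y. \<Sum>j\<in>J. F j i y)"
  using assms by (induction J rule: infinite_finite_induct) (auto intro: symbol_on_add symbol_on_zero)

lemma symbol_on_mult:
  assumes "symbol_on m d D F" "symbol_on m e D G"
  shows "symbol_on m (d + e) D (\<lambda>i y. F i y * G i y)"
proof -
  have base: "symbol_on 0 (d + e) D (\<lambda>i y. F i y * G i y)"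
    if "symbol_on 0 d D F" "symbol_on 0 e D G" for d e F G
  proof -
    from that(1) obtain C where C: "C \<ge> 0" "\<And>i y. (i, y) \<in> D \<Longrightarrow> \<bar>F i y\<bar> \<le> C * norm y powr d" using symbol_on_0E by metis
    from that(2) obtain C' where C': "\<And>i y. (i, y) \<in> D \<Longrightarrow> \<bar>G i y\<bar> \<le> C' * norm y powr e" using symbol_on_0E by metis
    have "\<bar>F i y * G i y\<bar> \<le> (C * C') * norm y powr (d + e)" if "(i, y) \<in> D" for i y
      using mult_mono[OF C(2)[OF that] C'[OF that]] C(1) by (simp add: abs_mult powr_add mult_ac)
    then show ?thesis by (rule symbol_on_0I)
  qed
  show ?thesis using assms
  proof (induction m arbitrary: d e F G)
    case (Suc m)
    obtain F' where F': "\<And>i y. (i, y) \<in> D \<Longrightarrow> (F i has_derivative F' i y) (at y)"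
      "\<And>w. symbol_on m (d - 1) D (\<lambda>i y. F' i y w)" "symbol_on 0 d D F" using Suc.prems(1) symbol_on_SucE by metis
    obtain G' where G': "\<And>i y. (i, y) \<in> D \<Longrightarrow> (G i has_derivative G' i y) (at y)"
      "\<And>w. symbol_on m (e - 1) D (\<lambda>i y. G' i y w)" "symbol_on 0 e D G" using Suc.prems(2) symbol_on_SucE by metis
    show ?case
    proof (rule symbol_on_SucI[OF base[OF F'(3) G'(3)], where F'="\<lambda>i y w. F i y * G' i y w + F' i y w * G i y"])
      fix i y assume "(i, y) \<in> D"
      then show "((\<lambda>y. F i y * G i y) has_derivative (\<lambda>w. F i y * G' i y w + F' i y w * G i y)) (at y)"
        by (intro has_derivative_mult F' G')
    next
      fix w
      have "symbol_on m (d + (e - 1)) D (\<lambda>i y. F i y * G' i y w)"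
        by (rule Suc.IH[OF symbol_on_SucD[OF Suc.prems(1)] G'(2)])
      moreover have "symbol_on m (d - 1 + e) D (\<lambda>i y. F' i y w * G i y)"
        by (rule Suc.IH[OF F'(2) symbol_on_SucD[OF Suc.prems(2)]])
      ultimately show "symbol_on m (d + e - 1) D (\<lambda>i y. F i y * G' i y w + F' i y w * G i y)"
        by (intro symbol_on_add) (simp_all add: algebra_simps)
    qed
  qed (rule base)
qed

text \<open>
  When \<open>y\<close> enters a function only through \<open>\<tau>\<^sub>i |y|\<close> or \<open>\<tau>\<^sub>i y\<close>, a derivative produces a factor \<open>\<tau>\<^sub>i\<close> but
  no decay in \<open>|y|\<close>. As \<open>\<tau>\<^sub>i |y|\<close> is bounded, that factor is worth one negative power of \<open>|y|\<close>.
\<close>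

lemma symbol_on_scale_gain:
  assumes "symbol_on m d D F" and D: "\<And>i y. (i, y) \<in> D \<Longrightarrow> y \<noteq> 0 \<and> \<bar>\<tau> i * norm y\<bar> \<le> \<rho>"
  shows "symbol_on m (d - 1) D (\<lambda>i y. \<tau> i * F i y)"
proof -
  have base: "symbol_on 0 (d - 1) D (\<lambda>i y. \<tau> i * F i y)" if "symbol_on 0 d D F" for d F
  proof -
    from that obtain C where C: "C \<ge> 0" "\<And>i y. (i, y) \<in> D \<Longrightarrow> \<bar>F i y\<bar> \<le> C * norm y powr d" using symbol_on_0E by metis
    have "\<bar>\<tau> i * F i y\<bar> \<le> (C * \<rho>) * norm y powr (d - 1)" if iy: "(i, y) \<in> D" for i y
    proof -
      have "\<bar>\<tau> i * F i y\<bar> \<le> \<bar>\<tau> i\<bar> * (C * norm y powr d)"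
        unfolding abs_mult by (intro mult_left_mono C(2)[OF iy]) simp
      also have "\<dots> = C * \<bar>\<tau> i * norm y\<bar> * norm y powr (d - 1)"
        using D[OF iy] by (simp add: abs_mult powr_diff)
      also have "\<dots> \<le> C * \<rho> * norm y powr (d - 1)"
        using D[OF iy] C(1) by (intro mult_right_mono mult_left_mono) auto
      finally show ?thesis .
    qed
    then show ?thesis by (rule symbol_on_0I)
  qed
  show ?thesis using assms(1)
  proof (induction m arbitrary: d F)
    case (Suc m)
    from Suc.prems obtain F' where F': "\<And>i y. (i, y) \<in> D \<Longrightarrow> (F i has_derivative F' i y) (at y)"
      "\<And>w. symbol_on m (d - 1) D (\<lambda>i y. F' i y w)" "symbol_on 0 d D F" using symbol_on_SucE by metis
    show ?case
      by (rule symbol_on_SucI[OF base[OF F'(3)] has_derivative_mult_right[OF F'(1)] Suc.IH[OF F'(2)]])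
  qed (rule base)
qed

text \<open>
  On the set where \<open>F i\<close> and its derivatives do not vanish, \<open>c i \<le> |y|\<close>, so that \<open>c i powr M\<close> can be traded
  for \<open>|y| powr M\<close>. This is the source of all error terms of arbitrarily high order.
\<close>

lemma symbol_on_vanish_gain:
  assumes "symbol_on m d D F" "\<And>i y. (i, y) \<in> D \<Longrightarrow> norm y < c i \<Longrightarrow> F i y = 0"
    "open_slices D" and c: "\<And>i y. (i, y) \<in> D \<Longrightarrow> c i > 0" and "M \<ge> 0"
  shows "symbol_on m (d + M) D (\<lambda>i y. c i powr M * F i y)"
proof -
  have base: "symbol_on 0 (d + M) D (\<lambda>i y. c i powr M * F i y)"
    if "symbol_on 0 d D F" and van: "\<And>i y. (i, y) \<in> D \<Longrightarrow> norm y < c i \<Longrightarrow> F i y = 0" for d F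
  proof -
    from that(1) obtain C where C: "C \<ge> 0" "\<And>i y. (i, y) \<in> D \<Longrightarrow> \<bar>F i y\<bar> \<le> C * norm y powr d" using symbol_on_0E by metis
    have "\<bar>c i powr M * F i y\<bar> \<le> C * norm y powr (d + M)" if D: "(i, y) \<in> D" for i y
    proof (cases "norm y < c i")
      case False
      have "\<bar>c i powr M * F i y\<bar> = c i powr M * \<bar>F i y\<bar>" by (simp add: abs_mult)
      also have "\<dots> \<le> norm y powr M * (C * norm y powr d)"
        using False c[OF D] \<open>M \<ge> 0\<close> C(2)[OF D] by (intro mult_mono powr_mono2) auto
      finally show ?thesis by (simp add: powr_add mult_ac)
    qed (use van D C in auto)
    then show ?thesis by (rule symbol_on_0I)
  qed
  show ?thesis using assms(1,2)
  proof (induction m arbitrary: d F)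
    case (Suc m)
    obtain F' where F': "\<And>i y. (i, y) \<in> D \<Longrightarrow> (F i has_derivative F' i y) (at y)"
      "\<And>w. symbol_on m (d - 1) D (\<lambda>i y. F' i y w)" "symbol_on 0 d D F" using Suc.prems(1) symbol_on_SucE by metis
    show ?case
    proof (rule symbol_on_SucI[OF base[OF F'(3) Suc.prems(2)], where F'="\<lambda>i y w. c i powr M * F' i y w"])
      fix i y assume "(i, y) \<in> D"
      then show "((\<lambda>y. c i powr M * F i y) has_derivative (\<lambda>w. c i powr M * F' i y w)) (at y)"
        by (intro has_derivative_mult_right F')
    next
      fix w
      have "F' i y w = 0" if D: "(i, y) \<in> D" and n: "norm y < c i" for i y
      proof -
        have "open ({y. (i, y) \<in> D} \<inter> ball 0 (c i))" using assms(3) by (auto simp: open_slices_def)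
        then have "((\<lambda>_. 0) has_derivative F' i y) (at y)"
          using F'(1)[OF D] D n Suc.prems(2)
          by (subst has_derivative_cong_open[of "{y. (i, y) \<in> D} \<inter> ball 0 (c i)" y _ "F i"]) auto
        moreover have "((\<lambda>_. 0) has_derivative (\<lambda>_. 0::real)) (at y)" by simp
        ultimately show ?thesis using has_derivative_unique by metis
      qed
      then have "symbol_on m (d - 1 + M) D (\<lambda>i y. c i powr M * F' i y w)"
        by (intro Suc.IH F'(2))
      then show "symbol_on m (d + M - 1) D (\<lambda>i y. c i powr M * F' i y w)" by (simp add: algebra_simps)
    qed
  qed (auto intro: base simp del: symbol_on.simps)
qed

lemma symbol_on_Un:
  assumes "symbol_on m d D F" "symbol_on m d E F" "open_slices D" "open_slices E"
  shows "symbol_on m d (D \<union> E) F"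
proof -
  have base: "symbol_on 0 d (D \<union> E) F" if "symbol_on 0 d D F" "symbol_on 0 d E F" for d F
  proof -
    from that(1) obtain C where C: "C \<ge> 0" "\<And>i y. (i, y) \<in> D \<Longrightarrow> \<bar>F i y\<bar> \<le> C * norm y powr d" using symbol_on_0E by metis
    from that(2) obtain C' where C': "C' \<ge> 0" "\<And>i y. (i, y) \<in> E \<Longrightarrow> \<bar>F i y\<bar> \<le> C' * norm y powr d" using symbol_on_0E by metis
    have "\<bar>F i y\<bar> \<le> max C C' * norm y powr d" if "(i, y) \<in> D \<union> E" for i y
      using that C(2)[of i y] C'(2)[of i y] mult_right_mono[of C "max C C'" "norm y powr d"]
        mult_right_mono[of C' "max C C'" "norm y powr d"] by auto
    then show ?thesis by (rule symbol_on_0I)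
  qed
  show ?thesis using assms(1,2)
  proof (induction m arbitrary: d F)
    case (Suc m)
    obtain F' where F': "\<And>i y. (i, y) \<in> D \<Longrightarrow> (F i has_derivative F' i y) (at y)"
      "\<And>w. symbol_on m (d - 1) D (\<lambda>i y. F' i y w)" "symbol_on 0 d D F" using Suc.prems(1) symbol_on_SucE by metis
    obtain G' where G': "\<And>i y. (i, y) \<in> E \<Longrightarrow> (F i has_derivative G' i y) (at y)"
      "\<And>w. symbol_on m (d - 1) E (\<lambda>i y. G' i y w)" "symbol_on 0 d E F" using Suc.prems(2) symbol_on_SucE by metis
    define H where "H i y = (if (i, y) \<in> D then F' i y else G' i y)" for i y
    have HE: "H i y = G' i y" if "(i, y) \<in> E" for i y
      using has_derivative_unique[OF F'(1) G'(1)] that by (auto simp: H_def)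
    show ?case
    proof (rule symbol_on_SucI[OF base[OF F'(3) G'(3)]])
      show "(F i has_derivative H i y) (at y)" if "(i, y) \<in> D \<union> E" for i y
        using that F'(1) G'(1) HE by (auto simp: H_def)
      show "symbol_on m (d - 1) (D \<union> E) (\<lambda>i y. H i y w)" for w
        by (rule Suc.IH; rule symbol_on_cong[OF _ _ F'(2)[of w]] symbol_on_cong[OF _ _ G'(2)[of w]])
          (use assms(3,4) HE in \<open>auto simp: H_def\<close>)
    qed
  qed (rule base)
qed

section \<open>Homogeneous functions, cutoffs and translates as symbols\<close>

text \<open>
  Differentiating \<open>N (r, c y) = c\<^sup>e N (r, y)\<close>: derivatives in \<open>r\<close> stay homogeneous of degree \<open>e\<close> in \<open>y\<close>,
  derivatives in \<open>y\<close> are homogeneous of degree \<open>e - 1\<close>.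
\<close>

lemma homogeneous_derivative:
  fixes N :: "real \<times> 'a::euclidean_space \<Rightarrow> real"
  assumes smooth: "Cinf_on ({-R<..<R} \<times> -{0}) N"
    and hom: "\<And>r y c. \<bar>r\<bar> < R \<Longrightarrow> y \<noteq> 0 \<Longrightarrow> c > 0 \<Longrightarrow> N (r, c *\<^sub>R y) = c powr e * N (r, y)"
    and "\<bar>r\<bar> < R" "y \<noteq> 0" "c > 0"
  shows "frechet_derivative N (at (r, c *\<^sub>R y)) (a, c *\<^sub>R w) = c powr e * frechet_derivative N (at (r, y)) (a, w)"
proof -
  let ?U = "{-R<..<R} \<times> (-{0}::'a set)"
  have op: "open ?U" by (intro open_Times) auto
  have in_U: "(r, c *\<^sub>R y) \<in> ?U" using assms by auto
  have "((\<lambda>z. N (fst z, c *\<^sub>R snd z)) has_derivative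
      (\<lambda>w. frechet_derivative N (at (r, c *\<^sub>R y)) (fst w, c *\<^sub>R snd w))) (at (r, y))"
    by (rule has_derivative_compose[where g=N and f="\<lambda>z. (fst z, c *\<^sub>R snd z)", simplified])
      (auto intro!: derivative_eq_intros Cinf_on_has_derivative[OF smooth in_U])
  moreover have "((\<lambda>z. N (fst z, c *\<^sub>R snd z)) has_derivative
      (\<lambda>w. c powr e * frechet_derivative N (at (r, y)) w)) (at (r, y))"
  proof (subst has_derivative_cong_open[OF op, of _ _ "\<lambda>z. c powr e * N z"])
    show "(r, y) \<in> ?U" using assms by auto
    then show "((\<lambda>z. c powr e * N z) has_derivative (\<lambda>w. c powr e * frechet_derivative N (at (r, y)) w)) (at (r, y))"
      by (intro has_derivative_mult_right Cinf_on_has_derivative[OF smooth])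
  next
    fix z assume "z \<in> ?U"
    then show "N (fst z, c *\<^sub>R snd z) = c powr e * N z"
      using hom[of "fst z" "snd z" c] \<open>c > 0\<close> by (cases z) (auto simp: abs_less_iff)
  qed
  ultimately have "(\<lambda>w. frechet_derivative N (at (r, c *\<^sub>R y)) (fst w, c *\<^sub>R snd w))
      = (\<lambda>w. c powr e * frechet_derivative N (at (r, y)) w)"
    by (rule has_derivative_unique)
  from fun_cong[OF this, of "(a, w)"] show ?thesis by simp
qed

lemma has_derivative_radial:
  fixes N :: "real \<times> 'a::euclidean_space \<Rightarrow> real"
  assumes "y \<noteq> 0" and N: "(N has_derivative N') (at (t * norm y, y))"
  shows "((\<lambda>y. N (t * norm y, y)) has_derivative (\<lambda>w. N' (t * ((y \<bullet> w) * norm y powr (-1)), w))) (at y)"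
proof -
  have "((\<lambda>y. (t * norm y, y)) has_derivative (\<lambda>w. (t * ((y \<bullet> w) * norm y powr (-1)), w))) (at y)"
    apply (rule has_derivative_Pair)
     apply (rule has_derivative_mult_right)
     apply (rule has_derivative_eq_rhs[OF has_derivative_norm])
    using assms(1) by (auto simp: sgn_div_norm powr_minus inner_commute divide_inverse)
  from has_derivative_compose[of "\<lambda>y. (t * norm y, y)" _ y UNIV N N', OF this N] show ?thesis .
qed

text \<open>
  By homogeneity a bound on the compact set \<open>[-\<rho>, \<rho>] \<times> sphere\<close> gives the bound for \<open>N\<close> itself. The
  derivative is a sum of two functions of the same kind: one comes from differentiating in \<open>y\<close> and has
  degree \<open>e - 1\<close>; the other comes from \<open>\<tau>\<^sub>i |y|\<close>, has degree \<open>e\<close>, but carries a factor \<open>\<tau>\<^sub>i\<close>.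
\<close>

lemma symbol_on_homogeneous:
  fixes N :: "real \<times> 'a::euclidean_space \<Rightarrow> real"
  assumes "Cinf_on ({-R<..<R} \<times> -{0}) N"
    and "\<And>r y c. \<bar>r\<bar> < R \<Longrightarrow> y \<noteq> 0 \<Longrightarrow> c > 0 \<Longrightarrow> N (r, c *\<^sub>R y) = c powr e * N (r, y)"
    and \<rho>: "\<rho> < R"
    and D: "\<And>i y. (i, y) \<in> D \<Longrightarrow> y \<noteq> 0 \<and> \<bar>\<tau> i * norm y\<bar> \<le> \<rho>"
    and slices: "open_slices D"
  shows "symbol_on m e D (\<lambda>i y. N (\<tau> i * norm y, y))"
proof -
  let ?U = "{-R<..<R} \<times> (-{0}::'a set)"
  have op: "open ?U" by (intro open_Times) auto
  have \<tau>\<rho>: "\<bar>\<tau> i * norm y\<bar> \<le> \<rho>" if "(i, y) \<in> D" for i y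
    using D[OF that] by blast
  have base: "symbol_on 0 e D (\<lambda>i y. N (\<tau> i * norm y, y))"
    if N: "Cinf_on ?U N"
      "\<And>r y c. \<bar>r\<bar> < R \<Longrightarrow> y \<noteq> 0 \<Longrightarrow> c > 0 \<Longrightarrow> N (r, c *\<^sub>R y) = c powr e * N (r, y)" for N :: "real \<times> 'a \<Rightarrow> real" and e
  proof -
    have sub: "{-\<rho>..\<rho>} \<times> sphere 0 1 \<subseteq> ?U" using \<rho> by auto
    have "compact (N ` ({-\<rho>..\<rho>} \<times> sphere 0 1))"
      by (intro compact_continuous_image compact_Times continuous_on_subset[OF Cinf_on_imp_continuous_on[OF N(1)] sub]) auto
    then obtain C where C: "\<And>z. z \<in> {-\<rho>..\<rho>} \<times> sphere 0 1 \<Longrightarrow> \<bar>N z\<bar> \<le> C"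
      unfolding compact_eq_bounded_closed bounded_iff by auto
    have "\<bar>N (\<tau> i * norm y, y)\<bar> \<le> C * norm y powr e" if "(i, y) \<in> D" for i y
    proof -
      have "N (\<tau> i * norm y, norm y *\<^sub>R (y /\<^sub>R norm y)) = norm y powr e * N (\<tau> i * norm y, y /\<^sub>R norm y)"
        using D[OF that] \<tau>\<rho>[OF that] \<rho> by (intro N(2)) auto
      moreover have "norm y *\<^sub>R (y /\<^sub>R norm y) = y" using D[OF that] by simp
      ultimately have eq: "N (\<tau> i * norm y, y) = norm y powr e * N (\<tau> i * norm y, y /\<^sub>R norm y)" by metis
      have "\<bar>N (\<tau> i * norm y, y /\<^sub>R norm y)\<bar> \<le> C"
        using D[OF that] \<tau>\<rho>[OF that] by (intro C) (auto simp: abs_le_iff)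
      from mult_right_mono[OF this powr_ge_zero[of "norm y" e]] show ?thesis
        unfolding eq by (simp only: abs_mult abs_of_nonneg[OF powr_ge_zero] mult.commute)
    qed
    then show ?thesis by (rule symbol_on_0I)
  qed
  show ?thesis using assms(1,2)
  proof (induction m arbitrary: e N)
    case (Suc m)
    let ?DN = "\<lambda>z. frechet_derivative N (at z)"
    have inU: "(\<tau> i * norm y, y) \<in> ?U" if "(i, y) \<in> D" for i y
      using \<tau>\<rho>[OF that] D[OF that] \<rho> by (auto simp: abs_le_iff)
    have lin: "?DN z (a, w) = a * ?DN z (1, 0) + ?DN z (0, w)" if "z \<in> ?U" for z a w
    proof -
      have "linear (?DN z)"
        using Cinf_on_has_derivative[OF Suc.prems(1) that] has_derivative_linear by blast
      from linear_add[OF this, of "a *\<^sub>R (1, 0)" "(0, w)"] linear_cmul[OF this, of a "(1, 0)"]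
      show ?thesis by simp
    qed
    show ?case
    proof (rule symbol_on_SucI[OF base[OF Suc.prems], where
          F'="\<lambda>i y w. ?DN (\<tau> i * norm y, y) (\<tau> i * ((y \<bullet> w) * norm y powr (-1)), w)"])
      fix i y assume iy: "(i, y) \<in> D"
      show "((\<lambda>y. N (\<tau> i * norm y, y)) has_derivative
          (\<lambda>w. ?DN (\<tau> i * norm y, y) (\<tau> i * ((y \<bullet> w) * norm y powr (-1)), w))) (at y)"
        using D[OF iy] by (intro has_derivative_radial Cinf_on_has_derivative[OF Suc.prems(1) inU[OF iy]]) simp
    next
      fix w
      define N1 where "N1 z = ?DN z (1, 0) * (z \<bullet> (0, w) * norm (snd z) powr (-1))" for z
      have "Cinf_on ?U N1" unfolding N1_def
      proof (intro Cinf_on_mult op Cinf_on_frechet Suc.prems(1) Cinf_on_norm_powr)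
        show "Cinf_on ?U (\<lambda>z. z \<bullet> (0, w))" unfolding Cinf_on_def using Ck_on_inner[OF op] by blast
        show "Cinf_on ?U (\<lambda>z. snd z \<bullet> b)" for b
          using Ck_on_inner[OF op, of _ "(0, b)"] by (simp add: Cinf_on_def inner_prod_def)
      qed auto
      moreover have "N1 (r, c *\<^sub>R y) = c powr e * N1 (r, y)" if "\<bar>r\<bar> < R" "y \<noteq> 0" "c > 0" for r y c
        using homogeneous_derivative[OF Suc.prems that, of 1 0] that
        by (simp add: N1_def inner_prod_def powr_mult powr_minus)
      ultimately have "symbol_on m e D (\<lambda>i y. N1 (\<tau> i * norm y, y))" by (rule Suc.IH)
      then have 1: "symbol_on m (e - 1) D (\<lambda>i y. \<tau> i * N1 (\<tau> i * norm y, y))"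
        by (rule symbol_on_scale_gain[where \<rho>=\<rho>]) (rule D)
      have 2: "symbol_on m (e - 1) D (\<lambda>i y. ?DN (\<tau> i * norm y, y) (0, w))"
      proof (rule Suc.IH[OF Cinf_on_frechet[OF Suc.prems(1)]])
        fix r c :: real and y :: 'a assume that: "\<bar>r\<bar> < R" "y \<noteq> 0" "c > 0"
        have "linear (?DN (r, c *\<^sub>R y))"
          using that Cinf_on_has_derivative[OF Suc.prems(1), of "(r, c *\<^sub>R y)"] has_derivative_linear by (auto simp: abs_less_iff)
        from linear_cmul[OF this, of c "(0, w)"]
        have "c * ?DN (r, c *\<^sub>R y) (0, w) = c powr e * ?DN (r, y) (0, w)"
          using homogeneous_derivative[OF Suc.prems that, of 0 w] by simp
        then show "?DN (r, c *\<^sub>R y) (0, w) = c powr (e - 1) * ?DN (r, y) (0, w)"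
          using that by (simp add: powr_diff field_simps)
      qed
      have eq: "?DN (\<tau> i * norm y, y) (\<tau> i * ((y \<bullet> w) * norm y powr (-1)), w)
          = \<tau> i * N1 (\<tau> i * norm y, y) + ?DN (\<tau> i * norm y, y) (0, w)" if "(i, y) \<in> D" for i y
        by (subst lin[OF inU[OF that]]) (simp add: N1_def inner_prod_def)
      show "symbol_on m (e - 1) D (\<lambda>i y. ?DN (\<tau> i * norm y, y) (\<tau> i * ((y \<bullet> w) * norm y powr (-1)), w))"
        by (rule symbol_on_cong[OF slices _ symbol_on_add[OF 1 2]]) (rule eq[symmetric])
    qed
  qed (rule base)
qed

lemma symbol_on_homogeneous_function:
  fixes H :: "'a::euclidean_space \<Rightarrow> real"
  assumes H: "Cinf_on (-{0}) H" "\<And>c y. y \<noteq> 0 \<Longrightarrow> c > 0 \<Longrightarrow> H (c *\<^sub>R y) = c powr d * H y"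
    and "\<And>i y. (i, y) \<in> D \<Longrightarrow> y \<noteq> 0" "open_slices D"
  shows "symbol_on m d D (\<lambda>i. H)"
proof -
  have op: "open ({-1<..<1::real} \<times> (-{0::'a}))" by (intro open_Times) auto
  have "Cinf_on ({-1<..<1::real} \<times> (-{0})) (\<lambda>z. H (snd z))"
  proof (rule Cinf_on_compose[OF op H(1)])
    fix b :: 'a
    show "Cinf_on ({-1<..<1::real} \<times> (-{0})) (\<lambda>z. snd z \<bullet> b)"
      using Ck_on_inner[OF op, of _ "(0, b)"] by (simp add: Cinf_on_def inner_prod_def)
  qed auto
  from symbol_on_homogeneous[OF this, of d 0 D "\<lambda>_. 0" m] show ?thesis using assms(2-4) by simp
qed

lemma compact_support_bounded:
  fixes \<eta> :: "'a::euclidean_space \<Rightarrow> real"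
  assumes "Cinf_on UNIV \<eta>" "\<And>x. norm x > B \<Longrightarrow> \<eta> x = 0"
  obtains K where "K \<ge> 0" "\<And>x. \<bar>\<eta> x\<bar> \<le> K"
proof -
  have "compact (\<eta> ` cball 0 B)"
    by (intro compact_continuous_image continuous_on_subset[OF Cinf_on_imp_continuous_on[OF assms(1)]]) auto
  then obtain C where "\<forall>z\<in>\<eta> ` cball 0 B. norm z \<le> C"
    unfolding compact_eq_bounded_closed bounded_iff by blast
  then have C: "\<bar>\<eta> z\<bar> \<le> C" if "z \<in> cball 0 B" for z using that by auto
  have "\<bar>\<eta> x\<bar> \<le> max C 0" for x
    using C[of x] assms(2)[of x] by (cases "norm x \<le> B") auto
  then show thesis using that[of "max C 0"] by auto
qed

lemma frechet_derivative_vanish: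
  fixes \<eta> :: "'a::euclidean_space \<Rightarrow> real"
  assumes "\<And>x. norm x > B \<Longrightarrow> \<eta> x = 0" "norm x > B"
  shows "frechet_derivative \<eta> (at x) w = 0"
proof -
  have "open {x::'a. norm x > B}" by (intro open_Collect_less continuous_intros)
  then have "frechet_derivative \<eta> (at x) = frechet_derivative (\<lambda>_. 0) (at x)"
    by (rule frechet_derivative_cong_open) (use assms in auto)
  then show ?thesis by simp
qed

text \<open>
  The estimate \<open>|D\<^sup>j \<eta>(x)| \<le> C |x|\<^bsup>-j\<^esup>\<close> holds because \<open>\<eta>\<close> has bounded support, and it is invariant under
  dilations. The power of \<open>1 / s i\<close> is needed for the induction; the case of interest is \<open>e = 0\<close>.
\<close>

lemma symbol_on_dilated_cutoff:
  fixes \<eta> :: "'a::euclidean_space \<Rightarrow> real"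
  assumes "Cinf_on UNIV \<eta>" "\<And>x. norm x > B \<Longrightarrow> \<eta> x = 0"
    and D: "\<And>i y. (i, y) \<in> D \<Longrightarrow> s i > 0 \<and> y \<noteq> 0"
  shows "symbol_on m (- real e) D (\<lambda>i y. (1 / s i) ^ e * \<eta> (y /\<^sub>R s i))"
proof -
  have base: "symbol_on 0 (- real e) D (\<lambda>i y. (1 / s i) ^ e * \<eta> (y /\<^sub>R s i))"
    if \<eta>: "Cinf_on UNIV \<eta>" "\<And>x. norm x > B \<Longrightarrow> \<eta> x = 0" for e and \<eta> :: "'a \<Rightarrow> real"
  proof -
    from compact_support_bounded[OF \<eta>] obtain K where K: "K \<ge> 0" "\<And>x. \<bar>\<eta> x\<bar> \<le> K" by metis
    have "\<bar>(1 / s i) ^ e * \<eta> (y /\<^sub>R s i)\<bar> \<le> (\<bar>B\<bar> ^ e * K) * norm y powr (- real e)" if "(i, y) \<in> D" for i y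
    proof -
      note y = D[OF that]
      have "\<bar>(norm y / s i) ^ e * \<eta> (y /\<^sub>R s i)\<bar> \<le> \<bar>B\<bar> ^ e * K"
      proof (cases "norm (y /\<^sub>R s i) > B")
        case False
        then have "norm y / s i \<le> B" using y by (simp add: field_simps)
        then have "norm y / s i \<le> \<bar>B\<bar>" by linarith
        then show ?thesis using K y
          by (auto simp: abs_mult power_abs intro!: mult_mono power_mono)
      qed (use \<eta>(2) K in auto)
      from mult_right_mono[OF this powr_ge_zero[of "norm y" "- real e"]]
      have "\<bar>(norm y / s i) ^ e * norm y powr (- real e) * \<eta> (y /\<^sub>R s i)\<bar> \<le> \<bar>B\<bar> ^ e * K * norm y powr (- real e)"
        by (simp only: abs_mult abs_of_nonneg[OF powr_ge_zero] mult_ac)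
      moreover have "(norm y / s i) ^ e * norm y powr (- real e) = (1 / s i) ^ e"
        using y by (simp add: powr_minus powr_realpow power_divide)
      ultimately show ?thesis by simp
    qed
    then show ?thesis by (rule symbol_on_0I)
  qed
  show ?thesis using assms(1,2)
  proof (induction m arbitrary: e \<eta>)
    case (Suc m)
    let ?D = "\<lambda>x. frechet_derivative \<eta> (at x)"
    show ?case
    proof (rule symbol_on_SucI[OF base[OF Suc.prems], where
        F'="\<lambda>i y w. (1 / s i) ^ Suc e * ?D (y /\<^sub>R s i) w"])
      fix i y assume iy: "(i, y) \<in> D"
      have "((\<lambda>y. y /\<^sub>R s i) has_derivative (\<lambda>w. w /\<^sub>R s i)) (at y)" by (auto intro!: derivative_eq_intros)
      then have "((\<lambda>y. \<eta> (y /\<^sub>R s i)) has_derivative (\<lambda>w. ?D (y /\<^sub>R s i) (w /\<^sub>R s i))) (at y)"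
        using Cinf_on_has_derivative[OF Suc.prems(1) UNIV_I] by (rule has_derivative_compose)
      moreover have "linear (?D (y /\<^sub>R s i))"
        using Cinf_on_has_derivative[OF Suc.prems(1)] has_derivative_linear by blast
      ultimately have "((\<lambda>y. \<eta> (y /\<^sub>R s i)) has_derivative (\<lambda>w. ?D (y /\<^sub>R s i) w / s i)) (at y)"
        by (simp add: linear_cmul divide_inverse mult.commute)
      from has_derivative_mult_right[OF this, of "(1 / s i) ^ e"]
      show "((\<lambda>y. (1 / s i) ^ e * \<eta> (y /\<^sub>R s i)) has_derivative (\<lambda>w. (1 / s i) ^ Suc e * ?D (y /\<^sub>R s i) w)) (at y)"
        by (simp add: mult_ac)
    next
      fix w
      have "symbol_on m (- real (Suc e)) D (\<lambda>i y. (1 / s i) ^ Suc e * ?D (y /\<^sub>R s i) w)"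
        by (rule Suc.IH[OF Cinf_on_frechet[OF Suc.prems(1)] frechet_derivative_vanish[OF Suc.prems(2)]])
      moreover have "- real (Suc e) = - real e - 1" by simp
      ultimately show "symbol_on m (- real e - 1) D (\<lambda>i y. (1 / s i) ^ Suc e * ?D (y /\<^sub>R s i) w)"
        by (simp only:)
    qed
  qed (rule base)
qed

lemma symbol_on_translate:
  fixes v :: "'a::euclidean_space \<Rightarrow> real"
  assumes "Cinf_on UNIV v" "\<And>x. norm x > B \<Longrightarrow> v x = 0"
    and D: "\<And>i y. (i, y) \<in> D \<Longrightarrow> y \<noteq> 0 \<and> \<bar>\<tau> i * norm y\<bar> \<le> \<rho>"
  shows "symbol_on m 0 D (\<lambda>i y. v (\<tau> i *\<^sub>R y + a i))"
proof -
  have base: "symbol_on 0 0 D (\<lambda>i y. v (\<tau> i *\<^sub>R y + a i))"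
    if v: "Cinf_on UNIV v" "\<And>x. norm x > B \<Longrightarrow> v x = 0" for v :: "'a \<Rightarrow> real"
  proof -
    from compact_support_bounded[OF v] obtain K where K: "K \<ge> 0" "\<And>x. \<bar>v x\<bar> \<le> K" by metis
    show ?thesis by (rule symbol_on_0I[of _ _ K]) (use K D in auto)
  qed
  show ?thesis using assms(1,2)
  proof (induction m arbitrary: v)
    case (Suc m)
    let ?D = "\<lambda>x. frechet_derivative v (at x)"
    show ?case
    proof (rule symbol_on_SucI[OF base[OF Suc.prems], where
        F'="\<lambda>i y w. \<tau> i * ?D (\<tau> i *\<^sub>R y + a i) w"])
      fix i y assume iy: "(i, y) \<in> D"
      have "((\<lambda>y. \<tau> i *\<^sub>R y + a i) has_derivative (\<lambda>w. \<tau> i *\<^sub>R w)) (at y)" by (auto intro!: derivative_eq_intros)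
      then have "((\<lambda>y. v (\<tau> i *\<^sub>R y + a i)) has_derivative (\<lambda>w. ?D (\<tau> i *\<^sub>R y + a i) (\<tau> i *\<^sub>R w))) (at y)"
        using Cinf_on_has_derivative[OF Suc.prems(1) UNIV_I] by (rule has_derivative_compose)
      moreover have "linear (?D (\<tau> i *\<^sub>R y + a i))"
        using Cinf_on_has_derivative[OF Suc.prems(1)] has_derivative_linear by blast
      ultimately show "((\<lambda>y. v (\<tau> i *\<^sub>R y + a i)) has_derivative (\<lambda>w. \<tau> i * ?D (\<tau> i *\<^sub>R y + a i) w)) (at y)"
        by (simp add: linear_cmul)
    next
      fix w
      have "symbol_on m 0 D (\<lambda>i y. ?D (\<tau> i *\<^sub>R y + a i) w)"
        by (rule Suc.IH[OF Cinf_on_frechet[OF Suc.prems(1)] frechet_derivative_vanish[OF Suc.prems(2)]])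
      then show "symbol_on m (0 - 1) D (\<lambda>i y. \<tau> i * ?D (\<tau> i *\<^sub>R y + a i) w)"
        by (rule symbol_on_scale_gain[where \<rho>=\<rho>]) (rule D)
    qed
  qed (rule base)
qed

section \<open>Iterated differences\<close>

fun fdiff :: "'a::real_vector list \<Rightarrow> ('a \<Rightarrow> real) \<Rightarrow> 'a \<Rightarrow> real" where
  "fdiff [] f x = f x"
| "fdiff (w # ws) f x = fdiff ws f (x + w) - fdiff ws f x"

lemma fdiff_sum: "fdiff ws (\<lambda>x. \<Sum>j\<in>J. c j * f j x) y = (\<Sum>j\<in>J. c j * fdiff ws (f j) y)"
  by (induction ws arbitrary: y) (auto simp: sum_subtractf right_diff_distrib)

lemma fdiff_diff: "fdiff ws (\<lambda>x. f x - g x) y = fdiff ws f y - fdiff ws g y"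
  by (induction ws arbitrary: y) auto

lemma fdiff_shift: "fdiff ws (\<lambda>x. f (x + a)) y = fdiff ws f (y + a)"
  by (induction ws arbitrary: y) (auto simp: add_ac)

lemma fdiff_scale: "fdiff ws (\<lambda>x. f (c *\<^sub>R x)) y = fdiff (map (\<lambda>w. c *\<^sub>R w) ws) f (c *\<^sub>R y)"
  by (induction ws arbitrary: y) (auto simp: scaleR_right_distrib)

text \<open>
  The bound on the steps keeps all points at which \<open>g\<close> is evaluated away from the origin.
\<close>

lemma fdiff_has_derivative:
  fixes g :: "'a::euclidean_space \<Rightarrow> real"
  assumes "\<And>y. y \<noteq> 0 \<Longrightarrow> (g has_derivative g' y) (at y)" "(\<Sum>w\<leftarrow>ws. norm w) < norm y"
  shows "(fdiff ws g has_derivative (\<lambda>w. fdiff ws (\<lambda>y. g' y w) y)) (at y)"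
  using assms(2)
proof (induction ws arbitrary: y)
  case Nil then show ?case using assms(1) by (auto intro: has_derivative_eq_rhs)
next
  case (Cons u ws)
  have "norm y \<le> norm (y + u) + norm u" using norm_triangle_ineq4[of "y + u" u] by simp
  then have 1: "(\<Sum>w\<leftarrow>ws. norm w) < norm (y + u)" using Cons.prems by simp
  have 2: "(\<Sum>w\<leftarrow>ws. norm w) < norm y" using Cons.prems norm_ge_zero[of u] by (simp del: norm_ge_zero)
  have "((\<lambda>y. fdiff ws g (y + u)) has_derivative (\<lambda>w. fdiff ws (\<lambda>y. g' y w) (y + u))) (at y)"
    by (rule has_derivative_compose[of "\<lambda>y. y + u" "\<lambda>w. w" y UNIV "fdiff ws g" "\<lambda>w. fdiff ws (\<lambda>y. g' y w) (y + u)"])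
      (auto intro!: derivative_eq_intros Cons.IH[OF 1])
  from has_derivative_diff[OF this Cons.IH[OF 2]] show ?case by simp
qed

lemma fdiff_has_real_derivative:
  fixes g :: "real \<Rightarrow> 'a::euclidean_space \<Rightarrow> real"
  assumes "\<And>y. y \<noteq> 0 \<Longrightarrow> ((\<lambda>t. g t y) has_real_derivative g' y) (at t)" "(\<Sum>w\<leftarrow>ws. norm w) < norm y"
  shows "((\<lambda>t. fdiff ws (g t) y) has_real_derivative fdiff ws g' y) (at t)"
  using assms(2)
proof (induction ws arbitrary: y)
  case Nil then show ?case using assms(1) by auto
next
  case (Cons u ws)
  have "norm y \<le> norm (y + u) + norm u" using norm_triangle_ineq4[of "y + u" u] by simp
  then have 1: "(\<Sum>w\<leftarrow>ws. norm w) < norm (y + u)" using Cons.prems by simp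
  have 2: "(\<Sum>w\<leftarrow>ws. norm w) < norm y" using Cons.prems norm_ge_zero[of u] by (simp del: norm_ge_zero)
  from DERIV_diff[OF Cons.IH[OF 1] Cons.IH[OF 2]] show ?case by simp
qed

lemma sum_list_norm_le:
  assumes "\<forall>w\<in>set ws. norm w \<le> r" shows "(\<Sum>w\<leftarrow>ws. norm w) \<le> real (length ws) * r"
  using assms by (induction ws) (auto simp: algebra_simps)

text \<open>
  Each of the \<open>m\<close> difference steps is turned into a derivative by the mean value theorem. The points
  involved all have norm between \<open>s/2\<close> and \<open>3s/2\<close>; working with the fixed scale \<open>s\<close> instead of \<open>|y|\<close> makes
  the induction go through although \<open>y\<close> moves at each step.
\<close>

lemma symbol_on_fdiff_bound_at_scale:
  fixes F :: "'i \<Rightarrow> 'a::euclidean_space \<Rightarrow> real"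
  assumes "symbol_on m d (I \<times> -{0}) F"
  shows "\<exists>C\<ge>0. \<forall>i\<in>I. \<forall>ws y r s. length ws = m \<longrightarrow> (\<forall>w\<in>set ws. norm w \<le> r) \<longrightarrow> s > 0 \<longrightarrow> r \<ge> 0 \<longrightarrow>
      s / 2 \<le> norm y - real m * r \<longrightarrow> norm y + real m * r \<le> 3 / 2 * s \<longrightarrow>
      \<bar>fdiff ws (F i) y\<bar> \<le> C * r ^ m * s powr (d - real m)"
  using assms
proof (induction m arbitrary: d F)
  case 0
  obtain C where C: "C \<ge> 0" "\<And>i y. (i, y) \<in> I \<times> -{0} \<Longrightarrow> \<bar>F i y\<bar> \<le> C * norm y powr d"
    using 0 symbol_on_0E by metis
  let ?M = "max ((1/2) powr d) ((3/2) powr d)"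
  have "\<bar>F i y\<bar> \<le> (C * ?M) * s powr d" if "i \<in> I" "s > 0" "s / 2 \<le> norm y" "norm y \<le> 3 / 2 * s" for i y s
  proof -
    have "y \<noteq> 0" using that by auto
    have "norm y powr d \<le> ?M * s powr d"
    proof (cases "d \<ge> 0")
      case True
      then have "norm y powr d \<le> (3 / 2 * s) powr d" using that by (intro powr_mono2) auto
      also have "\<dots> = (3 / 2) powr d * s powr d" using that by (subst powr_mult) auto
      also have "\<dots> \<le> ?M * s powr d" by (intro mult_right_mono) auto
      finally show ?thesis .
    next
      case False
      then have "norm y powr d \<le> (1 / 2 * s) powr d" using that by (intro powr_mono2') auto
      also have "\<dots> = (1 / 2) powr d * s powr d" using that by (subst powr_mult) auto
      also have "\<dots> \<le> ?M * s powr d" by (intro mult_right_mono) auto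
      finally show ?thesis .
    qed
    with C(2)[of i y] \<open>i \<in> I\<close> \<open>y \<noteq> 0\<close> mult_left_mono[OF this C(1)] show ?thesis by (auto simp: mult.assoc)
  qed
  moreover have "C * ?M \<ge> 0" using C(1) by (intro mult_nonneg_nonneg) (auto simp: le_max_iff_disj)
  ultimately show ?case by (intro exI[of _ "C * ?M"]) auto
next
  case (Suc m)
  obtain F' where F': "\<And>i y. (i, y) \<in> I \<times> -{0} \<Longrightarrow> (F i has_derivative F' i y) (at y)"
    "\<And>w. symbol_on m (d - 1) (I \<times> -{0}) (\<lambda>i y. F' i y w)" using Suc.prems symbol_on_SucE by metis
  have "\<forall>b. \<exists>C\<ge>0. \<forall>i\<in>I. \<forall>ws y r s. length ws = m \<longrightarrow> (\<forall>w\<in>set ws. norm w \<le> r) \<longrightarrow> s > 0 \<longrightarrow> r \<ge> 0 \<longrightarrow>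
      s / 2 \<le> norm y - real m * r \<longrightarrow> norm y + real m * r \<le> 3 / 2 * s \<longrightarrow>
      \<bar>fdiff ws (\<lambda>y. F' i y b) y\<bar> \<le> C * r ^ m * s powr (d - 1 - real m)"
    using Suc.IH[OF F'(2)] by blast
  then obtain C where C0: "\<And>b. C b \<ge> 0" and
    C: "\<And>b i ws y r s. i \<in> I \<Longrightarrow> length ws = m \<Longrightarrow> (\<forall>w\<in>set ws. norm w \<le> r) \<Longrightarrow> s > 0 \<Longrightarrow> r \<ge> 0 \<Longrightarrow>
      s / 2 \<le> norm y - real m * r \<Longrightarrow> norm y + real m * r \<le> 3 / 2 * s \<Longrightarrow>
      \<bar>fdiff ws (\<lambda>y. F' i y b) y\<bar> \<le> C b * r ^ m * s powr (d - 1 - real m)"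
    by metis
  show ?case
  proof (intro exI[of _ "\<Sum>b\<in>Basis. C b"] conjI sum_nonneg C0 ballI allI impI)
    fix i and ws :: "'a list" and y :: 'a and r s :: real
    assume i: "i \<in> I" and len: "length ws = Suc m" and r: "\<forall>w\<in>set ws. norm w \<le> r" and "s > 0" "r \<ge> 0"
      and lo: "s / 2 \<le> norm y - real (Suc m) * r" and hi: "norm y + real (Suc m) * r \<le> 3 / 2 * s"
    from len obtain u us where ws: "ws = u # us" "length us = m" by (cases ws) auto
    define p where "p t = y + t *\<^sub>R u" for t
    have us: "\<forall>w\<in>set us. norm w \<le> r" and u: "norm u \<le> r" using r ws by auto
    have p: "norm y - r \<le> norm (p t)" "norm (p t) \<le> norm y + r" if "0 \<le> t" "t \<le> 1" for t
    proof -
      have "norm (t *\<^sub>R u) \<le> 1 * r" unfolding norm_scaleR using that u by (intro mult_mono) auto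
      then show "norm y - r \<le> norm (p t)" "norm (p t) \<le> norm y + r"
        using norm_triangle_ineq[of y "t *\<^sub>R u"] norm_diff_ineq[of y "t *\<^sub>R u"] unfolding p_def by linarith+
    qed
    have deriv: "((\<lambda>t. fdiff us (F i) (p t)) has_real_derivative fdiff us (\<lambda>y. F' i y u) (p t)) (at t)"
      if "0 \<le> t" "t \<le> 1" for t
    proof -
      have "(\<Sum>w\<leftarrow>us. norm w) \<le> real m * r" using sum_list_norm_le[OF us] ws by simp
      also have "\<dots> < norm (p t)" using p[OF that] lo \<open>s > 0\<close> by (simp add: algebra_simps)
      finally have "(fdiff us (F i) has_derivative (\<lambda>w. fdiff us (\<lambda>y. F' i y w) (p t))) (at (p t))"
        by (intro fdiff_has_derivative F'(1)) (use i in auto)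
      moreover have "(p has_derivative (\<lambda>h. h *\<^sub>R u)) (at t)"
        unfolding p_def by (auto intro!: derivative_eq_intros)
      ultimately have D: "((\<lambda>t. fdiff us (F i) (p t)) has_derivative (\<lambda>h. fdiff us (\<lambda>y. F' i y (h *\<^sub>R u)) (p t))) (at t)"
        using has_derivative_compose[of p "\<lambda>h. h *\<^sub>R u" t UNIV "fdiff us (F i)" "\<lambda>w. fdiff us (\<lambda>y. F' i y w) (p t)"] by blast
      then have "fdiff us (\<lambda>y. F' i y (h *\<^sub>R u)) (p t) = h * fdiff us (\<lambda>y. F' i y (1 *\<^sub>R u)) (p t)" for h
        using linear_cmul[OF has_derivative_linear[OF D], of h 1] by simp
      with D show ?thesis by (simp add: has_field_derivative_def mult_commute_abs)
    qed
    have "\<exists>t. 0 < t \<and> t < 1 \<and> fdiff us (F i) (p 1) - fdiff us (F i) (p 0) = (1 - 0) * fdiff us (\<lambda>y. F' i y u) (p t)"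
      by (rule MVT2) (auto intro: deriv)
    then obtain t where t: "0 < t" "t < 1" and
      eq: "fdiff ws (F i) y = fdiff us (\<lambda>y. F' i y u) (p t)" by (auto simp: ws p_def)
    have nz: "(\<Sum>w\<leftarrow>us. norm w) < norm (p t)"
    proof -
      have "(\<Sum>w\<leftarrow>us. norm w) \<le> real m * r" using sum_list_norm_le[OF us] ws by simp
      also have "\<dots> < norm (p t)" using p[of t] t lo \<open>s > 0\<close> by (simp add: algebra_simps)
      finally show ?thesis .
    qed
    have "linear (\<lambda>w. fdiff us (\<lambda>y. F' i y w) (p t))"
      using fdiff_has_derivative[of "F i" "F' i" us "p t"] nz F'(1) i has_derivative_linear by auto
    from linear_sum[OF this, of "\<lambda>b. (u \<bullet> b) *\<^sub>R b" Basis]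
    have "fdiff us (\<lambda>y. F' i y u) (p t) = (\<Sum>b\<in>Basis. (u \<bullet> b) * fdiff us (\<lambda>y. F' i y b) (p t))"
      by (simp add: euclidean_representation linear_cmul[OF \<open>linear _\<close>])
    also have "\<bar>\<dots>\<bar> \<le> (\<Sum>b\<in>Basis. r * (C b * r ^ m * s powr (d - 1 - real m)))"
    proof (intro order.trans[OF sum_abs] sum_mono)
      fix b :: 'a assume "b \<in> Basis"
      have "\<bar>u \<bullet> b\<bar> \<le> r" using Basis_le_norm[OF \<open>b \<in> Basis\<close>, of u] u by simp
      moreover have "\<bar>fdiff us (\<lambda>y. F' i y b) (p t)\<bar> \<le> C b * r ^ m * s powr (d - 1 - real m)"
        using p[of t] t lo hi \<open>s > 0\<close> \<open>r \<ge> 0\<close> by (intro C[OF i ws(2) us]) (auto simp: algebra_simps)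
      ultimately show "\<bar>(u \<bullet> b) * fdiff us (\<lambda>y. F' i y b) (p t)\<bar> \<le> r * (C b * r ^ m * s powr (d - 1 - real m))"
        unfolding abs_mult using \<open>r \<ge> 0\<close> by (intro mult_mono) auto
    qed
    also have "\<dots> = (\<Sum>b\<in>Basis. C b) * r ^ Suc m * s powr (d - real (Suc m))"
      by (simp add: sum_distrib_right sum_distrib_left mult_ac algebra_simps)
    finally show "\<bar>fdiff ws (F i) y\<bar> \<le> (\<Sum>b\<in>Basis. C b) * r ^ Suc m * s powr (d - real (Suc m))"
      unfolding eq .
  qed
qed

text \<open>
  The symbol estimate of order \<open>m\<close> in the form in which it is used: with differences in place of
  derivatives, it makes sense for Taylor remainders without differentiating them.
  The condition \<open>2 m r \<le> |y|\<close> keeps the points \<open>y + \<Sum> ws\<close> at a distance comparable to \<open>|y|\<close> from the origin.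
\<close>

definition diff_bound :: "nat \<Rightarrow> real \<Rightarrow> real \<Rightarrow> ('a::real_normed_vector \<Rightarrow> real) \<Rightarrow> bool" where
  "diff_bound m d C G \<longleftrightarrow> (\<forall>y ws r. y \<noteq> 0 \<longrightarrow> length ws = m \<longrightarrow> r \<ge> 0 \<longrightarrow> (\<forall>w\<in>set ws. norm w \<le> r) \<longrightarrow>
     2 * real m * r \<le> norm y \<longrightarrow> \<bar>fdiff ws G y\<bar> \<le> C * r ^ m * norm y powr (d - real m))"

lemma symbol_on_imp_diff_bound:
  assumes "symbol_on m d (I \<times> -{0}) F"
  obtains C where "C \<ge> 0" "\<And>i. i \<in> I \<Longrightarrow> diff_bound m d C (F i)"
proof -
  from symbol_on_fdiff_bound_at_scale[OF assms] obtain C where C0: "C \<ge> 0" and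
    C: "\<And>i ws y r s. i \<in> I \<Longrightarrow> length ws = m \<Longrightarrow> (\<forall>w\<in>set ws. norm w \<le> r) \<Longrightarrow> s > 0 \<Longrightarrow> r \<ge> 0 \<Longrightarrow>
      s / 2 \<le> norm y - real m * r \<Longrightarrow> norm y + real m * r \<le> 3 / 2 * s \<Longrightarrow>
      \<bar>fdiff ws (F i) y\<bar> \<le> C * r ^ m * s powr (d - real m)" by blast
  have "diff_bound m d C (F i)" if "i \<in> I" for i
    unfolding diff_bound_def by (intro allI impI C[OF that]) auto
  with C0 that show thesis by blast
qed

text \<open>
  Here \<open>K j\<close> is the \<open>j\<close>-th derivative in \<open>t\<close> divided by \<open>j!\<close>. Differences in \<open>y\<close> commute with
  differentiation in \<open>t\<close>, since they are finite linear combinations. So the Lagrange form of the remainder for the scalar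
  function \<open>t \<mapsto> fdiff ws (K 0 i t) y\<close> bounds the difference of the remainder by one of \<open>K (Suc p) i t\<close>.
\<close>

lemma taylor_remainder_diff_bound:
  fixes K :: "nat \<Rightarrow> 'i \<Rightarrow> real \<Rightarrow> 'a::euclidean_space \<Rightarrow> real"
  assumes deriv: "\<And>j i t y. j \<le> p \<Longrightarrow> i \<in> I \<Longrightarrow> 0 \<le> t \<Longrightarrow> t \<le> 1 \<Longrightarrow> y \<noteq> 0 \<Longrightarrow>
      ((\<lambda>t. K j i t y) has_real_derivative (real (Suc j) * K (Suc j) i t y)) (at t)"
    and sym: "symbol_on m d ((I \<times> {0..1}) \<times> -{0}) (\<lambda>(i, t). K (Suc p) i t)"
  obtains C where "C \<ge> 0" "\<And>i. i \<in> I \<Longrightarrow> diff_bound m d C (\<lambda>y. K 0 i 1 y - (\<Sum>j\<le>p. K j i 0 y))"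
proof -
  obtain C where C0: "C \<ge> 0" and C: "\<And>it. it \<in> I \<times> {0..1} \<Longrightarrow> diff_bound m d C ((\<lambda>(i, t). K (Suc p) i t) it)"
    using symbol_on_imp_diff_bound[OF sym] by metis
  have "diff_bound m d C (\<lambda>y. K 0 i 1 y - (\<Sum>j\<le>p. K j i 0 y))" if i: "i \<in> I" for i
    unfolding diff_bound_def
  proof (intro allI impI)
    fix y :: 'a and ws :: "'a list" and r assume y: "y \<noteq> 0" and ws: "length ws = m" "r \<ge> 0" "\<forall>w\<in>set ws. norm w \<le> r"
      "2 * real m * r \<le> norm y"
    define D where "D j t = fact j * fdiff ws (K j i t) y" for j t
    have small: "(\<Sum>w\<leftarrow>ws. norm w) < norm y"
    proof -
      have "(\<Sum>w\<leftarrow>ws. norm w) \<le> real m * r" using sum_list_norm_le[OF ws(3)] ws(1) by simp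
      also have "\<dots> \<le> norm y / 2" using ws(4) by simp
      also have "\<dots> < norm y" using y by simp
      finally show ?thesis .
    qed
    have cmul: "fdiff ws (\<lambda>y. c * g y) y = c * fdiff ws g y" for c g
      using fdiff_sum[of ws "\<lambda>_. c" "\<lambda>_. g" "{()}" y] by simp
    have "\<forall>j t. j < Suc p \<and> 0 \<le> t \<and> t \<le> 1 \<longrightarrow> DERIV (D j) t :> D (Suc j) t"
    proof (intro allI impI)
      fix j t assume j: "j < Suc p \<and> 0 \<le> t \<and> t \<le> (1::real)"
      have "((\<lambda>t. fdiff ws (K j i t) y) has_real_derivative fdiff ws (\<lambda>y. real (Suc j) * K (Suc j) i t y) y) (at t)"
        by (rule fdiff_has_real_derivative[OF _ small]) (use deriv i j in auto)
      from DERIV_cmult[OF this, of "fact j"] show "DERIV (D j) t :> D (Suc j) t"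
        unfolding D_def cmul by (simp add: mult_ac)
    qed
    then obtain t where t: "0 < t" "t < 1"
      and eq: "D 0 1 = (\<Sum>j<Suc p. D j 0 / fact j * 1 ^ j) + D (Suc p) t / fact (Suc p) * 1 ^ Suc p"
      using Maclaurin[of 1 "Suc p" D "D 0"] by auto
    have "fdiff ws (\<lambda>y. K 0 i 1 y - (\<Sum>j\<le>p. K j i 0 y)) y = fdiff ws (K 0 i 1) y - (\<Sum>j\<le>p. fdiff ws (K j i 0) y)"
      using fdiff_sum[of ws "\<lambda>_. 1" "\<lambda>j. K j i 0" "{..p}" y] by (simp add: fdiff_diff)
    also have "\<dots> = fdiff ws (K (Suc p) i t) y"
      using eq by (simp add: D_def lessThan_Suc_atMost del: fact_Suc)
    finally show "\<bar>fdiff ws (\<lambda>y. K 0 i 1 y - (\<Sum>j\<le>p. K j i 0 y)) y\<bar> \<le> C * r ^ m * norm y powr (d - real m)"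
      using C[of "(i, t)"] i t y ws by (simp add: diff_bound_def)
  qed
  with C0 that show thesis by blast
qed

lemma diff_bound_scale:
  assumes "diff_bound m d C G" "h > 0"
  shows "diff_bound m d (C * h powr d) (\<lambda>y. G (h *\<^sub>R y))"
  unfolding diff_bound_def
proof (intro allI impI)
  fix y :: 'a and ws :: "'a list" and r :: real
  assume y: "y \<noteq> 0" "length ws = m" "r \<ge> 0" "\<forall>w\<in>set ws. norm w \<le> r" "2 * real m * r \<le> norm y"
  have small: "\<forall>w\<in>set (map (\<lambda>w. h *\<^sub>R w) ws). norm w \<le> h * r"
    using y(4) assms(2) by (auto intro: mult_left_mono)
  have "\<bar>fdiff (map (\<lambda>w. h *\<^sub>R w) ws) G (h *\<^sub>R y)\<bar> \<le> C * (h * r) ^ m * norm (h *\<^sub>R y) powr (d - real m)"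
    using assms(1)[unfolded diff_bound_def, rule_format, of "h *\<^sub>R y" "map (\<lambda>w. h *\<^sub>R w) ws" "h * r"] y assms(2)
      mult_left_mono[OF y(5), of h] small
    by (auto simp: mult_ac simp del: set_map)
  also have "\<dots> = C * h powr d * r ^ m * norm y powr (d - real m)"
    using assms(2) y(1) by (simp add: powr_mult power_mult_distrib powr_diff powr_realpow field_simps)
  finally show "\<bar>fdiff ws (\<lambda>y. G (h *\<^sub>R y)) y\<bar> \<le> C * h powr d * r ^ m * norm y powr (d - real m)"
    by (simp add: fdiff_scale)
qed

section \<open>Lattice sums and cell averages\<close>

lemma borel_measurable_shift:
  fixes F :: "'a::euclidean_space \<Rightarrow> real"
  assumes "F \<in> borel_measurable borel" shows "(\<lambda>x. F (c + x)) \<in> borel_measurable borel"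
  using assms by simp

lemma integrable_lborel_shift:
  fixes F :: "'a::euclidean_space \<Rightarrow> real"
  assumes "integrable lborel F" shows "integrable lborel (\<lambda>x. F (c + x))"
  using assms integrable_distr[of "(+) c" lborel borel F] by (simp add: lborel_distr_plus)

lemma integral_lborel_shift:
  fixes F :: "'a::euclidean_space \<Rightarrow> real"
  assumes "F \<in> borel_measurable borel" shows "(\<integral>x. F (c + x) \<partial>lborel) = (\<integral>x. F x \<partial>lborel)"
  using assms integral_distr[of "(+) c" lborel borel F] by (simp add: lborel_distr_plus)

lemma integrable_lborel_cmult_indicator:
  fixes F :: "'a::euclidean_space \<Rightarrow> real"
  assumes "integrable lborel F" "A \<in> sets borel" shows "integrable lborel (\<lambda>x. indicator A x * F x)"
  using integrable_mult_indicator[OF _ assms(1), of A] assms(2) by simp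

text \<open>
  The unit cell is half open, so that its lattice translates form a partition of the space.
\<close>

definition cell :: "(real ^ 'n) set" where
  "cell = {w. \<forall>i. 0 \<le> w $ i \<and> w $ i < 1}"

lemma cell_measurable [measurable]: "cell \<in> sets borel"
proof -
  have "cell = (\<Inter>i. {w::real ^ 'n. 0 \<le> w $ i} \<inter> {w. w $ i < 1})" by (auto simp: cell_def)
  also have "\<dots> \<in> sets borel"
    by (intro sets.countable_INT'' sets.Int borel_closed borel_open closed_Collect_le open_Collect_less continuous_intros) auto
  finally show ?thesis .
qed

lemma emeasure_cell: "emeasure lborel (cell :: (real ^ 'n) set) = 1"
proof (rule antisym)
  have vol: "(\<Prod>b\<in>Basis. (1 - 0 :: real ^ 'n) \<bullet> b) = 1"
    by (intro prod.neutral) (auto simp: Basis_vec_def inner_axis)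
  have le: "(0 :: real ^ 'n) \<bullet> b \<le> 1 \<bullet> b" if "b \<in> Basis" for b
    using that by (auto simp: Basis_vec_def inner_axis)
  have "cell \<subseteq> cbox 0 (1 :: real ^ 'n)" by (auto simp: cell_def mem_box_cart less_imp_le)
  then have "emeasure lborel (cell :: (real ^ 'n) set) \<le> emeasure lborel (cbox 0 (1 :: real ^ 'n))"
    by (intro emeasure_mono) auto
  also have "\<dots> = 1" using emeasure_lborel_cbox[OF le] vol by simp
  finally show "emeasure lborel (cell :: (real ^ 'n) set) \<le> 1" .
  have "box 0 (1 :: real ^ 'n) \<subseteq> cell" by (auto simp: cell_def mem_box_cart less_imp_le)
  then have "emeasure lborel (box 0 (1 :: real ^ 'n)) \<le> emeasure lborel (cell :: (real ^ 'n) set)"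
    by (intro emeasure_mono) auto
  moreover have "emeasure lborel (box 0 (1 :: real ^ 'n)) = 1"
    using emeasure_lborel_box[OF le] vol by simp
  ultimately show "1 \<le> emeasure lborel (cell :: (real ^ 'n) set)" by simp
qed

lemma integrable_cell: "integrable lborel (indicator cell :: real ^ 'n \<Rightarrow> real)"
  by (rule integrable_real_indicator) (auto simp: emeasure_cell)

lemma measure_cell [simp]: "measure lborel (cell :: (real ^ 'n) set) = 1"
  by (simp add: emeasure_cell measure_def)

lemma norm_cell: 
  fixes w :: "real ^ 'n" assumes "w \<in> cell" shows "norm w \<le> real CARD('n)"
proof -
  have "norm w \<le> (\<Sum>i\<in>UNIV. \<bar>w $ i\<bar>)" by (rule norm_le_l1_cart)
  also have "\<dots> \<le> (\<Sum>i\<in>(UNIV::'n set). 1)"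
    using assms by (intro sum_mono) (auto simp: cell_def abs_le_iff less_imp_le intro: order.trans[of _ 0])
  finally show ?thesis by simp
qed

lemma finite_lattice_cball: "finite ((int_lattice :: (real ^ 'n) set) \<inter> cball 0 R)"
proof -
  let ?S = "(int_lattice :: (real ^ 'n) set) \<inter> cball 0 R"
  let ?T = "real_of_int ` {-\<lceil>R\<rceil>..\<lceil>R\<rceil>}"
  have "vec_nth ` ?S \<subseteq> PiE UNIV (\<lambda>_. ?T)"
  proof (rule image_subsetI)
    fix z assume z: "z \<in> ?S"
    have "z $ i \<in> ?T" for i
    proof -
      obtain k where k: "z $ i = real_of_int k" using z by (auto simp: int_lattice_def elim: Ints_cases)
      have "\<bar>z $ i\<bar> \<le> R" using component_le_norm_cart[of z i] z by simp
      then have "k \<in> {-\<lceil>R\<rceil>..\<lceil>R\<rceil>}" unfolding k by simp linarith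
      then show "z $ i \<in> ?T" using k by auto
    qed
    then show "vec_nth z \<in> PiE UNIV (\<lambda>_. ?T)" by (simp add: PiE_UNIV_domain)
  qed
  moreover have "finite (PiE (UNIV::'n set) (\<lambda>_. ?T))" by (intro finite_PiE) auto
  ultimately have "finite (vec_nth ` ?S)" by (rule finite_subset)
  then show ?thesis by (rule finite_imageD) (auto simp: inj_on_def Finite_Cartesian_Product.vec_nth_inject)
qed

lemma lattice_cell_unique:
  fixes x :: "real ^ 'n"
  assumes "z \<in> int_lattice" "z' \<in> int_lattice" "x - z \<in> cell" "x - z' \<in> cell"
  shows "z = z'"
proof (rule Finite_Cartesian_Product.vec_eq_iff[THEN iffD2], rule allI)
  fix i
  have "z $ i \<in> \<int>" "z' $ i \<in> \<int>" using assms(1,2) by (auto simp: int_lattice_def)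
  then obtain k k' where k: "z $ i = real_of_int k" "z' $ i = real_of_int k'" by (metis Ints_cases)
  have "0 \<le> x $ i - z $ i \<and> x $ i - z $ i < 1" "0 \<le> x $ i - z' $ i \<and> x $ i - z' $ i < 1"
    using assms(3,4) by (auto simp: cell_def)
  then have "\<bar>real_of_int k - real_of_int k'\<bar> < 1" unfolding k by linarith
  then have "k = k'" by linarith
  then show "z $ i = z' $ i" using k by simp
qed

lemma lattice_cell_exists:
  fixes x :: "real ^ 'n"
  obtains z where "z \<in> int_lattice" "x - z \<in> cell"
proof
  show "(\<chi> i. real_of_int \<lfloor>x $ i\<rfloor>) \<in> int_lattice" by (auto simp: int_lattice_def)
  show "x - (\<chi> i. real_of_int \<lfloor>x $ i\<rfloor>) \<in> cell" by (auto simp: cell_def) linarith+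
qed

lemma sum_indicator_cell_le:
  assumes "finite Z" "Z \<subseteq> int_lattice"
  shows "(\<Sum>z\<in>Z. indicator cell (x - z)) \<le> (1::real)"
proof (cases "\<exists>z\<in>Z. x - z \<in> cell")
  case True
  then obtain z where z: "z \<in> Z" "x - z \<in> cell" by blast
  have "indicator cell (x - z') = (if z' = z then 1 else 0 :: real)" if "z' \<in> Z" for z'
    using lattice_cell_unique[of z z' x] z that assms(2) by (auto simp: indicator_def)
  then have "(\<Sum>z\<in>Z. indicator cell (x - z)) = (\<Sum>z'\<in>Z. if z' = z then 1 else 0 :: real)" by (intro sum.cong) auto
  then show ?thesis using assms(1) by simp
qed (auto simp: indicator_def)

lemma sum_indicator_cell_eq:
  fixes x :: "real ^ 'n"
  assumes "norm x + real CARD('n) \<le> R"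
  shows "(\<Sum>z\<in>int_lattice \<inter> cball 0 R. indicator cell (x - z)) = (1::real)"
proof -
  obtain z where z: "z \<in> int_lattice" "x - z \<in> cell" by (rule lattice_cell_exists)
  have "norm z \<le> norm x + norm (x - z)" using norm_triangle_ineq4[of x "x - z"] by simp
  then have "z \<in> cball 0 R" using norm_cell[OF z(2)] assms by simp
  have "x - z' \<in> cell \<longleftrightarrow> z' = z" if "z' \<in> int_lattice" for z'
    using lattice_cell_unique[OF that z(1) _ z(2)] z(2) by blast
  then have "indicator cell (x - z') = (if z' = z then 1 else 0 :: real)" if "z' \<in> int_lattice" for z'
    using that by (simp add: indicator_def)
  then have "(\<Sum>z\<in>int_lattice \<inter> cball 0 R. indicator cell (x - z)) = (\<Sum>z'\<in>int_lattice \<inter> cball 0 R. if z' = z then 1 else (0 :: real))"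
    by (intro sum.cong) auto
  also have "\<dots> = 1" using finite_lattice_cball[of R] z(1) \<open>z \<in> cball 0 R\<close> by (subst sum.delta) auto
  finally show ?thesis .
qed

definition cell_avg :: "(real ^ 'n \<Rightarrow> real) \<Rightarrow> real ^ 'n \<Rightarrow> real" where
  "cell_avg F x = (\<integral>w. indicator cell w * F (x + w) \<partial>lborel)"

text \<open>
  The operator \<open>A - 1\<close>, where \<open>A\<close> is the average over the cell.
\<close>

definition cell_dev :: "(real ^ 'n \<Rightarrow> real) \<Rightarrow> real ^ 'n \<Rightarrow> real" where
  "cell_dev F x = cell_avg F x - F x"

lemma integrable_cell_translate:
  fixes F :: "real ^ 'n \<Rightarrow> real"
  assumes "integrable lborel F"
  shows "integrable lborel (\<lambda>w. indicator cell w * F (x + w))"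
  by (rule integrable_lborel_cmult_indicator[OF integrable_lborel_shift[OF assms] cell_measurable])

lemma cell_avg_alt:
  assumes "integrable lborel F"
  shows "cell_avg F z = (\<integral>x. indicator cell (x - z) * F x \<partial>lborel)"
    and "integrable lborel (\<lambda>x. indicator cell (x - z) * F x)"
proof -
  have F: "F \<in> borel_measurable borel" using borel_measurable_integrable[OF assms] by simp
  have "(\<lambda>x. indicator cell (x - z) * F x) \<in> borel_measurable borel" using F by measurable
  from integral_lborel_shift[OF this, of z]
  show "cell_avg F z = (\<integral>x. indicator cell (x - z) * F x \<partial>lborel)" by (simp add: cell_avg_def)
  have "integrable lborel (\<lambda>x. indicator ((\<lambda>x. x - z) -` cell) x * F x)"
    by (rule integrable_lborel_cmult_indicator[OF assms])
      (use measurable_sets[of "\<lambda>x. x - z" borel borel cell] in auto)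
  then show "integrable lborel (\<lambda>x. indicator cell (x - z) * F x)" by (simp add: indicator_def vimage_def)
qed

text \<open>
  The average at \<open>z\<close> is the integral over the cell at \<open>z\<close>, and the cells tile the space.
\<close>

lemma lattice_sum_cell_avg:
  fixes F :: "real ^ 'n \<Rightarrow> real"
  assumes F: "integrable lborel F" and supp: "\<And>x. norm x > R \<Longrightarrow> F x = 0" and R': "R' \<ge> R + real CARD('n)"
  shows "(\<Sum>z\<in>int_lattice \<inter> cball 0 R'. cell_avg F z) = (\<integral>x. F x \<partial>lborel)"
proof -
  have "(\<Sum>z\<in>int_lattice \<inter> cball 0 R'. cell_avg F z)
      = (\<integral>x. (\<Sum>z\<in>int_lattice \<inter> cball 0 R'. indicator cell (x - z) * F x) \<partial>lborel)"
    unfolding cell_avg_alt(1)[OF F]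
    by (rule Bochner_Integration.integral_sum[symmetric]) (rule cell_avg_alt(2)[OF F])
  also have "\<dots> = (\<integral>x. F x \<partial>lborel)"
  proof (rule Bochner_Integration.integral_cong[OF refl])
    fix x :: "real ^ 'n"
    show "(\<Sum>z\<in>int_lattice \<inter> cball 0 R'. indicator cell (x - z) * F x) = F x"
    proof (cases "F x = 0")
      case False
      then have "norm x \<le> R" using supp by force
      then have "(\<Sum>z\<in>int_lattice \<inter> cball 0 R'. indicator cell (x - z)) = (1::real)"
        using R' by (intro sum_indicator_cell_eq) auto
      then show ?thesis by (simp flip: sum_distrib_right)
    qed simp
  qed
  finally show ?thesis .
qed

lemma cell_avg_integral:
  fixes F :: "real ^ 'n \<Rightarrow> real"
  assumes F: "integrable lborel F"
  shows "integrable lborel (cell_avg F)" "(\<integral>x. cell_avg F x \<partial>lborel) = (\<integral>x. F x \<partial>lborel)"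
proof -
  have Fm [measurable]: "F \<in> borel_measurable borel" using borel_measurable_integrable[OF F] by simp
  have "integrable (lborel \<Otimes>\<^sub>M lborel) (\<lambda>(w, x). indicator cell w * F (x + w))"
  proof (rule lborel_pair.Fubini_integrable)
    have "(\<integral>x. norm (case (w, x) of (w, x) \<Rightarrow> indicator cell w * F (x + w)) \<partial>lborel)
        = indicator cell w * (\<integral>x. \<bar>F x\<bar> \<partial>lborel)" for w
      using integral_lborel_shift[of "\<lambda>x. \<bar>F x\<bar>" w] by (simp add: abs_mult add.commute)
    then show "integrable lborel (\<lambda>w. \<integral>x. norm (case (w, x) of (w, x) \<Rightarrow> indicator cell w * F (x + w)) \<partial>lborel)"
      by (simp only: integrable_cell integrable_mult_left_iff integrable_mult_left)
    show "AE w in lborel. integrable lborel (\<lambda>x. case (w, x) of (w, x) \<Rightarrow> indicator cell w * F (x + w))"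
      using integrable_lborel_shift[OF F] by (auto simp: add.commute)
  qed simp
  then have I: "integrable (lborel \<Otimes>\<^sub>M lborel) (case_prod (\<lambda>w x. indicator cell w * F (x + w)))" by simp
  show "integrable lborel (cell_avg F)"
    using lborel_pair.integrable_snd[OF I] by (simp add: cell_avg_def[abs_def])
  have "(\<integral>x. cell_avg F x \<partial>lborel) = (\<integral>w. (\<integral>x. indicator cell w * F (x + w) \<partial>lborel) \<partial>lborel)"
    unfolding cell_avg_def by (rule lborel_pair.Fubini_integral[OF I])
  also have "\<dots> = (\<integral>w. indicator cell w * (\<integral>x. F x \<partial>lborel) \<partial>(lborel :: (real ^ 'n) measure))"
    using integral_lborel_shift[OF Fm] by (simp add: add.commute)
  finally show "(\<integral>x. cell_avg F x \<partial>lborel) = (\<integral>x. F x \<partial>lborel)" by (simp add: measure_cell)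
qed

text \<open>
  The class of functions on which \<open>cell_dev\<close> acts; the radius of the support is tracked because it
  increases with each application.
\<close>

definition integrable_supp :: "real \<Rightarrow> (real ^ 'n \<Rightarrow> real) \<Rightarrow> bool" where
  "integrable_supp R F \<longleftrightarrow> integrable lborel F \<and> (\<forall>x. norm x > R \<longrightarrow> F x = 0)"

lemma integrable_supp_cell_dev:
  fixes F :: "real ^ 'n \<Rightarrow> real"
  assumes "integrable_supp R F" shows "integrable_supp (R + real CARD('n)) (cell_dev F)"
proof -
  have "cell_dev F x = 0" if x: "norm x > R + real CARD('n)" for x
  proof -
    have "indicator cell w * F (x + w) = 0" for w
    proof (cases "w \<in> cell")
      case True
      have "norm (x + w) > R" using norm_diff_ineq[of x w] norm_cell[OF True] x by linarith
      then show ?thesis using assms by (auto simp: integrable_supp_def)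
    qed simp
    moreover have "F x = 0" using assms x by (auto simp: integrable_supp_def)
    ultimately show ?thesis by (simp only: cell_dev_def cell_avg_def) simp
  qed
  then show ?thesis using assms cell_avg_integral(1)
    by (auto simp: integrable_supp_def cell_dev_def[abs_def])
qed

lemma integrable_supp_cell_dev_pow:
  fixes F :: "real ^ 'n \<Rightarrow> real"
  assumes "integrable_supp R F" shows "integrable_supp (R + real k * real CARD('n)) ((cell_dev ^^ k) F)"
proof (induction k)
  case (Suc k)
  have "R + real k * real CARD('n) + real CARD('n) = R + real (Suc k) * real CARD('n)"
    by (simp add: algebra_simps)
  with integrable_supp_cell_dev[OF Suc.IH] show ?case by (simp only: funpow.simps o_apply)
qed (use assms in simp)

text \<open>
  For \<open>m = 1\<close> this is the tiling property. Since \<open>(A - 1)\<^sup>k F\<close> has integral zero for \<open>k \<ge> 1\<close>, the tiling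
  property applied to it says that replacing it by \<open>(A - 1)\<^bsup>k+1\<^esup> F\<close> only changes the sign of the lattice sum.
\<close>

lemma lattice_error_cell_dev:
  fixes F :: "real ^ 'n \<Rightarrow> real"
  assumes F: "integrable_supp R F" and R': "R' \<ge> R + real m * real CARD('n)" and "m > 0"
  shows "\<bar>(\<integral>x. F x \<partial>lborel) - (\<Sum>z\<in>int_lattice \<inter> cball 0 R'. F z)\<bar>
      = \<bar>\<Sum>z\<in>int_lattice \<inter> cball 0 R'. (cell_dev ^^ m) F z\<bar>"
  using assms(2,3)
proof (induction m)
  case (Suc m)
  define G where "G = (cell_dev ^^ m) F"
  have G: "integrable_supp (R + real m * real CARD('n)) G"
    unfolding G_def by (rule integrable_supp_cell_dev_pow[OF F])
  have "(\<Sum>z\<in>int_lattice \<inter> cball 0 R'. cell_avg G z) = (\<integral>x. G x \<partial>lborel)"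
    by (rule lattice_sum_cell_avg) (use G Suc.prems in \<open>auto simp: integrable_supp_def algebra_simps\<close>)
  then have eq: "(\<Sum>z\<in>int_lattice \<inter> cball 0 R'. (cell_dev ^^ Suc m) F z)
      = (\<integral>x. G x \<partial>lborel) - (\<Sum>z\<in>int_lattice \<inter> cball 0 R'. G z)"
    by (simp add: G_def cell_dev_def sum_subtractf)
  show ?case
  proof (cases m)
    case 0 then show ?thesis using eq by (simp add: G_def)
  next
    case (Suc k)
    have H: "integrable lborel ((cell_dev ^^ k) F)"
      using integrable_supp_cell_dev_pow[OF F] by (auto simp: integrable_supp_def)
    then have "(\<integral>x. G x \<partial>lborel) = 0"
      by (simp add: G_def Suc cell_dev_def[abs_def] cell_avg_integral)
    moreover have "\<bar>(\<integral>x. F x \<partial>lborel) - (\<Sum>z\<in>int_lattice \<inter> cball 0 R'. F z)\<bar>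
        = \<bar>\<Sum>z\<in>int_lattice \<inter> cball 0 R'. G z\<bar>"
      unfolding G_def by (rule Suc.IH) (use Suc.prems Suc in \<open>auto simp: algebra_simps\<close>)
    ultimately show ?thesis using eq by simp
  qed
qed simp

lemma cell_avg_diff:
  assumes "integrable lborel F" "integrable lborel G"
  shows "cell_avg (\<lambda>x. F x - G x) x = cell_avg F x - cell_avg G x"
  unfolding cell_avg_def right_diff_distrib
  by (rule Bochner_Integration.integral_diff[OF assms[THEN integrable_cell_translate]])

lemma cell_dev_pow_difference:
  fixes F :: "real ^ 'n \<Rightarrow> real"
  assumes F: "integrable_supp R F"
  shows "(cell_dev ^^ k) (\<lambda>y. F (y + w) - F y) = (\<lambda>x. (cell_dev ^^ k) F (x + w) - (cell_dev ^^ k) F x)"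
proof (induction k)
  case (Suc k)
  define G where "G = (cell_dev ^^ k) F"
  have G: "integrable lborel G"
    using integrable_supp_cell_dev_pow[OF F] by (auto simp: integrable_supp_def G_def)
  have "integrable lborel (\<lambda>x. G (x + w))"
    using integrable_lborel_shift[OF G, of w] by (simp add: add.commute)
  from cell_avg_diff[OF this G] have "cell_avg (\<lambda>x. G (x + w) - G x) x = cell_avg G (x + w) - cell_avg G x" for x
    by (simp add: cell_avg_def add.assoc add.commute[of w])
  then have "cell_dev (\<lambda>x. G (x + w) - G x) = (\<lambda>x. cell_dev G (x + w) - cell_dev G x)"
    by (auto simp: cell_dev_def)
  then show ?case using Suc.IH by (simp only: funpow.simps o_apply G_def)
qed simp

lemma cell_average_bound:
  fixes \<phi> :: "real ^ 'n \<Rightarrow> real"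
  assumes "\<And>w. w \<in> cell \<Longrightarrow> \<bar>\<phi> w\<bar> \<le> M" "M \<ge> 0"
  shows "\<bar>\<integral>w. indicator cell w * \<phi> w \<partial>lborel\<bar> \<le> M"
proof -
  have "\<bar>\<integral>w. indicator cell w * \<phi> w \<partial>lborel\<bar> \<le> (\<integral>w. \<bar>indicator cell w * \<phi> w\<bar> \<partial>lborel)"
    using integral_norm_bound[of lborel "\<lambda>w. indicator cell w * \<phi> w"] by simp
  also have "\<dots> \<le> (\<integral>w. indicator cell w * M \<partial>(lborel :: (real ^ 'n) measure))"
    using assms by (intro integral_mono' integrable_mult_left integrable_cell) (auto simp: indicator_def)
  also have "\<dots> = M" by (simp add: measure_cell)
  finally show ?thesis .
qed

text \<open>
  \<open>(A - 1)\<^sup>m F (x)\<close> is the average of \<open>fdiff ws F x\<close> over all \<open>ws\<close> in the cell. The average is peeled off one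
  step at a time, with \<open>F\<close> replaced by its first difference, so that no multiple integral appears.
\<close>

lemma cell_dev_pow_le_fdiff:
  fixes F :: "real ^ 'n \<Rightarrow> real"
  assumes "integrable_supp R F" "M \<ge> 0"
    "\<And>ws. length ws = m \<Longrightarrow> set ws \<subseteq> cell \<Longrightarrow> \<bar>fdiff ws F x\<bar> \<le> M"
  shows "\<bar>(cell_dev ^^ m) F x\<bar> \<le> M"
  using assms(1,3)
proof (induction m arbitrary: F R)
  case 0 then show ?case using 0(2)[of "[]"] by simp
next
  case (Suc m)
  define G where "G = (cell_dev ^^ m) F"
  have G: "integrable lborel G"
    using integrable_supp_cell_dev_pow[OF Suc.prems(1)] by (auto simp: integrable_supp_def G_def)
  have "\<bar>G (x + w) - G x\<bar> \<le> M" if w: "w \<in> cell" for w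
  proof -
    have "integrable_supp (R + real CARD('n)) (\<lambda>y. F (y + w) - F y)"
      unfolding integrable_supp_def
    proof (intro conjI allI impI)
      show "integrable lborel (\<lambda>y. F (y + w) - F y)"
        using Suc.prems(1) integrable_lborel_shift[of F w] by (simp add: integrable_supp_def add.commute)
      fix y :: "real ^ 'n" assume y: "norm y > R + real CARD('n)"
      have "norm (y + w) > R" using norm_diff_ineq[of y w] norm_cell[OF w] y by linarith
      moreover have "norm y > R" using y of_nat_0_le_iff[of "CARD('n)", where ?'a=real] by linarith
      ultimately show "F (y + w) - F y = 0" using Suc.prems(1) by (auto simp: integrable_supp_def)
    qed
    moreover have "\<bar>fdiff ws (\<lambda>y. F (y + w) - F y) x\<bar> \<le> M" if "length ws = m" "set ws \<subseteq> cell" for ws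
    proof -
      have "fdiff ws (\<lambda>y. F (y + w) - F y) x = fdiff (w # ws) F x"
        by (simp add: fdiff_diff fdiff_shift)
      then show ?thesis using Suc.prems(2)[of "w # ws"] that w by simp
    qed
    ultimately have "\<bar>(cell_dev ^^ m) (\<lambda>y. F (y + w) - F y) x\<bar> \<le> M" by (rule Suc.IH)
    then show ?thesis by (simp add: cell_dev_pow_difference[OF Suc.prems(1)] G_def)
  qed
  then have "\<bar>\<integral>w. indicator cell w * (G (x + w) - G x) \<partial>lborel\<bar> \<le> M"
    by (rule cell_average_bound[OF _ assms(2)])
  moreover have "(\<integral>w. indicator cell w * (G (x + w) - G x) \<partial>lborel)
      = cell_avg G x - (\<integral>w. indicator cell w * G x \<partial>(lborel :: (real ^ 'n) measure))"
    unfolding cell_avg_def right_diff_distrib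
    by (intro Bochner_Integration.integral_diff integrable_cell_translate[OF G] integrable_mult_left integrable_cell)
  moreover have "(\<integral>w. indicator cell w * G x \<partial>(lborel :: (real ^ 'n) measure)) = G x"
    by (simp add: measure_cell)
  moreover have "(cell_dev ^^ Suc m) F x = cell_avg G x - G x" by (simp add: G_def cell_dev_def[of G, unfolded G_def])
  ultimately show ?case by simp
qed

text \<open>
  Differences are not small near the singularity. The value at \<open>x\<close> itself is kept, and all other
  contributions are integrals of \<open>|F|\<close> over cells inside the ball of radius \<open>\<rho>\<close>.
\<close>

lemma cell_dev_pow_near:
  fixes F :: "real ^ 'n \<Rightarrow> real"
  assumes F: "integrable_supp R F" and "norm x + real k * real CARD('n) \<le> \<rho>"
  shows "\<bar>(cell_dev ^^ k) F x\<bar> \<le> \<bar>F x\<bar> + 3 ^ k * (\<integral>y. indicator (cball 0 \<rho>) y * \<bar>F y\<bar> \<partial>lborel)"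
  using assms(2)
proof (induction k arbitrary: x)
  case 0 then show ?case by (auto intro!: Bochner_Integration.integral_nonneg)
next
  case (Suc k)
  define G where "G = (cell_dev ^^ k) F"
  define K0 where "K0 = (\<integral>y. indicator (cball 0 \<rho>) y * \<bar>F y\<bar> \<partial>lborel)"
  have K0: "K0 \<ge> 0" unfolding K0_def by (auto intro!: Bochner_Integration.integral_nonneg)
  have Fi: "integrable lborel (\<lambda>y. \<bar>F y\<bar>)" using F by (auto simp: integrable_supp_def)
  have FK: "integrable lborel (\<lambda>y. indicator (cball 0 \<rho>) y * \<bar>F y\<bar>)"
    by (rule integrable_lborel_cmult_indicator[OF Fi]) auto
  have FKx: "integrable lborel (\<lambda>w. indicator (cball 0 \<rho>) (x + w) * \<bar>F (x + w)\<bar>)" for x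
    by (rule integrable_lborel_shift[OF FK])
  have near: "norm (x + w) + real k * real CARD('n) \<le> \<rho>" if "w \<in> cell" for w
    using norm_triangle_ineq[of x w] norm_cell[OF that] Suc.prems by (simp add: algebra_simps)
  have "\<bar>cell_avg G x\<bar> \<le> (\<integral>w. \<bar>indicator cell w * G (x + w)\<bar> \<partial>lborel)"
    unfolding cell_avg_def using integral_norm_bound[of lborel "\<lambda>w. indicator cell w * G (x + w)"] by simp
  also have "\<dots> \<le> (\<integral>w. indicator (cball 0 \<rho>) (x + w) * \<bar>F (x + w)\<bar> + indicator cell w * (3 ^ k * K0) \<partial>lborel)"
  proof (rule integral_mono')
    show "integrable lborel (\<lambda>w. indicator (cball 0 \<rho>) (x + w) * \<bar>F (x + w)\<bar> + indicator cell w * (3 ^ k * K0))"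
      by (intro Bochner_Integration.integrable_add FKx integrable_mult_left integrable_cell)
    fix w
    show "0 \<le> indicator (cball 0 \<rho>) (x + w) * \<bar>F (x + w)\<bar> + indicator cell w * (3 ^ k * K0)"
      using K0 by (auto simp: indicator_def)
    show "\<bar>indicator cell w * G (x + w)\<bar> \<le> indicator (cball 0 \<rho>) (x + w) * \<bar>F (x + w)\<bar> + indicator cell w * (3 ^ k * K0)"
    proof (cases "w \<in> cell")
      case True
      have "x + w \<in> cball 0 \<rho>" using near[OF True] by (auto intro: order.trans[rotated])
      then show ?thesis using Suc.IH[OF near[OF True]] True by (simp add: G_def K0_def)
    qed (auto simp: indicator_def)
  qed
  also have "\<dots> = (\<integral>w. indicator (cball 0 \<rho>) (x + w) * \<bar>F (x + w)\<bar> \<partial>lborel)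
      + (\<integral>w. indicator cell w * (3 ^ k * K0) \<partial>(lborel :: (real ^ 'n) measure))"
    by (intro Bochner_Integration.integral_add FKx integrable_mult_left integrable_cell)
  also have "\<dots> = K0 + 3 ^ k * K0"
    unfolding K0_def by (subst integral_lborel_shift[OF borel_measurable_integrable[OF FK, simplified]]) simp
  finally have "\<bar>cell_avg G x\<bar> \<le> K0 + 3 ^ k * K0" .
  moreover have "\<bar>G x\<bar> \<le> \<bar>F x\<bar> + 3 ^ k * K0"
    unfolding G_def K0_def by (rule Suc.IH) (use Suc.prems in \<open>auto simp: algebra_simps\<close>)
  moreover have "K0 \<le> 3 ^ k * K0" using mult_right_mono[of 1 "3 ^ k" K0] K0 by simp
  moreover have "(cell_dev ^^ Suc k) F x = cell_avg G x - G x" by (simp add: G_def cell_dev_def[of G, unfolded G_def])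
  ultimately show ?case unfolding K0_def[symmetric] by simp
qed

section \<open>Integrability of powers and the basic error bound\<close>

text \<open>
  The function is dominated by the sum of \<open>c k\<close> times the indicator of the ball of radius \<open>r k\<close>.
\<close>

lemma integrable_by_ball_cover:
  fixes g :: "'a::euclidean_space \<Rightarrow> real"
  assumes g [measurable]: "g \<in> borel_measurable borel" and c: "\<And>k. c k \<ge> 0" and r: "\<And>k. r k \<ge> 0"
    and sum: "summable (\<lambda>k. c k * r k ^ DIM('a))"
    and cover: "\<And>y. g y \<noteq> 0 \<Longrightarrow> \<exists>k. \<bar>g y\<bar> \<le> c k \<and> norm y < r k"
  shows "integrable lborel g"
proof (rule integrableI_bounded)
  let ?V = "unit_ball_vol (real DIM('a))"
  have [measurable]: "ball (0::'a) (r k) \<in> sets lborel" for k by simp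
  have "(\<integral>\<^sup>+y. ennreal (norm (g y)) \<partial>lborel)
      \<le> (\<integral>\<^sup>+y. (\<Sum>k. ennreal (c k) * indicator (ball 0 (r k)) (y::'a)) \<partial>lborel)"
  proof (rule nn_integral_mono)
    fix y :: 'a
    show "ennreal (norm (g y)) \<le> (\<Sum>k. ennreal (c k) * indicator (ball 0 (r k)) y)"
    proof (cases "g y = 0")
      case False
      then obtain k where k: "\<bar>g y\<bar> \<le> c k" "norm y < r k" using cover by blast
      have "ennreal (norm (g y)) \<le> (\<Sum>k\<in>{k}. ennreal (c k) * indicator (ball 0 (r k)) y)"
        using k c by (simp add: ennreal_leI)
      also have "\<dots> \<le> (\<Sum>k. ennreal (c k) * indicator (ball 0 (r k)) y)"
        by (rule sum_le_suminf) auto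
      finally show ?thesis .
    qed simp
  qed
  also have "\<dots> = (\<Sum>k. \<integral>\<^sup>+y. ennreal (c k) * indicator (ball 0 (r k)) (y::'a) \<partial>lborel)"
    by (rule nn_integral_suminf) measurable
  also have "\<dots> = (\<Sum>k. ennreal (?V * (c k * r k ^ DIM('a))))"
    using c r by (simp add: nn_integral_cmult_indicator emeasure_ball ennreal_mult'[symmetric] mult_ac)
  also have "\<dots> = ennreal (\<Sum>k. ?V * (c k * r k ^ DIM('a)))"
    using c r sum by (intro suminf_ennreal2 summable_mult) (auto intro!: mult_nonneg_nonneg)
  also have "\<dots> < \<infinity>" by simp
  finally show "(\<integral>\<^sup>+y. ennreal (norm (g y)) \<partial>lborel) < \<infinity>" .
qed simp

lemma nat_floor_bounds:
  fixes L :: real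
  assumes "L \<ge> 0" obtains k :: nat where "real k \<le> L" "L < real k + 1"
proof (rule that[of "nat \<lfloor>L\<rfloor>"])
  have "real (nat \<lfloor>L\<rfloor>) = of_int \<lfloor>L\<rfloor>" using assms by simp
  then show "real (nat \<lfloor>L\<rfloor>) \<le> L" "L < real (nat \<lfloor>L\<rfloor>) + 1" by linarith+
qed

lemma integrable_power_near:
  fixes d R :: real
  assumes d: "d > - real DIM('a::euclidean_space)" and R: "R > 0"
  shows "integrable lborel (\<lambda>y::'a. indicator (cball 0 R) y * norm y powr d)"
proof (rule integrable_by_ball_cover)
  let ?n = "DIM('a)"
  define c where "c k = R powr d * max 1 (2 powr (-d)) * 2 powr (- real k * d)" for k :: nat
  \<comment> \<open>Shells \<open>2\<^bsup>-k-1\<^esup> R < |y| \<le> 2\<^bsup>-k\<^esup> R\<close>; the factor 2 in \<open>r\<close> makes the radius bound strict, the maximum in \<open>c\<close> covers both signs of \<open>d\<close>.\<close>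
  define r where "r k = 2 * R * 2 powr (- real k)" for k :: nat
  show "(\<lambda>y::'a. indicator (cball 0 R) y * norm y powr d) \<in> borel_measurable borel"
    by (intro borel_measurable_times borel_measurable_indicator powr_real_measurable
        borel_measurable_norm measurable_const measurable_ident_sets) auto
  show "c k \<ge> 0" "r k \<ge> 0" for k using R by (auto simp: c_def r_def)
  have q: "2 powr (- (d + ?n)) < (1::real)" using d by (simp add: powr_less_one)
  have "c k * r k ^ ?n = R powr d * max 1 (2 powr (-d)) * (2 * R) ^ ?n * (2 powr (- (d + ?n))) ^ k" for k
    by (simp add: c_def r_def power_mult_distrib powr_realpow[symmetric] powr_powr powr_add[symmetric] algebra_simps)
  moreover have "summable (\<lambda>k. R powr d * max 1 (2 powr (-d)) * (2 * R) ^ ?n * (2 powr (- (d + ?n))) ^ k)"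
    using q by (intro summable_mult summable_geometric) auto
  ultimately show "summable (\<lambda>k. c k * r k ^ ?n)" by simp
  fix y :: 'a assume "indicator (cball 0 R) y * norm y powr d \<noteq> 0"
  then have y: "norm y \<le> R" "norm y > 0" by (auto simp: indicator_def split: if_splits)
  \<comment> \<open>The shell containing \<open>y\<close> is the integer part of \<open>L\<close>.\<close>
  define L where "L = - log 2 (norm y / R)"
  have nL: "norm y = R * 2 powr (- L)" using y R by (simp add: L_def)
  have "L \<ge> 0" using y R by (auto simp: L_def)
  then obtain k :: nat where k: "real k \<le> L" "L < real k + 1"
    by (rule nat_floor_bounds)
  have "norm y < r k"
  proof -
    have "2 powr (- L) \<le> (2::real) powr (- real k)" using k by simp
    also have "\<dots> < 2 * 2 powr (- real k)" by simp
    finally show ?thesis using R unfolding nL r_def by (simp add: mult_ac)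
  qed
  moreover have "norm y powr d \<le> c k"
  proof -
    have "norm y powr d = R powr d * 2 powr (- L * d)" using R by (simp add: nL powr_mult powr_powr)
    moreover have "2 powr (- L * d) \<le> max 1 (2 powr (-d)) * 2 powr (- real k * d)"
    proof (cases "d \<ge> 0")
      case True
      then have "2 powr (- L * d) \<le> 1 * 2 powr (- real k * d)" using k by (simp add: mult_right_mono)
      also have "\<dots> \<le> max 1 (2 powr (-d)) * 2 powr (- real k * d)" by (intro mult_right_mono) auto
      finally show ?thesis .
    next
      case False
      then have "2 powr (- L * d) \<le> (2::real) powr (- (real k + 1) * d)"
        using k mult_right_mono_neg[of L "real k + 1" d] by (simp add: algebra_simps)
      also have "\<dots> = 2 powr (-d) * 2 powr (- real k * d)" by (simp add: powr_add[symmetric] algebra_simps)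
      also have "\<dots> \<le> max 1 (2 powr (-d)) * 2 powr (- real k * d)" by (intro mult_right_mono) auto
      finally show ?thesis .
    qed
    ultimately show ?thesis unfolding c_def by (simp add: mult_left_mono mult.assoc)
  qed
  ultimately show "\<exists>k. \<bar>indicator (cball 0 R) y * norm y powr d\<bar> \<le> c k \<and> norm y < r k"
    using y by (intro exI[of _ k]) simp
qed

lemma integrable_power_far:
  fixes s :: real
  assumes s: "s > real DIM('a::euclidean_space)"
  shows "integrable lborel (\<lambda>y::'a. indicator (- ball 0 1) y * norm y powr (- s))"
proof (rule integrable_by_ball_cover)
  let ?n = "DIM('a)"
  define c where "c k = 2 powr (- real k * s)" for k :: nat
  define r where "r k = 2 * 2 powr (real k)" for k :: nat
  show "(\<lambda>y::'a. indicator (- ball 0 1) y * norm y powr (- s)) \<in> borel_measurable borel"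
    by (intro borel_measurable_times borel_measurable_indicator powr_real_measurable
        borel_measurable_norm measurable_const measurable_ident_sets) auto
  show "c k \<ge> 0" "r k \<ge> 0" for k by (auto simp: c_def r_def)
  have q: "2 powr (?n - s) < (1::real)" using s by (simp add: powr_less_one)
  have "c k * r k ^ ?n = 2 ^ ?n * (2 powr (?n - s)) ^ k" for k
    by (simp add: c_def r_def power_mult_distrib powr_realpow[symmetric] powr_powr powr_add[symmetric] algebra_simps)
  moreover have "summable (\<lambda>k. 2 ^ ?n * (2 powr (?n - s)) ^ k)"
    using q by (intro summable_mult summable_geometric) auto
  ultimately show "summable (\<lambda>k. c k * r k ^ ?n)" by simp
  fix y :: 'a assume "indicator (- ball 0 1) y * norm y powr (- s) \<noteq> 0"
  then have y: "norm y \<ge> 1" by (auto simp: indicator_def split: if_splits)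
  define L where "L = log 2 (norm y)"
  have "norm y > 0" using y by linarith
  then have nL: "norm y = 2 powr L" by (simp add: L_def)
  have "L \<ge> 0" using y \<open>norm y > 0\<close> unfolding L_def by (subst zero_le_log_cancel_iff) auto
  then obtain k :: nat where k: "real k \<le> L" "L < real k + 1"
    by (rule nat_floor_bounds)
  have "norm y < r k"
  proof -
    have "2 powr L < (2::real) powr (real k + 1)" using k by simp
    then show ?thesis unfolding nL r_def by (simp add: powr_add mult_ac)
  qed
  moreover have "norm y powr (- s) \<le> c k"
    using k s unfolding nL c_def by (simp add: powr_powr mult_right_mono)
  ultimately show "\<exists>k. \<bar>indicator (- ball 0 1) y * norm y powr (- s)\<bar> \<le> c k \<and> norm y < r k"
    using y by (intro exI[of _ k]) simp
qed

text \<open>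
  Comparison with the integral of \<open>|x - \<alpha>|\<^bsup>-s\<^esup>\<close>: over the cell at \<open>z\<close> the distance to \<open>\<alpha>\<close> changes by at most a
  factor two, and the cells of different lattice points are disjoint.
\<close>

lemma lattice_tail_sum_bounded:
  fixes \<alpha> :: "real ^ 'n"
  assumes s: "s > real CARD('n)"
  obtains S where "S \<ge> 0" "\<And>Z. finite Z \<Longrightarrow> Z \<subseteq> int_lattice \<Longrightarrow> (\<And>z. z \<in> Z \<Longrightarrow> norm (z - \<alpha>) \<ge> real CARD('n) + 1) \<Longrightarrow>
      (\<Sum>z\<in>Z. norm (z - \<alpha>) powr (- s)) \<le> S"
proof -
  let ?n = "real CARD('n)"
  define g where "g x = indicator (- ball 0 1) (x - \<alpha>) * norm (x - \<alpha>) powr (- s)" for x :: "real ^ 'n"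
  have g: "integrable lborel g"
    using integrable_lborel_shift[OF integrable_power_far[where 'a="real ^ 'n"], of s "- \<alpha>"] s
    by (simp add: g_def[abs_def])
  have g0: "g x \<ge> 0" for x by (simp add: g_def indicator_def)
  define S where "S = 2 powr s * (\<integral>x. g x \<partial>lborel)"
  have "(\<Sum>z\<in>Z. norm (z - \<alpha>) powr (- s)) \<le> S"
    if Z: "finite Z" "Z \<subseteq> int_lattice" "\<And>z. z \<in> Z \<Longrightarrow> norm (z - \<alpha>) \<ge> ?n + 1" for Z
  proof -
    have "norm (z - \<alpha>) powr (- s) \<le> (\<integral>x. indicator cell (x - z) * (2 powr s * g x) \<partial>lborel)" if z: "z \<in> Z" for z
    proof -
      have ind: "integrable lborel (\<lambda>x. indicator cell (- z + x) * norm (z - \<alpha>) powr (- s))"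
        using integrable_lborel_shift[OF integrable_cell, of "-z"] by simp
      have "norm (z - \<alpha>) powr (- s) = (\<integral>x. indicator cell (- z + x) * norm (z - \<alpha>) powr (- s) \<partial>lborel)"
        using integral_lborel_shift[of "indicator cell :: real ^ 'n \<Rightarrow> real" "- z"] by simp
      also have "\<dots> \<le> (\<integral>x. indicator cell (x - z) * (2 powr s * g x) \<partial>lborel)"
      proof (rule integral_mono)
        show "integrable lborel (\<lambda>x. indicator cell (x - z) * (2 powr s * g x))"
          by (rule cell_avg_alt(2)) (intro integrable_mult_right g)
        fix x :: "real ^ 'n"
        show "indicator cell (- z + x) * norm (z - \<alpha>) powr (- s) \<le> indicator cell (x - z) * (2 powr s * g x)"
        proof (cases "x - z \<in> cell")
          case True
          then have "norm (x - z) \<le> ?n" by (rule norm_cell)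
          then have xa: "norm (x - \<alpha>) \<le> norm (z - \<alpha>) + ?n" "norm (x - \<alpha>) \<ge> norm (z - \<alpha>) - ?n"
            using norm_triangle_ineq[of "z - \<alpha>" "x - z"] norm_diff_ineq[of "z - \<alpha>" "x - z"] by (simp_all add: algebra_simps)
          have "norm (x - \<alpha>) \<ge> 1" "norm (x - \<alpha>) / 2 \<le> norm (z - \<alpha>)" using xa Z(3)[OF z] by linarith+
          then have "norm (z - \<alpha>) powr (- s) \<le> (norm (x - \<alpha>) / 2) powr (- s)"
            using s of_nat_0_le_iff[of "CARD('n)", where ?'a=real] by (intro powr_mono2') linarith+
          also have "\<dots> = 2 powr s * norm (x - \<alpha>) powr (- s)"
            by (simp add: powr_divide powr_minus field_simps)
          finally show ?thesis using True \<open>norm (x - \<alpha>) \<ge> 1\<close> by (simp add: g_def)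
        qed simp
      qed (rule ind)
      finally show ?thesis .
    qed
    then have "(\<Sum>z\<in>Z. norm (z - \<alpha>) powr (- s)) \<le> (\<Sum>z\<in>Z. \<integral>x. indicator cell (x - z) * (2 powr s * g x) \<partial>lborel)"
      by (rule sum_mono)
    also have "\<dots> = (\<integral>x. (\<Sum>z\<in>Z. indicator cell (x - z) * (2 powr s * g x)) \<partial>lborel)"
      by (rule Bochner_Integration.integral_sum[symmetric], rule cell_avg_alt(2)) (intro integrable_mult_right g)
    also have "\<dots> \<le> (\<integral>x. 2 powr s * g x \<partial>lborel)"
    proof (rule integral_mono')
      show "integrable lborel (\<lambda>x. 2 powr s * g x)" by (intro integrable_mult_right g)
      fix x :: "real ^ 'n"
      show "0 \<le> 2 powr s * g x" using g0 by simp
      have "(\<Sum>z\<in>Z. indicator cell (x - z)) * (2 powr s * g x) \<le> 1 * (2 powr s * g x)"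
        using sum_indicator_cell_le[OF Z(1,2)] g0 by (intro mult_right_mono) auto
      then show "(\<Sum>z\<in>Z. indicator cell (x - z) * (2 powr s * g x)) \<le> 2 powr s * g x"
        by (simp add: sum_distrib_right)
    qed
    finally show ?thesis by (simp add: S_def)
  qed
  moreover have "S \<ge> 0" unfolding S_def using g0 by simp
  ultimately show thesis using that by blast
qed

lemma fdiff_cong:
  assumes "\<And>y. norm (y - x) \<le> real (length ws) * r \<Longrightarrow> f y = g y" "\<forall>w\<in>set ws. norm w \<le> r" "r \<ge> 0"
  shows "fdiff ws f x = fdiff ws g x"
  using assms(1,2)
proof (induction ws arbitrary: x)
  case Nil then show ?case by simp
next
  case (Cons w ws)
  have "norm w \<le> r" using Cons.prems by simp
  have "fdiff ws f (x + w) = fdiff ws g (x + w)"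
  proof (rule Cons.IH)
    fix y assume "norm (y - (x + w)) \<le> real (length ws) * r"
    then have "norm (y - x) \<le> real (length (w # ws)) * r"
      using norm_triangle_ineq[of "y - (x + w)" w] \<open>norm w \<le> r\<close> by (simp add: algebra_simps)
    then show "f y = g y" by (rule Cons.prems)
  qed (use Cons.prems in simp)
  moreover have "fdiff ws f x = fdiff ws g x"
    by (rule Cons.IH) (use Cons.prems \<open>r \<ge> 0\<close> in \<open>auto simp: algebra_simps\<close>)
  ultimately show ?case by simp
qed

text \<open>
  The error of the punctured rule, as a functional of the integrand centred at the singular point.
\<close>

definition quad_error :: "real \<Rightarrow> real ^ 'n \<Rightarrow> (real ^ 'n \<Rightarrow> real) \<Rightarrow> real" where
  "quad_error h \<alpha> G = full_integral (\<lambda>x. G (x - h *\<^sub>R \<alpha>)) - punctured_trapezoidal h (\<lambda>x. G (x - h *\<^sub>R \<alpha>))"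

lemma integrable_of_power_bound:
  fixes G :: "real ^ 'n \<Rightarrow> real"
  assumes G: "G \<in> borel_measurable borel" and supp: "\<And>y. norm y > R \<Longrightarrow> G y = 0"
    and bound: "\<And>y. \<bar>G y\<bar> \<le> C * norm y powr d" and d: "d > - real CARD('n)"
  shows "integrable lborel G"
proof -
  have "integrable lborel (\<lambda>y::real ^ 'n. C * (indicator (cball 0 (max R 1)) y * norm y powr d))"
    by (intro integrable_mult_right integrable_power_near) (use d in auto)
  then show ?thesis
  proof (rule Bochner_Integration.integrable_bound)
    show "AE y in lborel. norm (G y) \<le> norm (C * (indicator (cball 0 (max R 1)) y * norm y powr d))"
    proof (rule AE_I2)
      fix y :: "real ^ 'n"
      show "norm (G y) \<le> norm (C * (indicator (cball 0 (max R 1)) y * norm y powr d))"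
        using supp[of y] order.trans[OF bound[of y] abs_ge_self] by (cases "norm y \<le> max R 1") (auto simp: indicator_def)
    qed
  qed (use G in simp)
qed

text \<open>
  Puncturing is encoded by setting the integrand to zero at the lattice point \<open>0\<close>, which does not change
  its integral; the singular point is \<open>\<alpha>\<close>, in general a different one. The error is then the lattice sum of
  \<open>cell_dev ^^ m\<close>. Far from \<open>\<alpha>\<close> and from \<open>0\<close> it is bounded by differences and the sum converges as
  \<open>m - d > n\<close>; on the remaining finite set the bound by local integrals is used, where \<open>d > -n\<close> enters.
\<close>

lemma quad_error_unit_bound:
  fixes \<alpha> :: "real ^ 'n"
  assumes d: "d > - real CARD('n)" and m: "real m > d + real CARD('n)"
  obtains K where "K \<ge> 0" "\<And>G C R. C \<ge> 0 \<Longrightarrow> G \<in> borel_measurable borel \<Longrightarrow> (\<And>y. norm y > R \<Longrightarrow> G y = 0) \<Longrightarrow>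
      (\<And>y. \<bar>G y\<bar> \<le> C * norm y powr d) \<Longrightarrow> diff_bound m d C G \<Longrightarrow> \<bar>quad_error 1 \<alpha> G\<bar> \<le> K * C"
proof -
  let ?n = "real CARD('n)"
  have "m > 0" using d m by (cases m) auto
  obtain S where S: "S \<ge> 0" "\<And>Z. finite Z \<Longrightarrow> Z \<subseteq> int_lattice \<Longrightarrow> (\<And>z. z \<in> Z \<Longrightarrow> norm (z - \<alpha>) \<ge> ?n + 1) \<Longrightarrow>
      (\<Sum>z\<in>Z. norm (z - \<alpha>) powr (- (real m - d))) \<le> S"
    using lattice_tail_sum_bounded[of "real m - d" \<alpha>] m by (metis less_diff_eq add.commute)
  \<comment> \<open>Beyond \<open>R1\<close> no difference step reaches \<open>0\<close>, and \<open>|z - \<alpha>|\<close> exceeds both \<open>2 m n\<close> and \<open>n + 1\<close>.\<close>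
  define R1 where "R1 = norm \<alpha> + 2 * real m * ?n + ?n + 1"
  define \<rho> where "\<rho> = R1 + real m * ?n"
  define J where "J = (\<integral>x. indicator (cball 0 \<rho>) x * norm (x - \<alpha>) powr d \<partial>lborel)"
  have pow_int: "integrable lborel (\<lambda>x. indicator (cball 0 \<rho>) x * norm (x - \<alpha>) powr d)"
  proof -
    have "real m * ?n \<ge> 0" "?n \<ge> 0" by simp_all
    then have "\<rho> + norm \<alpha> > 0" using norm_ge_zero[of \<alpha>] unfolding \<rho>_def R1_def by linarith
    then have "integrable lborel (\<lambda>y::real ^ 'n. indicator (cball 0 (\<rho> + norm \<alpha>)) y * norm y powr d)"
      using d by (intro integrable_power_near) auto
    from integrable_lborel_cmult_indicator[OF integrable_lborel_shift[OF this, of "- \<alpha>"], of "cball 0 \<rho>"]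
    have "integrable lborel (\<lambda>x. indicator (cball 0 \<rho>) x * (indicator (cball 0 (\<rho> + norm \<alpha>)) (- \<alpha> + x) * norm (- \<alpha> + x) powr d))" by simp
    also have "(\<lambda>x. indicator (cball 0 \<rho>) x * (indicator (cball 0 (\<rho> + norm \<alpha>)) (- \<alpha> + x) * norm (- \<alpha> + x) powr d))
        = (\<lambda>x. indicator (cball 0 \<rho>) x * norm (x - \<alpha>) powr d)"
    proof
      fix x show "indicator (cball 0 \<rho>) x * (indicator (cball 0 (\<rho> + norm \<alpha>)) (- \<alpha> + x) * norm (- \<alpha> + x) powr d)
          = indicator (cball 0 \<rho>) x * norm (x - \<alpha>) powr d"
        using norm_triangle_ineq4[of x \<alpha>] by (auto simp: indicator_def)
    qed
    finally show ?thesis .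
  qed
  have J: "J \<ge> 0" unfolding J_def by (intro Bochner_Integration.integral_nonneg) (simp add: indicator_def)
  let ?near = "(int_lattice :: (real ^ 'n) set) \<inter> cball 0 R1"
  define K where "K = (\<Sum>z\<in>?near. norm (z - \<alpha>) powr d + 3 ^ m * J) + ?n ^ m * S"
  have K: "K \<ge> 0" unfolding K_def using J S by (intro add_nonneg_nonneg sum_nonneg mult_nonneg_nonneg) auto
  have "\<bar>quad_error 1 \<alpha> G\<bar> \<le> K * C"
    if C: "C \<ge> 0" and G: "G \<in> borel_measurable borel" "\<And>y. norm y > R \<Longrightarrow> G y = 0"
      "\<And>y. \<bar>G y\<bar> \<le> C * norm y powr d" "diff_bound m d C G" for G C R
  proof -
    define F where "F x = indicator (- {0}) x * G (- \<alpha> + x)" for x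
    define R2 where "R2 = R + norm \<alpha>"
    define R' where "R' = R2 + real m * ?n"
    let ?Z = "(int_lattice :: (real ^ 'n) set) \<inter> cball 0 R'"
    have Gi: "integrable lborel G" by (rule integrable_of_power_bound[OF G(1,2,3) d])
    have Fi: "integrable lborel F"
      unfolding F_def by (rule integrable_lborel_cmult_indicator[OF integrable_lborel_shift[OF Gi]]) auto
    have F0: "F x = 0" if "norm x > R2" for x
      using G(2)[of "- \<alpha> + x"] norm_triangle_ineq2[of x \<alpha>] that by (simp add: F_def R2_def)
    have supp: "integrable_supp R2 F" using Fi F0 by (simp add: integrable_supp_def)
    have 1: "full_integral (\<lambda>x. G (x - 1 *\<^sub>R \<alpha>)) = (\<integral>x. F x \<partial>lborel)"
      unfolding full_integral_def
    proof (rule integral_cong_AE)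
      have "AE x in lborel. x \<noteq> (0 :: real ^ 'n)" by (rule AE_lborel_singleton)
      then show "AE x in lborel. G (x - 1 *\<^sub>R \<alpha>) = F x" by eventually_elim (simp add: F_def)
    qed (use G(1) Fi in auto)
    have 2: "punctured_trapezoidal 1 (\<lambda>x. G (x - 1 *\<^sub>R \<alpha>)) = (\<Sum>z\<in>?Z. F z)"
    proof -
      have "(\<Sum>\<^sub>\<infinity>y\<in>int_lattice - {0}. G (y - \<alpha>)) = (\<Sum>\<^sub>\<infinity>y\<in>?Z. F y)"
      proof (rule infsum_cong_neutral)
        fix x assume "x \<in> ?Z - (int_lattice - {0})" then show "F x = 0" by (auto simp: F_def)
      next
        fix x assume x: "x \<in> (int_lattice - {0}) - ?Z"
        then have "norm x > R2" by (auto simp: R'_def not_le intro: le_less_trans[rotated])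
        with F0[OF this] x show "G (x - \<alpha>) = 0" by (simp add: F_def)
      qed (auto simp: F_def)
      then show ?thesis
        unfolding infsum_finite[OF finite_lattice_cball] by (simp add: punctured_trapezoidal_def)
    qed
    have "\<bar>quad_error 1 \<alpha> G\<bar> = \<bar>\<Sum>z\<in>?Z. (cell_dev ^^ m) F z\<bar>"
      unfolding quad_error_def 1 2 by (rule lattice_error_cell_dev[OF supp]) (use \<open>m > 0\<close> in \<open>auto simp: R'_def\<close>)
    also have "\<dots> \<le> (\<Sum>z\<in>?Z. \<bar>(cell_dev ^^ m) F z\<bar>)" by (rule sum_abs)
    also have "\<dots> \<le> (\<Sum>z\<in>?near. \<bar>(cell_dev ^^ m) F z\<bar>) + (\<Sum>z\<in>?Z - cball 0 R1. \<bar>(cell_dev ^^ m) F z\<bar>)"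
    proof -
      have "(\<Sum>z\<in>?Z. \<bar>(cell_dev ^^ m) F z\<bar>) \<le> (\<Sum>z\<in>?near \<union> (?Z - cball 0 R1). \<bar>(cell_dev ^^ m) F z\<bar>)"
        using finite_lattice_cball[of R1] finite_lattice_cball[of R'] by (intro sum_mono2) auto
      also have "\<dots> = (\<Sum>z\<in>?near. \<bar>(cell_dev ^^ m) F z\<bar>) + (\<Sum>z\<in>?Z - cball 0 R1. \<bar>(cell_dev ^^ m) F z\<bar>)"
        using finite_lattice_cball[of R1] finite_lattice_cball[of R'] by (intro sum.union_disjoint) auto
      finally show ?thesis .
    qed
    also have "(\<Sum>z\<in>?near. \<bar>(cell_dev ^^ m) F z\<bar>) \<le> (\<Sum>z\<in>?near. C * (norm (z - \<alpha>) powr d + 3 ^ m * J))"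
    proof (rule sum_mono)
      fix z assume z: "z \<in> ?near"
      have Fb: "\<bar>F x\<bar> \<le> C * norm (x - \<alpha>) powr d" for x
        using G(3)[of "- \<alpha> + x"] C by (auto simp: F_def indicator_def)
      have "(\<integral>y. indicator (cball 0 \<rho>) y * \<bar>F y\<bar> \<partial>lborel) \<le> (\<integral>y. C * (indicator (cball 0 \<rho>) y * norm (y - \<alpha>) powr d) \<partial>lborel)"
        by (rule integral_mono') (use pow_int Fb C in \<open>auto simp: indicator_def\<close>)
      also have "\<dots> = C * J" by (simp add: J_def)
      finally have int_le: "(\<integral>y. indicator (cball 0 \<rho>) y * \<bar>F y\<bar> \<partial>lborel) \<le> C * J" .
      have "3 ^ m * (\<integral>y. indicator (cball 0 \<rho>) y * \<bar>F y\<bar> \<partial>lborel) \<le> 3 ^ m * (C * J)"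
        by (rule mult_left_mono[OF int_le]) simp
      moreover have "\<bar>(cell_dev ^^ m) F z\<bar> \<le> \<bar>F z\<bar> + 3 ^ m * (\<integral>y. indicator (cball 0 \<rho>) y * \<bar>F y\<bar> \<partial>lborel)"
        by (rule cell_dev_pow_near[OF supp]) (use z in \<open>simp add: \<rho>_def\<close>)
      moreover have "C * (norm (z - \<alpha>) powr d + 3 ^ m * J) = C * norm (z - \<alpha>) powr d + 3 ^ m * (C * J)"
        by (simp add: distrib_left mult_ac)
      ultimately show "\<bar>(cell_dev ^^ m) F z\<bar> \<le> C * (norm (z - \<alpha>) powr d + 3 ^ m * J)"
        using Fb[of z] by linarith
    qed
    also have "(\<Sum>z\<in>?Z - cball 0 R1. \<bar>(cell_dev ^^ m) F z\<bar>)
        \<le> (\<Sum>z\<in>?Z - cball 0 R1. C * ?n ^ m * norm (z - \<alpha>) powr (- (real m - d)))"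
    proof (rule sum_mono)
      fix z assume z: "z \<in> ?Z - cball 0 R1"
      then have z1: "norm z > R1" by simp
      have za: "norm (z - \<alpha>) \<ge> norm z - norm \<alpha>" by (rule norm_triangle_ineq2)
      have mn: "real m * ?n \<ge> 0" by simp
      have zfar: "2 * real m * ?n \<le> norm (z - \<alpha>)"
        using za z1 of_nat_0_le_iff[of "CARD('n)", where ?'a=real] unfolding R1_def by linarith
      have "norm (z - \<alpha>) > 0"
        using za z1 mn of_nat_0_le_iff[of "CARD('n)", where ?'a=real] unfolding R1_def by linarith
      then have znz: "z - \<alpha> \<noteq> 0" by auto
      show "\<bar>(cell_dev ^^ m) F z\<bar> \<le> C * ?n ^ m * norm (z - \<alpha>) powr (- (real m - d))"
      proof (rule cell_dev_pow_le_fdiff[OF supp])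
        show "0 \<le> C * ?n ^ m * norm (z - \<alpha>) powr (- (real m - d))" using C by simp
        fix ws :: "(real ^ 'n) list" assume ws: "length ws = m" "set ws \<subseteq> cell"
        have wn: "\<forall>w\<in>set ws. norm w \<le> ?n" using ws(2) norm_cell by blast
        have "fdiff ws F z = fdiff ws (\<lambda>x. G (x + - \<alpha>)) z"
        proof (rule fdiff_cong[OF _ wn])
          fix y assume "norm (y - z) \<le> real (length ws) * ?n"
          then have "norm z \<le> norm y + real m * ?n"
            using norm_triangle_ineq4[of y "y - z"] ws(1) by simp
          then have "norm y > 0" using z1 mn norm_ge_zero[of \<alpha>] unfolding R1_def by linarith
          then have "y \<noteq> 0" by auto
          then show "F y = G (y + - \<alpha>)" by (simp add: F_def add.commute)
        qed simp
        then have "fdiff ws F z = fdiff ws G (z - \<alpha>)" using fdiff_shift[of ws G "- \<alpha>" z] by simp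
        moreover have "\<bar>fdiff ws G (z - \<alpha>)\<bar> \<le> C * ?n ^ m * norm (z - \<alpha>) powr (d - real m)"
          using ws(1) wn zfar znz by (intro G(4)[unfolded diff_bound_def, rule_format]) auto
        ultimately show "\<bar>fdiff ws F z\<bar> \<le> C * ?n ^ m * norm (z - \<alpha>) powr (- (real m - d))" by simp
      qed
    qed
    also have "\<dots> = C * ?n ^ m * (\<Sum>z\<in>?Z - cball 0 R1. norm (z - \<alpha>) powr (- (real m - d)))"
      by (simp add: sum_distrib_left)
    also have "\<dots> \<le> C * ?n ^ m * S"
    proof (intro mult_left_mono S(2))
      fix z assume "z \<in> ?Z - cball 0 R1"
      then have "norm z > R1" by simp
      moreover have "real m * ?n \<ge> 0" by simp
      ultimately show "?n + 1 \<le> norm (z - \<alpha>)" using norm_triangle_ineq2[of z \<alpha>] unfolding R1_def by linarith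
    qed (use C finite_lattice_cball[of R'] in auto)
    finally show ?thesis by (simp add: K_def sum_distrib_left sum_distrib_right algebra_simps)
  qed
  with K that show thesis by blast
qed

section \<open>The quadrature error\<close>

lemma punctured_trapezoidal_eq_sum:
  fixes F :: "real ^ 'n \<Rightarrow> real"
  assumes h: "h > 0" and supp: "\<And>x. norm x > R \<Longrightarrow> F x = 0"
  shows "punctured_trapezoidal h F = h ^ CARD('n) * (\<Sum>z\<in>int_lattice \<inter> cball 0 (R / h) - {0}. F (h *\<^sub>R z))"
proof -
  have "(\<lambda>z. h *\<^sub>R z) ` int_lattice - {0} = (\<lambda>z. h *\<^sub>R z) ` ((int_lattice :: (real ^ 'n) set) - {0})"
    using h by auto
  then have "(\<Sum>\<^sub>\<infinity>y\<in>(\<lambda>z. h *\<^sub>R z) ` int_lattice - {0}. F y) = (\<Sum>\<^sub>\<infinity>z\<in>int_lattice - {0}. F (h *\<^sub>R z))"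
    using h by (simp add: infsum_reindex inj_on_def o_def)
  also have "\<dots> = (\<Sum>\<^sub>\<infinity>z\<in>int_lattice \<inter> cball 0 (R / h) - {0}. F (h *\<^sub>R z))"
  proof (rule infsum_cong_neutral)
    fix z :: "real ^ 'n" assume z: "z \<in> (int_lattice - {0}) - (int_lattice \<inter> cball 0 (R / h) - {0})"
    then have "norm (h *\<^sub>R z) > R" using h by (auto simp: field_simps not_le)
    then show "F (h *\<^sub>R z) = 0" by (rule supp)
  qed auto
  also have "\<dots> = (\<Sum>z\<in>int_lattice \<inter> cball 0 (R / h) - {0}. F (h *\<^sub>R z))"
    by (intro infsum_finite finite_Diff finite_lattice_cball)
  finally show ?thesis by (simp add: punctured_trapezoidal_def)
qed

definition bounded_support :: "(real ^ 'n \<Rightarrow> real) \<Rightarrow> bool" where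
  "bounded_support F \<longleftrightarrow> (\<exists>R. \<forall>x. norm x > R \<longrightarrow> F x = 0)"

lemma bounded_support_shift: 
  assumes "bounded_support F" shows "bounded_support (\<lambda>x. F (x - a))"
proof -
  from assms obtain R where R: "\<And>x. norm x > R \<Longrightarrow> F x = 0" by (auto simp: bounded_support_def)
  have "F (x - a) = 0" if "norm x > R + norm a" for x
    using norm_triangle_ineq2[of x a] that by (intro R) linarith
  then show ?thesis unfolding bounded_support_def by blast
qed

lemma bounded_support_uniform:
  assumes "finite J" "\<And>j. j \<in> J \<Longrightarrow> bounded_support (F j)"
  obtains R where "\<And>j x. j \<in> J \<Longrightarrow> norm x > R \<Longrightarrow> F j x = 0"
proof -
  have "\<exists>R. \<forall>j\<in>J. \<forall>x. norm x > R \<longrightarrow> F j x = 0" using assms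
  proof (induction J)
    case (insert j J)
    have "\<exists>R. \<forall>j\<in>J. \<forall>x. norm x > R \<longrightarrow> F j x = 0" by (rule insert.IH) (use insert.prems in blast)
    then obtain R1 where "\<forall>j\<in>J. \<forall>x. norm x > R1 \<longrightarrow> F j x = 0" by blast
    moreover obtain R2 where "\<forall>x. norm x > R2 \<longrightarrow> F j x = 0"
      using insert.prems[of j] by (auto simp: bounded_support_def)
    ultimately show ?case by (intro exI[of _ "max R1 R2"]) auto
  qed auto
  with that show thesis by blast
qed

lemma punctured_trapezoidal_sum:
  fixes F :: "'j \<Rightarrow> real ^ 'n \<Rightarrow> real"
  assumes h: "h > 0" and J: "finite J" and "\<And>j. j \<in> J \<Longrightarrow> bounded_support (F j)"
  shows "punctured_trapezoidal h (\<lambda>x. \<Sum>j\<in>J. c j * F j x) = (\<Sum>j\<in>J. c j * punctured_trapezoidal h (F j))"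
proof -
  obtain R where R: "\<And>j x. j \<in> J \<Longrightarrow> norm x > R \<Longrightarrow> F j x = 0"
    using bounded_support_uniform[OF J, of F] assms(3) by blast
  have "punctured_trapezoidal h (\<lambda>x. \<Sum>j\<in>J. c j * F j x)
      = h ^ CARD('n) * (\<Sum>z\<in>int_lattice \<inter> cball 0 (R / h) - {0}. \<Sum>j\<in>J. c j * F j (h *\<^sub>R z))"
    using R by (intro punctured_trapezoidal_eq_sum[OF h]) simp
  also have "\<dots> = (\<Sum>j\<in>J. c j * (h ^ CARD('n) * (\<Sum>z\<in>int_lattice \<inter> cball 0 (R / h) - {0}. F j (h *\<^sub>R z))))"
    by (subst sum.swap) (simp add: sum_distrib_left mult_ac)
  also have "\<dots> = (\<Sum>j\<in>J. c j * punctured_trapezoidal h (F j))"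
    by (intro sum.cong refl) (simp add: punctured_trapezoidal_eq_sum[OF h R])
  finally show ?thesis .
qed

lemma quad_error_sum:
  fixes G :: "'j \<Rightarrow> real ^ 'n \<Rightarrow> real"
  assumes h: "h > 0" and J: "finite J" and "\<And>j. j \<in> J \<Longrightarrow> bounded_support (G j)"
    and I: "\<And>j. j \<in> J \<Longrightarrow> integrable lborel (G j)"
  shows "quad_error h \<alpha> (\<lambda>x. \<Sum>j\<in>J. c j * G j x) = (\<Sum>j\<in>J. c j * quad_error h \<alpha> (G j))"
proof -
  have "full_integral (\<lambda>x. \<Sum>j\<in>J. c j * G j (x - h *\<^sub>R \<alpha>)) = (\<Sum>j\<in>J. \<integral>x. c j * G j (x - h *\<^sub>R \<alpha>) \<partial>lborel)"
    unfolding full_integral_def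
  proof (rule Bochner_Integration.integral_sum)
    fix j assume "j \<in> J"
    from integrable_lborel_shift[OF I[OF this], of "- h *\<^sub>R \<alpha>"]
    show "integrable lborel (\<lambda>x. c j * G j (x - h *\<^sub>R \<alpha>))" by simp
  qed
  then have "full_integral (\<lambda>x. \<Sum>j\<in>J. c j * G j (x - h *\<^sub>R \<alpha>)) = (\<Sum>j\<in>J. c j * full_integral (\<lambda>x. G j (x - h *\<^sub>R \<alpha>)))"
    by (simp add: full_integral_def)
  moreover have "punctured_trapezoidal h (\<lambda>x. \<Sum>j\<in>J. c j * G j (x - h *\<^sub>R \<alpha>))
      = (\<Sum>j\<in>J. c j * punctured_trapezoidal h (\<lambda>x. G j (x - h *\<^sub>R \<alpha>)))"
    by (rule punctured_trapezoidal_sum[OF h J]) (intro bounded_support_shift assms(3))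
  ultimately show ?thesis by (simp add: quad_error_def sum_subtractf right_diff_distrib)
qed

lemma quad_error_cmult:
  assumes "h > 0" "bounded_support G" "integrable lborel G"
  shows "quad_error h \<alpha> (\<lambda>x. c * G x) = c * quad_error h \<alpha> G"
  using quad_error_sum[of h "{()}" "\<lambda>_. G" \<alpha> "\<lambda>_. c"] assms by simp

lemma quad_error_lincomb2:
  assumes "h > 0" "bounded_support G" "integrable lborel G" "bounded_support G'" "integrable lborel G'"
  shows "quad_error h \<alpha> (\<lambda>x. G x + c * G' x) = quad_error h \<alpha> G + c * quad_error h \<alpha> G'"
  using quad_error_sum[of h "{True, False}" "\<lambda>b. if b then G else G'" \<alpha> "\<lambda>b. if b then 1 else c"] assms by auto

lemma integral_lborel_scale:
  fixes F :: "real ^ 'n \<Rightarrow> real"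
  assumes "F \<in> borel_measurable borel" "h > 0"
  shows "(\<integral>x. F x \<partial>lborel) = h ^ CARD('n) * (\<integral>x. F (h *\<^sub>R x) \<partial>lborel)"
proof -
  have "(\<integral>x. F x \<partial>lborel) = (\<integral>x. F x \<partial>(density (distr lborel borel (\<lambda>x. 0 + h *\<^sub>R x)) (\<lambda>_. ennreal (\<bar>h\<bar> ^ DIM(real ^ 'n)))))"
    using lborel_affine[of h "0 :: real ^ 'n"] assms(2) by simp
  also have "\<dots> = (\<integral>x. h ^ CARD('n) * F x \<partial>(distr lborel borel (\<lambda>x. 0 + h *\<^sub>R x)))"
    using assms by (subst integral_density) auto
  also have "\<dots> = (\<integral>x. h ^ CARD('n) * F (0 + h *\<^sub>R x) \<partial>lborel)"
    using assms by (subst integral_distr) auto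
  finally show ?thesis by simp
qed

lemma quad_error_scale:
  fixes G :: "real ^ 'n \<Rightarrow> real"
  assumes h: "h > 0" and G: "G \<in> borel_measurable borel"
  shows "quad_error h \<alpha> G = h ^ CARD('n) * quad_error 1 \<alpha> (\<lambda>y. G (h *\<^sub>R y))"
proof -
  have "(\<lambda>x. G (x - h *\<^sub>R \<alpha>)) \<in> borel_measurable borel"
    using borel_measurable_shift[OF G, of "- h *\<^sub>R \<alpha>"] by simp
  then have "full_integral (\<lambda>x. G (x - h *\<^sub>R \<alpha>)) = h ^ CARD('n) * full_integral (\<lambda>x. G (h *\<^sub>R (x - 1 *\<^sub>R \<alpha>)))"
    unfolding full_integral_def using integral_lborel_scale[OF _ h] by (simp add: scaleR_right_diff_distrib)
  moreover have "(\<lambda>z. h *\<^sub>R z) ` int_lattice - {0} = (\<lambda>z. h *\<^sub>R z) ` ((int_lattice :: (real ^ 'n) set) - {0})"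
    using h by auto
  then have "punctured_trapezoidal h (\<lambda>x. G (x - h *\<^sub>R \<alpha>)) = h ^ CARD('n) * punctured_trapezoidal 1 (\<lambda>x. G (h *\<^sub>R (x - 1 *\<^sub>R \<alpha>)))"
    using h by (simp add: punctured_trapezoidal_def infsum_reindex inj_on_def o_def scaleR_right_diff_distrib)
  ultimately show ?thesis by (simp add: quad_error_def right_diff_distrib)
qed

lemma borel_measurable_away_from_zero:
  fixes G :: "real ^ 'n \<Rightarrow> real"
  assumes "continuous_on (-{0}) G" shows "G \<in> borel_measurable borel"
  using assms by (intro borel_measurable_continuous_countable_exceptions[of "{0}"]) auto

lemma symbol_on_continuous:
  assumes "symbol_on (Suc m) d (I \<times> -{0}) F" "i \<in> I" shows "continuous_on (-{0}) (F i)"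
proof -
  obtain F' where F': "\<And>i y. (i, y) \<in> I \<times> -{0} \<Longrightarrow> (F i has_derivative F' i y) (at y)"
    using symbol_on_SucE[OF assms(1)] by metis
  show ?thesis
    using F' assms(2) by (intro continuous_at_imp_continuous_on ballI has_derivative_continuous) fastforce
qed

text \<open>
  Scaling to step one multiplies both bounds on \<open>F i\<close> by \<open>h\<^sup>d\<close> and the error by \<open>h\<^sup>n\<close>.
\<close>

lemma quad_error_bound:
  fixes F :: "'i \<Rightarrow> real ^ 'n \<Rightarrow> real"
  assumes d: "d > - real CARD('n)" and m: "real m > d + real CARD('n)"
    and cont: "\<And>i. i \<in> I \<Longrightarrow> continuous_on (-{0}) (F i)" and F0: "\<And>i. i \<in> I \<Longrightarrow> F i 0 = 0"
    and supp: "\<And>i. i \<in> I \<Longrightarrow> bounded_support (F i)"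
    and bounds: "\<And>k. k \<in> {0, m} \<Longrightarrow> \<exists>C\<ge>0. \<forall>i\<in>I. diff_bound k d C (F i)"
  obtains K where "K \<ge> 0" "\<And>i h. i \<in> I \<Longrightarrow> h > 0 \<Longrightarrow> \<bar>quad_error h \<alpha> (F i)\<bar> \<le> K * h powr (d + real CARD('n))"
proof -
  obtain K where K: "K \<ge> 0" "\<And>G C R. C \<ge> 0 \<Longrightarrow> G \<in> borel_measurable borel \<Longrightarrow> (\<And>y. norm y > R \<Longrightarrow> G y = 0) \<Longrightarrow>
      (\<And>y. \<bar>G y\<bar> \<le> C * norm y powr d) \<Longrightarrow> diff_bound m d C G \<Longrightarrow> \<bar>quad_error 1 \<alpha> G\<bar> \<le> K * C"
    using quad_error_unit_bound[OF d m] by metis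
  obtain C0 C1 where C0: "C0 \<ge> 0" "\<And>i. i \<in> I \<Longrightarrow> diff_bound 0 d C0 (F i)"
    and C1: "C1 \<ge> 0" "\<And>i. i \<in> I \<Longrightarrow> diff_bound m d C1 (F i)" using bounds by (metis insertI1 insertI2)
  define C where "C = max C0 C1"
  have mono: "diff_bound k d C G" if "diff_bound k d C' G" "C' \<le> C" for k C' and G :: "real ^ 'n \<Rightarrow> real"
    unfolding diff_bound_def
  proof (intro allI impI)
    fix y :: "real ^ 'n" and ws :: "(real ^ 'n) list" and r :: real
    assume y: "y \<noteq> 0" "length ws = k" "r \<ge> 0" "\<forall>w\<in>set ws. norm w \<le> r" "2 * real k * r \<le> norm y"
    then have "\<bar>fdiff ws G y\<bar> \<le> C' * r ^ k * norm y powr (d - real k)"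
      using that(1) by (simp add: diff_bound_def)
    also have "\<dots> \<le> C * r ^ k * norm y powr (d - real k)"
      using that(2) y(3) by (intro mult_right_mono) auto
    finally show "\<bar>fdiff ws G y\<bar> \<le> C * r ^ k * norm y powr (d - real k)" .
  qed
  have "C \<ge> 0" using C0 by (simp add: C_def)
  have "\<bar>quad_error h \<alpha> (F i)\<bar> \<le> (K * C) * h powr (d + real CARD('n))" if i: "i \<in> I" and h: "h > 0" for i h
  proof -
    have meas: "F i \<in> borel_measurable borel" by (rule borel_measurable_away_from_zero[OF cont[OF i]])
    obtain R where R: "\<And>y. norm y > R \<Longrightarrow> F i y = 0" using supp[OF i] by (auto simp: bounded_support_def)
    have b0: "\<bar>F i y\<bar> \<le> C * norm y powr d" for y
    proof (cases "y = 0")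
      case False
      have "diff_bound 0 d C (F i)" by (rule mono[OF C0(2)[OF i]]) (simp add: C_def)
      from this[unfolded diff_bound_def, rule_format, of y "[]" 0] False show ?thesis by simp
    qed (use F0[OF i] in simp)
    have "\<bar>quad_error 1 \<alpha> (\<lambda>y. F i (h *\<^sub>R y))\<bar> \<le> K * (C * h powr d)"
    proof (rule K(2))
      show "0 \<le> C * h powr d" using \<open>C \<ge> 0\<close> by simp
      show "(\<lambda>y. F i (h *\<^sub>R y)) \<in> borel_measurable borel" using meas by simp
      show "F i (h *\<^sub>R y) = 0" if "norm y > R / h" for y using h that by (intro R) (simp add: field_simps)
      show "\<bar>F i (h *\<^sub>R y)\<bar> \<le> C * h powr d * norm y powr d" for y
        using b0[of "h *\<^sub>R y"] h by (simp add: powr_mult mult_ac)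
      show "diff_bound m d (C * h powr d) (\<lambda>y. F i (h *\<^sub>R y))"
        by (rule diff_bound_scale[OF mono[OF C1(2)[OF i]] h]) (simp add: C_def)
    qed
    then have "h ^ CARD('n) * \<bar>quad_error 1 \<alpha> (\<lambda>y. F i (h *\<^sub>R y))\<bar> \<le> h ^ CARD('n) * (K * (C * h powr d))"
      using h by (intro mult_left_mono) auto
    also have "\<dots> = (K * C) * h powr (d + real CARD('n))"
      using h by (simp add: powr_add powr_realpow mult_ac)
    finally show ?thesis using h by (simp add: quad_error_scale[OF h meas] abs_mult)
  qed
  then show thesis using that[of "K * C"] K(1) \<open>C \<ge> 0\<close> by simp
qed

lemma quad_error_symbol_bound:
  fixes F :: "'i \<Rightarrow> real ^ 'n \<Rightarrow> real"
  assumes d: "d > - real CARD('n)" and sym: "\<And>m. symbol_on m d (I \<times> -{0}) F"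
    and F0: "\<And>i. i \<in> I \<Longrightarrow> F i 0 = 0" and supp: "\<And>i. i \<in> I \<Longrightarrow> bounded_support (F i)"
  obtains K where "K \<ge> 0" "\<And>i h. i \<in> I \<Longrightarrow> h > 0 \<Longrightarrow> \<bar>quad_error h \<alpha> (F i)\<bar> \<le> K * h powr (d + real CARD('n))"
proof -
  obtain m :: nat where m: "real m > d + real CARD('n)" using reals_Archimedean2 by blast
  have bounds: "\<exists>C\<ge>0. \<forall>i\<in>I. diff_bound k d C (F i)" for k
    using symbol_on_imp_diff_bound[OF sym[of k]] by metis
  show thesis
  proof (rule quad_error_bound[OF d m, of I F \<alpha>])
    show "continuous_on (- {0}) (F i)" if "i \<in> I" for i by (rule symbol_on_continuous[OF sym that])
  qed (use F0 supp bounds that in auto)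
qed

lemma symbol_integrable:
  fixes F :: "'i \<Rightarrow> real ^ 'n \<Rightarrow> real"
  assumes d: "d > - real CARD('n)" and sym: "symbol_on (Suc m) d (I \<times> -{0}) F"
    and i: "i \<in> I" and "F i 0 = 0" "bounded_support (F i)"
  shows "integrable lborel (F i)"
proof -
  obtain C where C: "\<And>i y. (i, y) \<in> I \<times> -{0} \<Longrightarrow> \<bar>F i y\<bar> \<le> C * norm y powr d"
    using symbol_on_0E[OF symbol_on_0[OF sym]] by metis
  obtain R where R: "\<And>y. norm y > R \<Longrightarrow> F i y = 0" using assms(5) by (auto simp: bounded_support_def)
  show ?thesis
  proof (rule integrable_of_power_bound[OF borel_measurable_away_from_zero[OF symbol_on_continuous[OF sym i]] R _ d])
    show "\<bar>F i y\<bar> \<le> C * norm y powr d" for y using C[of i y] i assms(4) by (cases "y = 0") auto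
  qed
qed

section \<open>Universal constants for homogeneous singularities\<close>

text \<open>
  For homogeneous \<open>H\<close> this is the scaled error \<open>R(h)\<close> with \<open>s = \<Lambda>/h\<close>.
\<close>

definition dilation_error ::
  "real ^ 'n \<Rightarrow> (real ^ 'n \<Rightarrow> real) \<Rightarrow> (real ^ 'n \<Rightarrow> real) \<Rightarrow> real \<Rightarrow> real" where
  "dilation_error \<alpha> \<psi> H s = quad_error 1 \<alpha> (\<lambda>y. H y * \<psi> (y /\<^sub>R s))"

locale cutoff =
  fixes \<psi> :: "real ^ 'n \<Rightarrow> real"
  assumes smooth: "Cinf_on UNIV \<psi>"
    and near: "\<And>x. norm x < 3 / 4 \<Longrightarrow> \<psi> x = 1"
    and far: "\<And>x. norm x > real CARD('n) \<Longrightarrow> \<psi> x = 0"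

text \<open>
  A homogeneous singularity together with a cutoff, to be used at varying radii. The value at the
  origin is fixed to zero so that the bound by \<open>|y|\<^sup>d\<close> holds there as well.
\<close>

locale homogeneous_cutoff = cutoff \<psi> for \<psi> :: "real ^ 'n \<Rightarrow> real" +
  fixes H :: "real ^ 'n \<Rightarrow> real" and d :: real
  assumes H_smooth: "Cinf_on (-{0}) H"
    and H_hom: "\<And>c y. c > 0 \<Longrightarrow> H (c *\<^sub>R y) = c powr d * H y"
    and H0: "H 0 = 0"
    and d: "d > - real CARD('n)"
begin

lemma bounded_support_cutoff: "s > 0 \<Longrightarrow> bounded_support (\<lambda>y. H y * \<psi> (y /\<^sub>R s))"
  unfolding bounded_support_def
  by (rule exI[of _ "real CARD('n) * s"]) (auto intro!: far simp: field_simps)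

lemma symbol_on_cutoff:
  assumes "\<And>i y. (i, y) \<in> D \<Longrightarrow> s i > 0 \<and> y \<noteq> 0" "open_slices D"
  shows "symbol_on m d D (\<lambda>i y. H y * \<psi> (y /\<^sub>R s i))"
proof -
  have "symbol_on m d D (\<lambda>i. H)"
    by (rule symbol_on_homogeneous_function[OF H_smooth]) (use H_hom assms in auto)
  moreover have "symbol_on m 0 D (\<lambda>i y. \<psi> (y /\<^sub>R s i))"
    using symbol_on_dilated_cutoff[OF smooth far, where D=D and s=s and m=m and e=0] assms(1) by simp
  ultimately show ?thesis using symbol_on_mult[of m d D "\<lambda>i. H" 0 "\<lambda>i y. \<psi> (y /\<^sub>R s i)"] by simp
qed

lemma integrable_cutoff:
  assumes "s > 0" shows "integrable lborel (\<lambda>y. H y * \<psi> (y /\<^sub>R s))"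
proof (rule symbol_integrable[OF d, where I="{()}" and F="\<lambda>_ y. H y * \<psi> (y /\<^sub>R s)"])
  show "symbol_on (Suc 0) d ({()} \<times> - {0}) (\<lambda>_ y. H y * \<psi> (y /\<^sub>R s))"
    by (rule symbol_on_cutoff) (use assms in \<open>auto intro!: open_slices_Times\<close>)
qed (use bounded_support_cutoff[OF assms] H0 in auto)

text \<open>
  The difference of the two integrands is a symbol of degree \<open>d\<close>, uniformly in \<open>s\<close> and \<open>s'\<close>, and vanishes
  for \<open>|y| < 3s/4\<close>. Trading this gap for \<open>M\<close> extra powers of \<open>|y|\<close> gives the rate.
\<close>

lemma dilation_error_cauchy:
  fixes \<alpha> :: "real ^ 'n"
  assumes "M \<ge> 0"
  obtains K where "K \<ge> 0" "\<And>s s'. 0 < s \<Longrightarrow> s \<le> s' \<Longrightarrow> \<bar>dilation_error \<alpha> \<psi> H s - dilation_error \<alpha> \<psi> H s'\<bar> \<le> K * s powr (- M)"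
proof -
  define I where "I = {(s, s'). 0 < s \<and> s \<le> (s'::real)}"
  define D where "D = I \<times> - {0 :: real ^ 'n}"
  define F where "F = (\<lambda>(s, s') y. H y * \<psi> (y /\<^sub>R s) + (-1) * (H y * \<psi> (y /\<^sub>R s')))"
  have D: "open_slices D" unfolding D_def by (intro open_slices_Times) auto
  have sym0: "symbol_on m d D F" for m
  proof -
    have "symbol_on m d D (\<lambda>i y. H y * \<psi> (y /\<^sub>R fst i))" "symbol_on m d D (\<lambda>i y. H y * \<psi> (y /\<^sub>R snd i))"
      by (rule symbol_on_cutoff; use D in \<open>auto simp: D_def I_def\<close>)+
    from symbol_on_add[OF this(1) symbol_on_uminus[OF this(2)]]
    show ?thesis by (simp add: F_def case_prod_unfold)
  qed
  have Fsupp: "bounded_support (F i)" if i: "i \<in> I" for i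
  proof -
    obtain s s' where ss: "i = (s, s')" "0 < s" "s \<le> s'" using i by (auto simp: I_def)
    obtain R R' where "\<And>x. norm x > R \<Longrightarrow> H x * \<psi> (x /\<^sub>R s) = 0" "\<And>x. norm x > R' \<Longrightarrow> H x * \<psi> (x /\<^sub>R s') = 0"
      using bounded_support_cutoff[of s] bounded_support_cutoff[of s'] ss unfolding bounded_support_def by (metis less_le_trans)
    then have "F i x = 0" if "norm x > max R R'" for x
      using that unfolding ss F_def prod.case by (simp only: max_less_iff_conj mult_zero_right add_0_right)
    then show ?thesis unfolding bounded_support_def by blast
  qed
  have sym: "symbol_on m (d + M) D (\<lambda>i y. (3 / 4 * fst i) powr M * F i y)" for m
  proof (rule symbol_on_vanish_gain[OF sym0 _ D])
    fix i y assume iy: "(i, y) \<in> D" and n: "norm y < 3 / 4 * fst i"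
    obtain s s' where ss: "i = (s, s')" "0 < s" "s \<le> s'" using iy by (auto simp: I_def D_def)
    have "norm (y /\<^sub>R s) < 3 / 4" "norm (y /\<^sub>R s') < 3 / 4" using n ss by (auto simp: field_simps)
    then show "F i y = 0" using near by (simp add: F_def ss)
  qed (use assms in \<open>auto simp: D_def I_def\<close>)
  have "d + M > - real CARD('n)" using d assms by simp
  then obtain K where
    K: "K \<ge> 0" "\<And>i h. i \<in> I \<Longrightarrow> h > 0 \<Longrightarrow>
      \<bar>quad_error h \<alpha> (\<lambda>y. (3 / 4 * fst i) powr M * F i y)\<bar> \<le> K * h powr (d + M + real CARD('n))"
  proof (rule quad_error_symbol_bound[OF _ sym[unfolded D_def], of \<alpha>])
    fix i assume "i \<in> I"
    then show "bounded_support (\<lambda>y. (3 / 4 * fst i) powr M * F i y)"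
      using Fsupp[of i] unfolding bounded_support_def by (metis mult_zero_right)
    show "(3 / 4 * fst i) powr M * F i 0 = 0" by (simp add: F_def H0 case_prod_unfold)
  qed blast
  have "\<bar>dilation_error \<alpha> \<psi> H s - dilation_error \<alpha> \<psi> H s'\<bar> \<le> (K * (3/4) powr (- M)) * s powr (- M)"
    if s: "0 < s" "s \<le> s'" for s s'
  proof -
    have i: "(s, s') \<in> I" using s by (simp add: I_def)
    have "integrable lborel (F (s, s'))"
      using integrable_cutoff[of s] integrable_cutoff[of s'] s by (simp add: F_def)
    then have "\<bar>(3 / 4 * s) powr M * quad_error 1 \<alpha> (F (s, s'))\<bar> \<le> K"
      using K(2)[OF i, of 1] quad_error_cmult[OF _ Fsupp[OF i], of 1 \<alpha>] by simp
    then have "\<bar>quad_error 1 \<alpha> (F (s, s'))\<bar> \<le> K * (3 / 4 * s) powr (- M)"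
      using s by (simp add: abs_mult powr_minus field_simps)
    also have "\<dots> = (K * (3/4) powr (- M)) * s powr (- M)" using powr_mult[of "3/4" s "- M"] by simp
    also have "quad_error 1 \<alpha> (F (s, s')) = dilation_error \<alpha> \<psi> H s - dilation_error \<alpha> \<psi> H s'"
      unfolding F_def dilation_error_def prod.case
      using s by (subst quad_error_lincomb2) (auto intro: bounded_support_cutoff integrable_cutoff)
    finally show ?thesis .
  qed
  then show thesis using that[of "K * (3/4) powr (- M)"] K(1) by simp
qed

lemma dilation_error_limit:
  fixes \<alpha> :: "real ^ 'n"
  obtains E where "\<And>M. M \<ge> 0 \<Longrightarrow> \<exists>K\<ge>0. \<forall>s>0. \<bar>dilation_error \<alpha> \<psi> H s - E\<bar> \<le> K * s powr (- M)"
proof -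
  let ?e = "dilation_error \<alpha> \<psi> H"
  obtain K1 where K1: "K1 \<ge> 0" "\<And>s s'. 0 < s \<Longrightarrow> s \<le> s' \<Longrightarrow> \<bar>?e s - ?e s'\<bar> \<le> K1 * s powr (- 1)"
    using dilation_error_cauchy[of 1 \<alpha>] by auto
  have "Cauchy (\<lambda>k. ?e (real (Suc k)))"
  proof (rule metric_CauchyI)
    fix \<epsilon> :: real assume \<epsilon>: "\<epsilon> > 0"
    obtain N :: nat where N: "real N > 2 * K1 / \<epsilon>" using reals_Archimedean2 by blast
    have *: "\<bar>?e (real (Suc N)) - ?e (real (Suc k))\<bar> < \<epsilon> / 2" if "k \<ge> N" for k
    proof -
      have "\<bar>?e (real (Suc N)) - ?e (real (Suc k))\<bar> \<le> K1 * real (Suc N) powr (- 1)"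
        using that by (intro K1(2)) auto
      also have "\<dots> = K1 / real (Suc N)" by (simp add: powr_minus divide_inverse)
      also have "\<dots> < \<epsilon> / 2" using N \<epsilon> by (simp add: field_simps)
      finally show ?thesis .
    qed
    show "\<exists>M. \<forall>m\<ge>M. \<forall>n\<ge>M. dist (?e (real (Suc m))) (?e (real (Suc n))) < \<epsilon>"
    proof (intro exI[of _ N] allI impI)
      fix m n assume "m \<ge> N" "n \<ge> N"
      from *[OF this(1)] *[OF this(2)] show "dist (?e (real (Suc m))) (?e (real (Suc n))) < \<epsilon>"
        unfolding dist_real_def by linarith
    qed
  qed
  then obtain E where E: "(\<lambda>k. ?e (real (Suc k))) \<longlonglongrightarrow> E" using Cauchy_convergent_iff convergent_def by blast
  have "\<exists>K\<ge>0. \<forall>s>0. \<bar>?e s - E\<bar> \<le> K * s powr (- M)" if "M \<ge> 0" for M :: real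
  proof -
    obtain K where K: "K \<ge> 0" "\<And>s s'. 0 < s \<Longrightarrow> s \<le> s' \<Longrightarrow> \<bar>?e s - ?e s'\<bar> \<le> K * s powr (- M)"
      using dilation_error_cauchy[OF \<open>M \<ge> 0\<close>, of \<alpha>] by blast
    have "\<bar>?e s - E\<bar> \<le> K * s powr (- M)" if s: "s > 0" for s
    proof (rule LIMSEQ_le_const2)
      show "(\<lambda>k. \<bar>?e s - ?e (real (Suc k))\<bar>) \<longlonglongrightarrow> \<bar>?e s - E\<bar>" by (intro tendsto_intros E)
      obtain N :: nat where N: "real N > s" using reals_Archimedean2 by blast
      show "\<exists>N. \<forall>n\<ge>N. \<bar>?e s - ?e (real (Suc n))\<bar> \<le> K * s powr (- M)"
        using s N by (intro exI[of _ N] allI impI K(2)) auto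
    qed
    with K(1) show ?thesis by blast
  qed
  with that show thesis by blast
qed

text \<open>
  Substituting \<open>h y\<close> for \<open>y\<close> changes the cutoff radius from \<open>\<Lambda>\<close> to \<open>\<Lambda>/h\<close>.
\<close>

lemma quad_error_cutoff:
  assumes h: "h > 0" and \<Lambda>: "\<Lambda> > 0"
  shows "quad_error h \<alpha> (\<lambda>y. H y * \<psi> (y /\<^sub>R \<Lambda>)) = h powr (d + real CARD('n)) * dilation_error \<alpha> \<psi> H (\<Lambda> / h)"
proof -
  have meas: "(\<lambda>y. H y * \<psi> (y /\<^sub>R \<Lambda>)) \<in> borel_measurable borel"
    using borel_measurable_integrable[OF integrable_cutoff[OF \<Lambda>]] by simp
  have "quad_error h \<alpha> (\<lambda>y. H y * \<psi> (y /\<^sub>R \<Lambda>)) = h ^ CARD('n) * quad_error 1 \<alpha> (\<lambda>y. H (h *\<^sub>R y) * \<psi> ((h *\<^sub>R y) /\<^sub>R \<Lambda>))"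
    by (rule quad_error_scale[OF h meas])
  also have "(\<lambda>y. H (h *\<^sub>R y) * \<psi> ((h *\<^sub>R y) /\<^sub>R \<Lambda>)) = (\<lambda>y. h powr d * (H y * \<psi> (y /\<^sub>R (\<Lambda> / h))))"
    using h \<Lambda> by (auto simp: H_hom field_simps)
  also have "quad_error 1 \<alpha> \<dots> = h powr d * dilation_error \<alpha> \<psi> H (\<Lambda> / h)"
    unfolding dilation_error_def
    using h \<Lambda> by (intro quad_error_cmult bounded_support_cutoff integrable_cutoff) auto
  finally show ?thesis using h by (simp add: powr_add powr_realpow mult_ac)
qed

end

section \<open>Multi-indices and iterated partial derivatives\<close>

text \<open>
  Taylor expansions are written as sums over words of coordinates, one for each order of
  differentiation, so that equal mixed derivatives are not collected. A word matters only through its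
  multi-index once it is paired with a moment.
\<close>

definition mi_of :: "'n list \<Rightarrow> nat ^ 'n" where
  "mi_of xs = (\<chi> i. count_list xs i)"

lemma mi_order_mi_of: "mi_order (mi_of xs) = length xs"
proof (induction xs)
  case (Cons x xs)
  have "mi_order (mi_of (x # xs)) = (\<Sum>i\<in>UNIV. count_list xs i + (if x = i then 1 else 0))"
    unfolding mi_order_def mi_of_def by (intro sum.cong) auto
  also have "\<dots> = mi_order (mi_of xs) + 1"
    by (simp add: sum.distrib mi_order_def mi_of_def)
  finally show ?case using Cons by simp
qed (simp add: mi_order_def mi_of_def)

lemma mi_power_Nil: "mi_power y (mi_of []) = 1"
  by (simp add: mi_power_def mi_of_def)

lemma mi_power_Cons: "mi_power y (mi_of (x # xs)) = y $ x * mi_power y (mi_of xs)"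
proof -
  have "mi_power y (mi_of (x # xs)) = (\<Prod>i\<in>UNIV. y $ i ^ count_list xs i * (if i = x then y $ i else 1))"
    unfolding mi_power_def mi_of_def by (intro prod.cong) auto
  also have "\<dots> = mi_power y (mi_of xs) * y $ x"
    by (simp add: prod.distrib mi_power_def mi_of_def)
  finally show ?thesis by simp
qed

lemma mi_power_scale: "mi_power (c *\<^sub>R y) \<beta> = c ^ mi_order \<beta> * mi_power y \<beta>"
  by (simp add: mi_power_def mi_order_def power_mult_distrib prod.distrib power_sum)

lemma Cinf_on_mi_power: "open U \<Longrightarrow> Cinf_on U (\<lambda>y. mi_power y \<beta>)"
  unfolding Cinf_on_def mi_power_def
proof
  fix k assume U: "open U"
  show "Ck_on k U (\<lambda>y. \<Prod>i\<in>UNIV. y $ i ^ (\<beta> $ i))"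
    using Ck_on_inner[OF U, of k "axis _ 1"] by (intro Ck_on_prod U Ck_on_power) (simp add: inner_axis)
qed

fun pderivs :: "'n list \<Rightarrow> (real ^ 'n \<Rightarrow> real) \<Rightarrow> real ^ 'n \<Rightarrow> real" where
  "pderivs [] v x = v x"
| "pderivs (i # xs) v x = frechet_derivative (pderivs xs v) (at x) (axis i 1)"

lemma Cinf_on_pderivs: "Cinf_on UNIV v \<Longrightarrow> Cinf_on UNIV (pderivs xs v)"
proof (induction xs)
  case Nil
  have "pderivs [] v = v" by auto
  with Nil show ?case by simp
next
  case (Cons i xs)
  have "pderivs (i # xs) v = (\<lambda>x. frechet_derivative (pderivs xs v) (at x) (axis i 1))" by auto
  then show ?case using Cinf_on_frechet[OF Cons.IH[OF Cons.prems]] by simp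
qed

lemma pderivs_vanish:
  assumes "\<And>x. norm x > B \<Longrightarrow> v x = 0" shows "norm x > B \<Longrightarrow> pderivs xs v x = 0"
  by (induction xs arbitrary: x) (auto intro: assms frechet_derivative_vanish)

lemma finite_lists_length: "finite {xs :: 'n::finite list. length xs = j}"
  using finite_lists_length_eq[of "UNIV :: 'n set" j] by simp

lemma sum_lists_Suc:
  "(\<Sum>xs | length xs = Suc j. f xs) = (\<Sum>xs | length xs = j. \<Sum>i\<in>(UNIV :: 'n::finite set). f (i # xs))"
proof -
  have "(\<Sum>xs | length xs = j. \<Sum>i\<in>(UNIV :: 'n set). f (i # xs))
      = (\<Sum>(xs, i)\<in>{xs. length xs = j} \<times> UNIV. f (i # xs))"
    by (rule sum.cartesian_product)
  also have "\<dots> = (\<Sum>xs | length xs = Suc j. f xs)"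
    by (rule sum.reindex_bij_witness[of _ "\<lambda>xs. (tl xs, hd xs)" "\<lambda>(xs, i). i # xs"])
      (auto simp: length_Suc_conv)
  finally show ?thesis by simp
qed

definition taylor_coeff :: "(real ^ 'n \<Rightarrow> real) \<Rightarrow> 'n list \<Rightarrow> real ^ 'n \<Rightarrow> real" where
  "taylor_coeff v xs a = pderivs xs v a / fact (length xs)"

text \<open>
  The \<open>j\<close>-th derivative of \<open>t \<mapsto> v (t y + a)\<close>, divided by \<open>j!\<close>.
\<close>

definition line_deriv :: "(real ^ 'n \<Rightarrow> real) \<Rightarrow> real ^ 'n \<Rightarrow> nat \<Rightarrow> real \<Rightarrow> real ^ 'n \<Rightarrow> real" where
  "line_deriv v a j t y = (\<Sum>xs | length xs = j. taylor_coeff v xs (t *\<^sub>R y + a) * mi_power y (mi_of xs))"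

lemma line_deriv_0: "line_deriv v a 0 t y = v (t *\<^sub>R y + a)"
  by (simp add: line_deriv_def taylor_coeff_def mi_power_Nil)

lemma line_deriv_has_real_derivative:
  assumes v: "Cinf_on UNIV v"
  shows "((\<lambda>t. line_deriv v a j t y) has_real_derivative real (Suc j) * line_deriv v a (Suc j) t y) (at t)"
proof -
  have D: "((\<lambda>t. pderivs xs v (t *\<^sub>R y + a)) has_real_derivative (\<Sum>i\<in>UNIV. y $ i * pderivs (i # xs) v (t *\<^sub>R y + a))) (at t)"
    for xs
  proof -
    let ?D = "frechet_derivative (pderivs xs v) (at (t *\<^sub>R y + a))"
    have "(pderivs xs v has_derivative ?D) (at (t *\<^sub>R y + a))"
      by (rule Cinf_on_has_derivative[OF Cinf_on_pderivs[OF v]]) simp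
    moreover have "((\<lambda>t. t *\<^sub>R y + a) has_derivative (\<lambda>s. s *\<^sub>R y)) (at t)" by (auto intro!: derivative_eq_intros)
    ultimately have comp: "((\<lambda>t. pderivs xs v (t *\<^sub>R y + a)) has_derivative (\<lambda>s. ?D (s *\<^sub>R y))) (at t)"
      using has_derivative_compose[of "\<lambda>t. t *\<^sub>R y + a" "\<lambda>s. s *\<^sub>R y" t UNIV "pderivs xs v" ?D] by blast
    have lin: "linear ?D" using \<open>(pderivs xs v has_derivative ?D) _\<close> has_derivative_linear by blast
    have "y = (\<Sum>i\<in>UNIV. y $ i *\<^sub>R axis i 1)" using basis_expansion[of y] by (simp add: scalar_mult_eq_scaleR)
    then have "?D y = (\<Sum>i\<in>UNIV. y $ i * pderivs (i # xs) v (t *\<^sub>R y + a))"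
      using linear_sum[OF lin, of "\<lambda>i. y $ i *\<^sub>R axis i 1" UNIV] by (simp add: linear_cmul[OF lin])
    then show ?thesis using comp unfolding has_field_derivative_def
      by (simp add: linear_cmul[OF lin] mult_commute_abs)
  qed
  have eq: "real (Suc j) * line_deriv v a (Suc j) t y = (\<Sum>xs | length xs = j.
      (\<Sum>i\<in>UNIV. y $ i * pderivs (i # xs) v (t *\<^sub>R y + a)) / fact (length xs) * mi_power y (mi_of xs))"
    unfolding line_deriv_def sum_lists_Suc sum_distrib_left
    by (intro sum.cong refl)
      (simp add: taylor_coeff_def mi_power_Cons sum_distrib_right sum_distrib_left sum_divide_distrib field_simps
        del: pderivs.simps of_nat_Suc)
  show ?thesis
  proof (subst eq)
    show "((\<lambda>t. line_deriv v a j t y) has_real_derivative (\<Sum>xs | length xs = j.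
        (\<Sum>i\<in>UNIV. y $ i * pderivs (i # xs) v (t *\<^sub>R y + a)) / fact (length xs) * mi_power y (mi_of xs))) (at t)"
      unfolding line_deriv_def taylor_coeff_def by (intro DERIV_sum DERIV_cmult_right DERIV_cdivide D)
  qed
qed

text \<open>
  With the derivatives \<open>A k\<close>, \<open>B k\<close> divided by \<open>k!\<close> the binomial coefficients disappear.
\<close>

lemma leibniz_normalised:
  fixes A B :: "nat \<Rightarrow> real \<Rightarrow> real"
  assumes "\<And>k. (A k has_real_derivative real (Suc k) * A (Suc k) t) (at t)"
    and "\<And>k. (B k has_real_derivative real (Suc k) * B (Suc k) t) (at t)"
  shows "((\<lambda>t. \<Sum>k\<le>j. A k t * B (j - k) t) has_real_derivative
      real (Suc j) * (\<Sum>k\<le>Suc j. A k t * B (Suc j - k) t)) (at t)"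
proof -
  have "((\<lambda>t. \<Sum>k\<le>j. A k t * B (j - k) t) has_real_derivative
      (\<Sum>k\<le>j. real (Suc k) * A (Suc k) t * B (j - k) t + real (Suc (j - k)) * B (Suc (j - k)) t * A k t)) (at t)"
    by (intro DERIV_sum DERIV_mult assms)
  also have "(\<Sum>k\<le>j. real (Suc k) * A (Suc k) t * B (j - k) t + real (Suc (j - k)) * B (Suc (j - k)) t * A k t)
      = (\<Sum>k\<le>j. real (Suc k) * (A (Suc k) t * B (j - k) t)) + (\<Sum>k\<le>j. real (Suc j - k) * (A k t * B (Suc j - k) t))"
    unfolding sum.distrib by (intro arg_cong2[where f="(+)"] sum.cong refl) (auto simp: Suc_diff_le)
  also have "(\<Sum>k\<le>j. real (Suc k) * (A (Suc k) t * B (j - k) t)) = (\<Sum>k\<le>Suc j. real k * (A k t * B (Suc j - k) t))"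
    by (subst sum.atMost_Suc_shift) simp
  also have "(\<Sum>k\<le>j. real (Suc j - k) * (A k t * B (Suc j - k) t)) = (\<Sum>k\<le>Suc j. real (Suc j - k) * (A k t * B (Suc j - k) t))"
    by simp
  also have "(\<Sum>k\<le>Suc j. real k * (A k t * B (Suc j - k) t)) + (\<Sum>k\<le>Suc j. real (Suc j - k) * (A k t * B (Suc j - k) t))
      = real (Suc j) * (\<Sum>k\<le>Suc j. A k t * B (Suc j - k) t)"
    unfolding sum_distrib_left sum.distrib[symmetric]
  proof (intro sum.cong refl)
    fix k assume "k \<in> {..Suc j}"
    then have "real k + real (Suc j - k) = real (Suc j)" by (simp add: of_nat_diff)
    then show "real k * (A k t * B (Suc j - k) t) + real (Suc j - k) * (A k t * B (Suc j - k) t)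
        = real (Suc j) * (A k t * B (Suc j - k) t)" by (simp only: distrib_right[symmetric])
  qed
  finally show ?thesis .
qed

section \<open>The radial expansion of the singular factor\<close>

text \<open>
  The \<open>k\<close>-th radial derivative of \<open>l\<close>, extended to all directions \<open>y \<noteq> 0\<close> as a function homogeneous of degree
  zero in \<open>y\<close>, so that derivatives on an open set replace those on the sphere.
\<close>

definition radial_ext :: "(real \<times> (real ^ 'n) \<Rightarrow> real) \<Rightarrow> nat \<Rightarrow> real \<times> (real ^ 'n) \<Rightarrow> real" where
  "radial_ext l k z = (deriv ^^ k) (\<lambda>r. l (r, snd z /\<^sub>R norm (snd z))) (fst z)"

lemma radial_ext_homogeneous:
  assumes "c > 0" shows "radial_ext l k (r, c *\<^sub>R y) = radial_ext l k (r, y)"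
proof -
  have "inverse (norm (c *\<^sub>R y)) * c = inverse (norm y)"
    using assms by (cases "norm y = 0") (simp_all add: field_simps)
  then have "(c *\<^sub>R y) /\<^sub>R norm (c *\<^sub>R y) = y /\<^sub>R norm y" by (simp only: scaleR_scaleR)
  then show ?thesis by (simp only: radial_ext_def fst_conv snd_conv)
qed

locale radial_function =
  fixes l :: "real \<times> (real ^ 'n) \<Rightarrow> real" and L' :: real
  assumes l_smooth: "smooth_on_subset ({-L'<..<L'} \<times> sphere 0 1) l"
begin

definition \<Omega> :: "(real \<times> (real ^ 'n)) set" where "\<Omega> = {-L'<..<L'} \<times> -{0}"

lemma open_\<Omega>: "open \<Omega>" unfolding \<Omega>_def by (intro open_Times) auto

lemma Cinf_on_snd_inner: "Cinf_on \<Omega> (\<lambda>z. snd z \<bullet> b)"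
  using Ck_on_inner[OF open_\<Omega>, of _ "(0, b)"] by (simp add: Cinf_on_def inner_prod_def)

lemma Cinf_on_norm_snd: "Cinf_on \<Omega> (\<lambda>z. norm (snd z) powr a)"
  by (rule Cinf_on_norm_powr[OF open_\<Omega> Cinf_on_snd_inner]) (auto simp: \<Omega>_def)

text \<open>
  Locally \<open>l\<close> is the restriction of a smooth function on an open set, which is composed with the smooth
  retraction \<open>(r, y) \<mapsto> (r, y/|y|)\<close>.
\<close>

lemma Cinf_on_radial_ext_0: "Cinf_on \<Omega> (radial_ext l 0)"
  unfolding Cinf_on_def
proof
  fix k show "Ck_on k \<Omega> (radial_ext l 0)"
  proof (rule Ck_on_local)
    fix z assume z: "z \<in> \<Omega>"
    define g where "g z = (fst z, snd z /\<^sub>R norm (snd z))" for z :: "real \<times> (real ^ 'n)"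
    have "g z \<in> {-L'<..<L'} \<times> sphere 0 1" using z by (auto simp: g_def \<Omega>_def)
    from bspec[OF l_smooth[unfolded smooth_on_subset_def] this]
    obtain U F where U: "open U" "g z \<in> U" "Cinf_on U F" "\<forall>y\<in>U \<inter> ({-L'<..<L'} \<times> sphere 0 1). F y = l y"
      by (elim exE conjE) (rule that)
    define V where "V = \<Omega> \<inter> g -` U"
    have "continuous_on \<Omega> g" unfolding g_def by (intro continuous_intros) (auto simp: \<Omega>_def)
    then have V: "open V" using continuous_open_preimage[OF _ open_\<Omega> U(1)] by (simp add: V_def)
    have "Ck_on k V (\<lambda>z. F (g z))"
    proof (rule Ck_on_compose[OF V, where f=F and g=g])
      show "Ck_on k U F" using U(3) by (simp add: Cinf_on_def)
      fix b :: "real \<times> (real ^ 'n)"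
      have "Ck_on k V (\<lambda>z. z \<bullet> (fst b, 0) + (snd z \<bullet> snd b) * norm (snd z) powr (-1))"
        using Cinf_on_snd_inner[of "snd b"] Cinf_on_norm_snd[of "-1"] unfolding Cinf_on_def
        by (intro Ck_on_add Ck_on_mult V Ck_on_inner) (auto intro: Ck_on_subset simp: V_def)
      then show "Ck_on k V (\<lambda>z. g z \<bullet> b)"
        by (subst Ck_on_cong[OF V]) (auto simp: g_def inner_prod_def powr_minus V_def \<Omega>_def)
    qed (auto simp: V_def)
    then have "Ck_on k V (radial_ext l 0)"
    proof (subst Ck_on_cong[OF V, of _ "\<lambda>z. F (g z)"])
      fix x assume "x \<in> V"
      then have "g x \<in> U \<inter> ({-L'<..<L'} \<times> sphere 0 1)" by (auto simp: V_def g_def \<Omega>_def)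
      then show "radial_ext l 0 x = F (g x)" using U(4) by (simp add: radial_ext_def g_def)
    qed
    then show "\<exists>V. open V \<and> z \<in> V \<and> Ck_on k V (radial_ext l 0)"
      using V z U(2) by (auto simp: V_def)
  qed
qed

lemma radial_ext_derivative_aux:
  assumes "Cinf_on \<Omega> (radial_ext l k)" "(r, y) \<in> \<Omega>"
  shows "((\<lambda>r. radial_ext l k (r, y)) has_real_derivative frechet_derivative (radial_ext l k) (at (r, y)) (1, 0)) (at r)"
proof -
  let ?D = "frechet_derivative (radial_ext l k) (at (r, y))"
  have D: "(radial_ext l k has_derivative ?D) (at (r, y))" by (rule Cinf_on_has_derivative[OF assms])
  have "((\<lambda>r. (r, y)) has_derivative (\<lambda>s. (s, 0))) (at r)" by (auto intro!: derivative_eq_intros)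
  then have "((\<lambda>r. radial_ext l k (r, y)) has_derivative (\<lambda>s. ?D (s, 0))) (at r)"
    using has_derivative_compose[of "\<lambda>r. (r, y)" "\<lambda>s. (s, 0)" r UNIV "radial_ext l k" ?D] D by blast
  moreover have "(\<lambda>s. ?D (s, 0)) = (*) (?D (1, 0))"
  proof
    fix s show "?D (s, 0) = ?D (1, 0) * s"
      using linear_cmul[OF has_derivative_linear[OF D], of s "(1, 0)"] by simp
  qed
  ultimately show ?thesis by (simp only: has_field_derivative_def)
qed

lemma radial_ext_Suc: "radial_ext l (Suc k) (r, y) = deriv (\<lambda>r. radial_ext l k (r, y)) r"
  by (simp add: radial_ext_def)

lemma Cinf_on_radial_ext: "Cinf_on \<Omega> (radial_ext l k)"
proof (induction k)
  case (Suc k)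
  have eq: "radial_ext l (Suc k) z = frechet_derivative (radial_ext l k) (at z) (1, 0)" if "z \<in> \<Omega>" for z
    using DERIV_imp_deriv[OF radial_ext_derivative_aux[OF Suc, of "fst z" "snd z"]] that
    by (simp add: radial_ext_Suc[of k "fst z" "snd z", simplified])
  show ?case unfolding Cinf_on_def
  proof
    fix n
    have "Ck_on n \<Omega> (\<lambda>z. frechet_derivative (radial_ext l k) (at z) (1, 0))"
      using Cinf_on_frechet[OF Suc, of "(1, 0)"] by (simp only: Cinf_on_def)
    then show "Ck_on n \<Omega> (radial_ext l (Suc k))" 
      using Ck_on_cong[OF open_\<Omega>, of "radial_ext l (Suc k)" "\<lambda>z. frechet_derivative (radial_ext l k) (at z) (1, 0)" n] eq
      by blast
  qed
qed (rule Cinf_on_radial_ext_0)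

lemma radial_ext_has_real_derivative:
  assumes "(r, y) \<in> \<Omega>"
  shows "((\<lambda>r. radial_ext l k (r, y)) has_real_derivative radial_ext l (Suc k) (r, y)) (at r)"
  using radial_ext_derivative_aux[OF Cinf_on_radial_ext assms] DERIV_imp_deriv[OF radial_ext_derivative_aux[OF Cinf_on_radial_ext assms]]
  by (simp add: radial_ext_Suc)

text \<open>
  The \<open>k\<close>-th derivative of \<open>t \<mapsto> l (t |y|, y/|y|)\<close>, divided by \<open>k!\<close>.
\<close>

definition ray_deriv :: "nat \<Rightarrow> real \<Rightarrow> real ^ 'n \<Rightarrow> real" where
  "ray_deriv k t y = norm y ^ k * radial_ext l k (t * norm y, y) / fact k"

lemma ray_deriv_has_real_derivative:
  assumes "(t * norm y, y) \<in> \<Omega>"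
  shows "((\<lambda>t. ray_deriv k t y) has_real_derivative real (Suc k) * ray_deriv (Suc k) t y) (at t)"
proof -
  have "((\<lambda>t. radial_ext l k (t * norm y, y)) has_real_derivative radial_ext l (Suc k) (t * norm y, y) * norm y) (at t)"
    by (rule DERIV_chain2[where f="\<lambda>r. radial_ext l k (r, y)" and g="\<lambda>t. t * norm y"])
      (auto intro!: derivative_eq_intros radial_ext_has_real_derivative[OF assms])
  from DERIV_cdivide[OF DERIV_cmult[OF this, of "norm y ^ k"], of "fact k"]
  show ?thesis by (simp add: ray_deriv_def[abs_def] field_simps del: of_nat_Suc)
qed

text \<open>
  At \<open>t = 0\<close> the ray expansion of the singular factor produces the homogeneous functions of the
  composite rule.
\<close>

lemma ray_deriv_0: "norm y powr a * ray_deriv k 0 y = homogeneous_sing (a + real k) (radial_coeff l k) y"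
proof (cases "y = 0")
  case False
  then have "norm y powr a * norm y ^ k = norm y powr (a + real k)" by (simp add: powr_add powr_realpow)
  moreover have "norm y powr a * ray_deriv k 0 y = (norm y powr a * norm y ^ k) * radial_coeff l k (y /\<^sub>R norm y)"
    by (simp add: ray_deriv_def radial_ext_def radial_coeff_def)
  ultimately show ?thesis by (simp add: homogeneous_sing_def)
qed (simp add: homogeneous_sing_def)

lemma symbol_on_ray_deriv:
  assumes "\<rho> < L'" "\<And>i y. (i, y) \<in> D \<Longrightarrow> y \<noteq> 0 \<and> \<bar>\<tau> i * norm y\<bar> \<le> \<rho>" "open_slices D"
  shows "symbol_on m (a + real k) D (\<lambda>i y. norm y powr a * ray_deriv k (\<tau> i) y)"
proof -
  let ?N = "\<lambda>z. norm (snd z) powr (a + real k) * radial_ext l k z * (1 / fact k)"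
  have "symbol_on m (a + real k) D (\<lambda>i y. ?N (\<tau> i * norm y, y))"
  proof (rule symbol_on_homogeneous[OF _ _ assms])
    have "Cinf_on \<Omega> ?N"
      by (intro Cinf_on_mult open_\<Omega> Cinf_on_norm_snd Cinf_on_radial_ext) (simp add: Cinf_on_def Ck_on_const)
    then show "Cinf_on ({-L'<..<L'} \<times> - {0}) ?N" by (simp add: \<Omega>_def)
    show "?N (r, c *\<^sub>R y) = c powr (a + real k) * ?N (r, y)" if "c > 0" for r y c
      using that by (simp add: powr_mult radial_ext_homogeneous)
  qed
  show ?thesis
  proof (rule symbol_on_cong[OF assms(3) _ \<open>symbol_on m _ D _\<close>])
    fix i y assume "(i, y) \<in> D"
    then have "norm y > 0" using assms(2) by simp
    then show "?N (\<tau> i * norm y, y) = norm y powr a * ray_deriv k (\<tau> i) y"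
      by (simp add: ray_deriv_def powr_add powr_realpow)
  qed
qed

lemma homogeneous_sing_smooth:
  assumes "L' > 0"
  shows "Cinf_on (-{0}) (\<lambda>y. homogeneous_sing (a + real k) (radial_coeff l k) y * mi_power y \<beta>)"
proof -
  have op: "open (-{0 :: real ^ 'n})" by auto
  have "Cinf_on (-{0}) (\<lambda>y. radial_ext l k (0, y))"
  proof (rule Cinf_on_compose[OF op Cinf_on_radial_ext])
    fix b :: "real \<times> (real ^ 'n)"
    show "Cinf_on (-{0}) (\<lambda>y. (0, y) \<bullet> b)"
      using Ck_on_inner[OF op, of _ "snd b"] by (simp add: Cinf_on_def inner_prod_def)
  qed (use assms in \<open>auto simp: \<Omega>_def\<close>)
  moreover have "Cinf_on (-{0}) (\<lambda>y :: real ^ 'n. norm y powr (a + real k))"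
    by (rule Cinf_on_norm_powr[OF op]) (auto simp: Cinf_on_def intro!: Ck_on_inner op)
  ultimately have "Cinf_on (-{0}) (\<lambda>y. norm y powr (a + real k) * radial_ext l k (0, y) * (1 / fact k) * mi_power y \<beta>)"
    by (intro Cinf_on_mult op Cinf_on_mi_power) (auto simp: Cinf_on_def Ck_on_const)
  also have "(\<lambda>y. norm y powr (a + real k) * radial_ext l k (0, y) * (1 / fact k) * mi_power y \<beta>)
      = (\<lambda>y. homogeneous_sing (a + real k) (radial_coeff l k) y * mi_power y \<beta>)"
    by (simp add: homogeneous_sing_def radial_coeff_def radial_ext_def)
  finally show ?thesis .
qed

end

section \<open>The weights\<close>

text \<open>
  The weights \<open>\<omega>(h)\<close> are a fixed matrix, the inverse of \<open>K\<close>, times the vector of scaled errors; hence they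
  converge, and the limit solves the system whose right-hand side is the limit of the scaled errors.
\<close>

lemma weight_moments:
  fixes \<alpha> :: "real ^ 'n"
  assumes inv: "invertible_mat (node_matrix \<alpha> c \<nu> q)"
    and lim: "\<And>j. j < num_mi CARD('n) q \<Longrightarrow> ((\<lambda>h. scaled_error \<psi> \<Lambda> \<alpha> \<delta> \<phi> (\<nu> j) h) \<longlongrightarrow> E j) (at_right 0)"
    and j: "j < num_mi CARD('n) q"
  shows "(\<Sum>i<num_mi CARD('n) q. weight \<psi> \<Lambda> \<alpha> c \<nu> q \<delta> \<phi> i * mi_power (c i - \<alpha>) (\<nu> j)) = E j"
proof -
  let ?N = "num_mi CARD('n) q"
  define K where "K = node_matrix \<alpha> c \<nu> q"
  have K: "K \<in> carrier_mat ?N ?N" by (simp add: K_def node_matrix_def Let_def)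
  obtain B where B: "inverts_mat K B" "inverts_mat B K" using inv unfolding invertible_mat_def K_def by blast
  have KB: "K * B = 1\<^sub>m ?N" using B(1) K by (simp add: inverts_mat_def)
  then have Bc: "dim_col B = ?N" by (metis index_mult_mat(3) index_one_mat(3))
  have BK': "B * K = 1\<^sub>m (dim_row B)" using B(2) by (simp add: inverts_mat_def)
  then have Br: "dim_row B = ?N" using K by (metis index_mult_mat(3) index_one_mat(3) carrier_matD(2))
  have Bm: "B \<in> carrier_mat ?N ?N" using Bc Br by auto
  have BK: "B * K = 1\<^sub>m ?N" using BK' Br by simp
  define R where "R h = Matrix.vec ?N (\<lambda>j. scaled_error \<psi> \<Lambda> \<alpha> \<delta> \<phi> (\<nu> j) h)" for h
  have Rc: "R h \<in> carrier_vec ?N" for h by (simp add: R_def)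
  have w: "weights_at \<psi> \<Lambda> \<alpha> c \<nu> q \<delta> \<phi> h = mult_mat_vec B (R h)" for h
    unfolding weights_at_def Let_def K_def[symmetric] R_def[symmetric]
  proof (rule the_equality)
    show "mult_mat_vec B (R h) \<in> carrier_vec ?N \<and> mult_mat_vec K (mult_mat_vec B (R h)) = R h"
      using Bm K Rc[of h] KB by (simp flip: assoc_mult_mat_vec)
    fix u assume "u \<in> carrier_vec ?N \<and> mult_mat_vec K u = R h"
    then show "u = mult_mat_vec B (R h)"
      using Bm K BK by (metis assoc_mult_mat_vec one_mult_mat_vec)
  qed
  define Ev where "Ev = Matrix.vec ?N E"
  have W: "weight \<psi> \<Lambda> \<alpha> c \<nu> q \<delta> \<phi> i = vec_index (mult_mat_vec B Ev) i" if i: "i < ?N" for i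
  proof -
    have "vec_index (mult_mat_vec B (R h)) i = (\<Sum>j<?N. B $$ (i, j) * scaled_error \<psi> \<Lambda> \<alpha> \<delta> \<phi> (\<nu> j) h)" for h
      using i Bm by (simp add: scalar_prod_def R_def lessThan_atLeast0)
    moreover have "((\<lambda>h. \<Sum>j<?N. B $$ (i, j) * scaled_error \<psi> \<Lambda> \<alpha> \<delta> \<phi> (\<nu> j) h) \<longlongrightarrow> (\<Sum>j<?N. B $$ (i, j) * E j)) (at_right 0)"
      by (intro tendsto_sum tendsto_mult tendsto_const lim) auto
    moreover have "(\<Sum>j<?N. B $$ (i, j) * E j) = vec_index (mult_mat_vec B Ev) i"
      using i Bm by (simp add: scalar_prod_def Ev_def lessThan_atLeast0)
    ultimately show ?thesis unfolding weight_def w by (simp add: tendsto_Lim)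
  qed
  have "mult_mat_vec K (mult_mat_vec B Ev) = Ev"
    using Bm K KB by (simp add: Ev_def flip: assoc_mult_mat_vec)
  then have "vec_index (mult_mat_vec K (mult_mat_vec B Ev)) j = E j" using j by (simp add: Ev_def)
  moreover have "vec_index (mult_mat_vec K (mult_mat_vec B Ev)) j
      = (\<Sum>i<?N. mi_power (c i - \<alpha>) (\<nu> j) * vec_index (mult_mat_vec B Ev) i)"
    using j Bm K by (simp add: scalar_prod_def lessThan_atLeast0 K_def node_matrix_def Let_def)
  ultimately show ?thesis by (simp add: W mult.commute)
qed

lemma scaled_error_eq:
  "scaled_error \<psi> \<Lambda> \<alpha> \<delta> \<phi> \<beta> h =
    quad_error h \<alpha> (\<lambda>y. (homogeneous_sing \<delta> \<phi> y * mi_power y \<beta>) * \<psi> (y /\<^sub>R \<Lambda>))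
      / h powr (\<delta> + real CARD('n) + real (mi_order \<beta>))" for \<alpha> :: "real ^ 'n"
  by (simp add: scaled_error_def quad_error_def cutoff_monomial_def Let_def mult.assoc)

section \<open>Expansion of the integrand\<close>

lemma bigo_at_right_0I:
  fixes g :: "real \<Rightarrow> real"
  assumes "h1 > 0" "\<And>h. 0 < h \<Longrightarrow> h < h1 \<Longrightarrow> \<bar>g h\<bar> \<le> C * h powr e"
  shows "g \<in> O[at_right 0](\<lambda>h. h powr e)"
proof (rule bigoI)
  show "\<forall>\<^sub>F h in at_right 0. norm (g h) \<le> C * norm (h powr e)"
    unfolding eventually_at_right_field using assms by (intro exI[of _ h1]) auto
qed

lemma taylor_coeff_smooth:
  assumes "Cinf_on UNIV v" shows "Cinf_on UNIV (taylor_coeff v xs)"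
proof -
  have "Cinf_on UNIV (\<lambda>x. pderivs xs v x * (1 / fact (length xs)))"
    by (intro Cinf_on_mult Cinf_on_pderivs assms open_UNIV) (simp add: Cinf_on_def Ck_on_const)
  then show ?thesis by (simp add: taylor_coeff_def[abs_def])
qed

lemma taylor_coeff_vanish:
  "(\<And>x. norm x > B \<Longrightarrow> v x = 0) \<Longrightarrow> norm x > B \<Longrightarrow> taylor_coeff v xs x = 0"
  by (simp add: taylor_coeff_def pderivs_vanish[where B=B])

lemma symbol_on_line_deriv:
  assumes v: "Cinf_on UNIV v" "\<And>x. norm x > B \<Longrightarrow> v x = 0"
    and D: "\<And>i y. (i, y) \<in> D \<Longrightarrow> y \<noteq> 0 \<and> \<bar>\<tau> i * norm y\<bar> \<le> \<rho>" "open_slices D"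
  shows "symbol_on m (real j) D (\<lambda>i y. line_deriv v (a i) j (\<tau> i) y)"
  unfolding line_deriv_def
proof (rule symbol_on_sum)
  fix xs assume "xs \<in> {xs :: 'a list. length xs = j}"
  then have len: "length xs = j" by simp
  have "symbol_on m 0 D (\<lambda>i y. taylor_coeff v xs (\<tau> i *\<^sub>R y + a i))"
    by (rule symbol_on_translate[OF taylor_coeff_smooth[OF v(1)] taylor_coeff_vanish[OF v(2)] D(1)])
  moreover have "symbol_on m (real j) D (\<lambda>i y. mi_power y (mi_of xs))"
    by (rule symbol_on_homogeneous_function[OF Cinf_on_mi_power])
      (use D in \<open>auto simp: mi_power_scale mi_order_mi_of len powr_realpow\<close>)
  ultimately show "symbol_on m (real j) D (\<lambda>i y. taylor_coeff v xs (\<tau> i *\<^sub>R y + a i) * mi_power y (mi_of xs))"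
    using symbol_on_mult[of m 0 D "\<lambda>i y. taylor_coeff v xs (\<tau> i *\<^sub>R y + a i)" "real j" "\<lambda>i y. mi_power y (mi_of xs)"] by simp
qed

text \<open>
  The Taylor polynomial of \<open>v\<close> at \<open>h\<alpha>\<close>, evaluated at the node \<open>h c = h\<alpha> + h (c - \<alpha>)\<close>. The constant does not depend
  on \<open>h\<close>, although the centre does.
\<close>

lemma node_taylor:
  fixes v :: "real ^ 'n \<Rightarrow> real"
  assumes v: "Cinf_on UNIV v" "\<And>x. norm x > B \<Longrightarrow> v x = 0"
  obtains C where "\<And>h. h > 0 \<Longrightarrow>
    \<bar>v (h *\<^sub>R c) - (\<Sum>j\<le>q. h ^ j * line_deriv v (h *\<^sub>R \<alpha>) j 0 (c - \<alpha>))\<bar> \<le> C * h ^ Suc q"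
proof -
  have "taylor_coeff v xs x = 0" if "norm x > B" for xs x
    by (rule taylor_coeff_vanish[OF v(2) that])
  then have "\<exists>T. \<forall>x. \<bar>taylor_coeff v xs x\<bar> \<le> T" for xs
    using compact_support_bounded[OF taylor_coeff_smooth[OF v(1)], of B xs] by metis
  then obtain T where T: "\<And>xs x. \<bar>taylor_coeff v xs x\<bar> \<le> T xs" by metis
  define C where "C = (\<Sum>xs | length xs = Suc q. T xs * \<bar>mi_power (c - \<alpha>) (mi_of xs)\<bar>)"
  have "\<bar>v (h *\<^sub>R c) - (\<Sum>j\<le>q. h ^ j * line_deriv v (h *\<^sub>R \<alpha>) j 0 (c - \<alpha>))\<bar> \<le> C * h ^ Suc q" if h: "h > 0" for h
  proof -
    define D where "D j t = fact j * line_deriv v (h *\<^sub>R \<alpha>) j t (c - \<alpha>)" for j t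
    have "\<forall>j t. j < Suc q \<and> 0 \<le> t \<and> t \<le> h \<longrightarrow> DERIV (D j) t :> D (Suc j) t"
    proof (intro allI impI)
      fix j t
      from DERIV_cmult[OF line_deriv_has_real_derivative[OF v(1)], of "fact j" "h *\<^sub>R \<alpha>" j "c - \<alpha>" t]
      show "DERIV (D j) t :> D (Suc j) t" unfolding D_def by (simp add: mult_ac)
    qed
    then obtain t where eq: "D 0 h = (\<Sum>j<Suc q. D j 0 / fact j * h ^ j) + D (Suc q) t / fact (Suc q) * h ^ Suc q"
      using Maclaurin[of h "Suc q" D "D 0"] h by auto
    have "h *\<^sub>R (c - \<alpha>) + h *\<^sub>R \<alpha> = h *\<^sub>R c" by (simp add: scaleR_right_diff_distrib)
    then have "v (h *\<^sub>R c) - (\<Sum>j\<le>q. h ^ j * line_deriv v (h *\<^sub>R \<alpha>) j 0 (c - \<alpha>)) = line_deriv v (h *\<^sub>R \<alpha>) (Suc q) t (c - \<alpha>) * h ^ Suc q"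
      using eq by (simp add: D_def line_deriv_0 lessThan_Suc_atMost mult.commute del: fact_Suc)
    moreover have "\<bar>line_deriv v (h *\<^sub>R \<alpha>) (Suc q) t (c - \<alpha>)\<bar> \<le> C"
      unfolding line_deriv_def C_def
      by (intro order.trans[OF sum_abs] sum_mono) (simp add: abs_mult mult_right_mono T)
    ultimately show ?thesis using h by (simp add: abs_mult mult_right_mono)
  qed
  with that show thesis by blast
qed

text \<open>
  Here \<open>L\<close> is only a radius beyond which \<open>v\<close> vanishes.
\<close>

locale composite_setting = radial_function l L' + cutoff \<psi>
  for l :: "real \<times> (real ^ 'n) \<Rightarrow> real" and L' :: real and \<psi> :: "real ^ 'n \<Rightarrow> real" +
  fixes v :: "real ^ 'n \<Rightarrow> real" and \<alpha> :: "real ^ 'n" and L \<gamma> :: real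
  assumes L: "0 \<le> L" "L < L'"
    and v_smooth: "Cinf_on UNIV v" and v_supp: "\<And>x. norm x > L \<Longrightarrow> v x = 0"
    and \<gamma>: "\<gamma> > - real CARD('n)"
begin

text \<open>
  A cutoff radius for the expansion: \<open>\<psi> (y / \<Lambda>0)\<close> lives on \<open>|y| \<le> L'/4\<close>, where \<open>l (t |y|, \<cdot>)\<close> is defined for all
  \<open>0 \<le> t \<le> 1\<close>.
\<close>

definition \<Lambda>0 :: real where "\<Lambda>0 = L' / (4 * real CARD('n))"

lemma \<Lambda>0_pos: "\<Lambda>0 > 0" using L by (simp add: \<Lambda>0_def)

lemma cutoff_far: "norm y > L' / 4 \<Longrightarrow> \<psi> (y /\<^sub>R \<Lambda>0) = 0"
  by (rule far) (use L in \<open>simp add: \<Lambda>0_def field_simps\<close>)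

text \<open>
  The integrand as a function of \<open>y = x - h\<alpha>\<close>.
\<close>

definition shifted :: "real \<Rightarrow> real ^ 'n \<Rightarrow> real" where
  "shifted h y = general_sing \<gamma> l y * v (y + h *\<^sub>R \<alpha>)"

text \<open>
  The \<open>j\<close>-th derivative, divided by \<open>j!\<close>, of \<open>t \<mapsto> |y|\<^sup>\<gamma> \<psi>(y/\<Lambda>0) l(t|y|, y/|y|) v(ty + h\<alpha>)\<close>. At \<open>t = 1\<close> and \<open>j = 0\<close>
  this is the cut-off integrand.
\<close>

definition ray_family :: "nat \<Rightarrow> real \<Rightarrow> real \<Rightarrow> real ^ 'n \<Rightarrow> real" where
  "ray_family j h t y = norm y powr \<gamma> * \<psi> (y /\<^sub>R \<Lambda>0)
     * (\<Sum>k\<le>j. ray_deriv k t y * line_deriv v (h *\<^sub>R \<alpha>) (j - k) t y)"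

lemma general_sing_eq: "general_sing \<gamma> l y = norm y powr \<gamma> * ray_deriv 0 1 y"
  by (simp add: general_sing_def ray_deriv_def radial_ext_def)

lemma ray_family_start: "ray_family 0 h 1 y = \<psi> (y /\<^sub>R \<Lambda>0) * shifted h y"
  by (simp add: ray_family_def shifted_def general_sing_eq line_deriv_0)

lemma ray_family_zero [simp]: "ray_family j h t 0 = 0"
  by (simp add: ray_family_def)

lemma ray_family_support: "bounded_support (ray_family j h t)"
  unfolding bounded_support_def by (rule exI[of _ "L' / 4"]) (simp add: ray_family_def cutoff_far)

lemma ray_family_has_real_derivative:
  assumes "0 \<le> t" "t \<le> 1" "y \<noteq> 0"
  shows "((\<lambda>t. ray_family j h t y) has_real_derivative real (Suc j) * ray_family (Suc j) h t y) (at t)"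
proof (cases "norm y > L' / 4")
  case True
  then show ?thesis by (simp add: ray_family_def cutoff_far)
next
  case False
  have "t * norm y \<le> 1 * norm y" using assms by (intro mult_right_mono) auto
  also have "\<dots> < L'" using False L by simp
  finally have "(t * norm y, y) \<in> \<Omega>" using assms L by (auto simp: \<Omega>_def intro: less_le_trans[of _ 0])
  from DERIV_cmult[OF leibniz_normalised[where A="\<lambda>k t. ray_deriv k t y" and B="\<lambda>k t. line_deriv v (h *\<^sub>R \<alpha>) k t y",
        OF ray_deriv_has_real_derivative[OF this] line_deriv_has_real_derivative[OF v_smooth]], of "norm y powr \<gamma> * \<psi> (y /\<^sub>R \<Lambda>0)" j]
  show ?thesis by (simp only: ray_family_def mult_ac)
qed

text \<open>
  Every derivative in \<open>t\<close> brings a factor of size \<open>|y|\<close>, hence the degree \<open>\<gamma> + j\<close>. The estimate is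
  proved on two overlapping open sets: a ball on which all factors are symbols, and the outside of the
  support of the cutoff, where the family vanishes.
\<close>

lemma symbol_on_ray_family:
  "symbol_on m (\<gamma> + real j) ((UNIV \<times> {0..1}) \<times> -{0}) (\<lambda>(h, t). ray_family j h t)"
proof -
  let ?J = "UNIV \<times> {0..1} :: (real \<times> real) set"
  let ?D1 = "?J \<times> (ball 0 (L' / 2) \<inter> -{0 :: real ^ 'n})"
  let ?D2 = "?J \<times> (- cball (0 :: real ^ 'n) (L' / 4))"
  let ?F = "\<lambda>(h, t). ray_family j h t"
  have o1: "open_slices ?D1" by (intro open_slices_Times open_Int) auto
  have o2: "open_slices ?D2" by (intro open_slices_Times) auto
  have "(?D1 \<union> ?D2) = ?J \<times> -{0}" using L by auto
  moreover have "symbol_on m (\<gamma> + real j) ?D2 ?F"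
    by (rule symbol_on_cong[OF o2 _ symbol_on_zero]) (auto simp: ray_family_def cutoff_far)
  moreover have "symbol_on m (\<gamma> + real j) ?D1 ?F"
  proof (rule symbol_on_cong[OF o1])
    have D: "y \<noteq> 0 \<and> \<bar>snd i * norm y\<bar> \<le> L' / 2" if "(i, y) \<in> ?D1" for i y
    proof -
      have "snd i * norm y \<le> 1 * (L' / 2)" using that L by (intro mult_mono) auto
      then show ?thesis using that by (auto simp: abs_mult)
    qed
    show "symbol_on m (\<gamma> + real j) ?D1 (\<lambda>i y. \<Sum>k\<le>j. (norm y powr \<gamma> * ray_deriv k (snd i) y)
        * line_deriv v (fst i *\<^sub>R \<alpha>) (j - k) (snd i) y * \<psi> (y /\<^sub>R \<Lambda>0))"
    proof (rule symbol_on_sum)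
      fix k assume "k \<in> {..j}"
      then have deg: "\<gamma> + real j = (\<gamma> + real k) + real (j - k) + 0" by (simp add: of_nat_diff)
      have cut: "symbol_on m 0 ?D1 (\<lambda>i y. \<psi> (y /\<^sub>R \<Lambda>0))"
        using symbol_on_dilated_cutoff[OF smooth far, where D="?D1" and s="\<lambda>_. \<Lambda>0" and m=m and e=0] \<Lambda>0_pos by simp
      have ray: "symbol_on m (\<gamma> + real k) ?D1 (\<lambda>i y. norm y powr \<gamma> * ray_deriv k (snd i) y)"
        by (rule symbol_on_ray_deriv[OF _ D o1]) (use L in auto)
      have line: "symbol_on m (real (j - k)) ?D1 (\<lambda>i y. line_deriv v (fst i *\<^sub>R \<alpha>) (j - k) (snd i) y)"
        by (rule symbol_on_line_deriv[OF v_smooth v_supp D o1])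
      show "symbol_on m (\<gamma> + real j) ?D1 (\<lambda>i y. (norm y powr \<gamma> * ray_deriv k (snd i) y)
        * line_deriv v (fst i *\<^sub>R \<alpha>) (j - k) (snd i) y * \<psi> (y /\<^sub>R \<Lambda>0))"
        unfolding deg by (rule symbol_on_mult[OF symbol_on_mult[OF ray line] cut])
    qed
  qed (auto simp: ray_family_def sum_distrib_left mult_ac)
  ultimately show ?thesis using symbol_on_Un[OF _ _ o1 o2] by metis
qed

definition taylor_remainder :: "nat \<Rightarrow> real \<Rightarrow> real ^ 'n \<Rightarrow> real" where
  "taylor_remainder p h y = ray_family 0 h 1 y - (\<Sum>j\<le>p. ray_family j h 0 y)"

lemma ray_family_continuous:
  assumes "0 \<le> t" "t \<le> 1" shows "continuous_on (-{0}) (ray_family j h t)"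
  using symbol_on_continuous[OF symbol_on_ray_family, of "(h, t)" j] assms by simp

lemma ray_family_integrable:
  assumes "0 \<le> t" "t \<le> 1" shows "integrable lborel (ray_family j h t)"
proof -
  have "\<gamma> + real j > - real CARD('n)" using \<gamma> by linarith
  from symbol_integrable[OF this symbol_on_ray_family, of "(h, t)"] show ?thesis
    using assms ray_family_support by simp
qed

lemma bounded_support_diff_sum:
  assumes "bounded_support F" "finite J" "\<And>j. j \<in> J \<Longrightarrow> bounded_support (G j)"
  shows "bounded_support (\<lambda>y. F y - (\<Sum>j\<in>J. G j y))"
proof -
  obtain R where R: "\<And>j x. j \<in> J \<Longrightarrow> norm x > R \<Longrightarrow> G j x = 0"
    using bounded_support_uniform[OF assms(2), of G] assms(3) by blast
  obtain R' where R': "\<And>x. norm x > R' \<Longrightarrow> F x = 0" using assms(1) by (auto simp: bounded_support_def)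
  have "F x - (\<Sum>j\<in>J. G j x) = 0" if "norm x > max R R'" for x using R R' that by simp
  then show ?thesis unfolding bounded_support_def by blast
qed

lemma taylor_remainder_support: "bounded_support (taylor_remainder p h)"
  unfolding taylor_remainder_def[abs_def] by (intro bounded_support_diff_sum ray_family_support) auto

lemma taylor_remainder_integrable: "integrable lborel (taylor_remainder p h)"
  unfolding taylor_remainder_def[abs_def]
  by (intro Bochner_Integration.integrable_diff Bochner_Integration.integrable_sum ray_family_integrable) auto

lemma quad_error_taylor_remainder:
  "(\<lambda>h. quad_error h \<alpha> (taylor_remainder p h)) \<in> O[at_right 0](\<lambda>h. h powr (\<gamma> + real CARD('n) + real p + 1))"
proof -
  let ?d = "\<gamma> + real (Suc p)"
  have d: "?d > - real CARD('n)" using \<gamma> by linarith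
  obtain m :: nat where m: "real m > ?d + real CARD('n)" using reals_Archimedean2 by blast
  have bounds: "\<exists>C\<ge>0. \<forall>h\<in>UNIV. diff_bound k ?d C (taylor_remainder p h)" for k
  proof -
    obtain C where C: "C \<ge> 0" "\<And>h. h \<in> UNIV \<Longrightarrow> diff_bound k ?d C (\<lambda>y. ray_family 0 h 1 y - (\<Sum>j\<le>p. ray_family j h 0 y))"
    proof (rule taylor_remainder_diff_bound[where K=ray_family and p=p and I="UNIV :: real set" and m=k and d="?d"])
      show "symbol_on k ?d ((UNIV \<times> {0..1}) \<times> - {0}) (\<lambda>(h, t). ray_family (Suc p) h t)"
        by (rule symbol_on_ray_family)
    qed (auto intro: ray_family_has_real_derivative simp del: of_nat_Suc)
    then show ?thesis unfolding taylor_remainder_def[abs_def] by blast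
  qed
  obtain K where K: "K \<ge> 0" "\<And>i h. i \<in> UNIV \<Longrightarrow> h > 0 \<Longrightarrow> \<bar>quad_error h \<alpha> (taylor_remainder p i)\<bar> \<le> K * h powr (?d + real CARD('n))"
  proof (rule quad_error_bound[OF d m, where I="UNIV :: real set" and F="taylor_remainder p" and \<alpha>=\<alpha>])
    show "continuous_on (- {0}) (taylor_remainder p h)" for h
      unfolding taylor_remainder_def[abs_def] by (intro continuous_intros ray_family_continuous) auto
  qed (use bounds in \<open>auto simp: taylor_remainder_support taylor_remainder_def\<close>)
  show ?thesis
    by (rule bigo_at_right_0I[of 1 _ K]) (use K in \<open>auto simp: algebra_simps\<close>)
qed

text \<open>
  The part of the integrand away from the singularity. It is supported in \<open>|y| \<ge> 3\<Lambda>0/4\<close> and so is a symbol of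
  every degree above \<open>\<gamma>\<close>.
\<close>

definition outer_part :: "real \<Rightarrow> real ^ 'n \<Rightarrow> real" where
  "outer_part h y = (1 - \<psi> (y /\<^sub>R \<Lambda>0)) * shifted h y"

text \<open>
  For \<open>h < h1\<close> the shift by \<open>h\<alpha>\<close> is less than a third of the gap between the support of \<open>v\<close> and the radius \<open>L'\<close>
  up to which \<open>l\<close> is defined.
\<close>

definition h1 :: real where "h1 = (L' - L) / (3 * (norm \<alpha> + 1))"

lemma h1_pos: "h1 > 0"
  using L norm_ge_zero[of \<alpha>] unfolding h1_def by (intro divide_pos_pos mult_pos_pos) linarith+

lemma shifted_vanish:
  assumes "0 < h" "h < h1" "norm y > (2 * L + L') / 3" shows "shifted h y = 0"
proof -
  have "h * norm \<alpha> \<le> h * (norm \<alpha> + 1)" using assms by simp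
  also have "\<dots> < h1 * (norm \<alpha> + 1)" using assms norm_ge_zero[of \<alpha>] by (intro mult_strict_right_mono) linarith+
  also have "\<dots> = (L' - L) / 3"
  proof -
    have "norm \<alpha> + 1 \<noteq> 0" using norm_ge_zero[of \<alpha>] by linarith
    then show ?thesis by (simp add: h1_def field_simps)
  qed
  finally have "norm (h *\<^sub>R \<alpha>) < (L' - L) / 3" using assms by simp
  then have "norm (y + h *\<^sub>R \<alpha>) > L" using norm_diff_ineq[of y "h *\<^sub>R \<alpha>"] assms(3) by (simp add: field_simps)
  then show ?thesis by (simp add: shifted_def v_supp)
qed

lemma shifted_support: "0 < h \<Longrightarrow> h < h1 \<Longrightarrow> bounded_support (shifted h)"
  unfolding bounded_support_def using shifted_vanish by blast

lemma symbol_on_shifted: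
  "symbol_on m \<gamma> ({0<..<h1} \<times> -{0}) shifted"
proof -
  let ?J = "{0<..<h1}"
  \<comment> \<open>The two radii divide the gap between \<open>L\<close> and \<open>L'\<close> into thirds.\<close>
  let ?D1 = "?J \<times> (ball 0 ((L + 2 * L') / 3) \<inter> -{0 :: real ^ 'n})"
  let ?D2 = "?J \<times> (- cball (0 :: real ^ 'n) ((2 * L + L') / 3))"
  have o1: "open_slices ?D1" by (intro open_slices_Times open_Int) auto
  have o2: "open_slices ?D2" by (intro open_slices_Times) auto
  have "(?D1 \<union> ?D2) = ?J \<times> -{0}" using L by auto
  moreover have "symbol_on m \<gamma> ?D2 shifted"
    by (rule symbol_on_cong[OF o2 _ symbol_on_zero]) (auto simp: shifted_vanish)
  moreover have "symbol_on m \<gamma> ?D1 shifted"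
  proof (rule symbol_on_cong[OF o1])
    have D: "y \<noteq> 0 \<and> \<bar>1 * norm y\<bar> \<le> (L + 2 * L') / 3" if "(i, y) \<in> ?D1" for i y
      using that by auto
    have "symbol_on m (\<gamma> + real 0) ?D1 (\<lambda>i y. norm y powr \<gamma> * ray_deriv 0 1 y)"
      by (rule symbol_on_ray_deriv[OF _ D o1]) (use L in auto)
    moreover have "symbol_on m (real 0) ?D1 (\<lambda>i y. line_deriv v (i *\<^sub>R \<alpha>) 0 1 y)"
      by (rule symbol_on_line_deriv[OF v_smooth v_supp D o1])
    ultimately show "symbol_on m \<gamma> ?D1 (\<lambda>i y. norm y powr \<gamma> * ray_deriv 0 1 y * line_deriv v (i *\<^sub>R \<alpha>) 0 1 y)"
      using symbol_on_mult by fastforce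
  qed (simp add: shifted_def general_sing_eq line_deriv_0)
  ultimately show ?thesis using symbol_on_Un[OF _ _ o1 o2] by metis
qed

lemma outer_part_zero [simp]: "outer_part h 0 = 0"
  by (simp add: outer_part_def shifted_def general_sing_def)

lemma outer_part_support: "0 < h \<Longrightarrow> h < h1 \<Longrightarrow> bounded_support (outer_part h)"
  using shifted_support[of h] unfolding bounded_support_def outer_part_def by fastforce

lemma symbol_on_outer_part:
  assumes "M \<ge> 0"
  shows "symbol_on m (\<gamma> + M) ({0<..<h1} \<times> -{0}) (\<lambda>h y. (3 / 4 * \<Lambda>0) powr M * outer_part h y)"
proof (rule symbol_on_vanish_gain)
  let ?D = "{0<..<h1} \<times> -{0 :: real ^ 'n}"
  show D: "open_slices ?D" by (intro open_slices_Times) auto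
  have "symbol_on m 0 ?D (\<lambda>i y. \<psi> (y /\<^sub>R \<Lambda>0))"
    using symbol_on_dilated_cutoff[OF smooth far, where D="?D" and s="\<lambda>_. \<Lambda>0" and m=m and e=0] \<Lambda>0_pos by simp
  from symbol_on_mult[OF symbol_on_shifted this]
  have "symbol_on m \<gamma> ?D (\<lambda>h y. shifted h y * \<psi> (y /\<^sub>R \<Lambda>0))" by simp
  from symbol_on_add[OF symbol_on_shifted symbol_on_uminus[OF this]]
  have "symbol_on m \<gamma> ?D (\<lambda>h y. shifted h y + - (shifted h y * \<psi> (y /\<^sub>R \<Lambda>0)))" by simp
  then show "symbol_on m \<gamma> ?D outer_part"
    by (rule symbol_on_cong[OF D, rotated]) (simp add: outer_part_def algebra_simps)
  fix h and y :: "real ^ 'n" assume "norm y < 3 / 4 * \<Lambda>0"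
  then have "norm (y /\<^sub>R \<Lambda>0) < 3 / 4" using \<Lambda>0_pos by (simp add: field_simps)
  then show "outer_part h y = 0" by (simp add: outer_part_def near)
qed (use \<Lambda>0_pos assms in auto)

lemma outer_part_integrable:
  assumes "0 < h" "h < h1" shows "integrable lborel (outer_part h)"
proof -
  have "symbol_on (Suc 0) \<gamma> ({0<..<h1} \<times> -{0}) (\<lambda>h y. (3 / 4 * \<Lambda>0) powr 0 * outer_part h y)"
    using symbol_on_outer_part[of 0 "Suc 0"] by simp
  from symbol_integrable[OF \<gamma> this, of h] show ?thesis using assms outer_part_support[OF assms] \<Lambda>0_pos by simp
qed

lemma quad_error_outer_part:
  "(\<lambda>h. quad_error h \<alpha> (outer_part h)) \<in> O[at_right 0](\<lambda>h. h powr (\<gamma> + real CARD('n) + real p + 1))"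
proof -
  let ?c = "(3 / 4 * \<Lambda>0) powr (real p + 1)"
  have c: "?c > 0" using \<Lambda>0_pos by simp
  have d: "\<gamma> + (real p + 1) > - real CARD('n)" using \<gamma> by linarith
  have supp: "bounded_support (\<lambda>y. ?c * outer_part h y)" if "h \<in> {0<..<h1}" for h
    using outer_part_support[of h] that unfolding bounded_support_def by fastforce
  obtain K where K: "K \<ge> 0" "\<And>i h. i \<in> {0<..<h1} \<Longrightarrow> h > 0 \<Longrightarrow>
      \<bar>quad_error h \<alpha> (\<lambda>y. ?c * outer_part i y)\<bar> \<le> K * h powr (\<gamma> + (real p + 1) + real CARD('n))"
    using quad_error_symbol_bound[OF d symbol_on_outer_part _ supp, of \<alpha>] by auto
  have "\<bar>quad_error h \<alpha> (outer_part h)\<bar> \<le> K / ?c * h powr (\<gamma> + real CARD('n) + real p + 1)" if h: "0 < h" "h < h1" for h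
  proof -
    have "?c * \<bar>quad_error h \<alpha> (outer_part h)\<bar> \<le> K * h powr (\<gamma> + (real p + 1) + real CARD('n))"
      using K(2)[of h h] h quad_error_cmult[OF h(1) outer_part_support[OF h] outer_part_integrable[OF h], of \<alpha> ?c] c
      by (simp add: abs_mult)
    then show ?thesis using c by (simp add: field_simps)
  qed
  then show ?thesis by (rule bigo_at_right_0I[OF h1_pos])
qed

text \<open>
  The homogeneous functions that occur in the Taylor polynomial; their scaled errors define the weights.
\<close>

definition model_sing :: "nat \<Rightarrow> nat ^ 'n \<Rightarrow> real ^ 'n \<Rightarrow> real" where
  "model_sing k \<beta> y = homogeneous_sing (\<gamma> + real k) (radial_coeff l k) y * mi_power y \<beta>"

lemma homogeneous_cutoff_model_sing:
  "homogeneous_cutoff \<psi> (model_sing k \<beta>) (\<gamma> + real k + real (mi_order \<beta>))"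
proof
  show "Cinf_on (- {0}) (model_sing k \<beta>)"
    unfolding model_sing_def by (rule homogeneous_sing_smooth) (use L in linarith)
  show "model_sing k \<beta> (c *\<^sub>R y) = c powr (\<gamma> + real k + real (mi_order \<beta>)) * model_sing k \<beta> y" if "c > 0" for c y
  proof -
    have "inverse (norm (c *\<^sub>R y)) * c = inverse (norm y)"
      using that by (cases "norm y = 0") (simp_all add: field_simps)
    then have "(c *\<^sub>R y) /\<^sub>R norm (c *\<^sub>R y) = y /\<^sub>R norm y" by (simp only: scaleR_scaleR)
    then have e: "radial_coeff l k ((c *\<^sub>R y) /\<^sub>R norm (c *\<^sub>R y)) = radial_coeff l k (y /\<^sub>R norm y)" by (simp only:)
    show ?thesis
      unfolding model_sing_def homogeneous_sing_def mi_power_scale e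
      using that by (simp add: powr_mult powr_add powr_realpow)
  qed
  show "\<gamma> + real k + real (mi_order \<beta>) > - real CARD('n)" using \<gamma> by linarith
qed (simp add: model_sing_def homogeneous_sing_def)

definition term_index :: "nat \<Rightarrow> (nat \<times> 'n list) set" where
  "term_index p = Sigma {..p} (\<lambda>k. {xs. length xs \<le> p - k})"

lemma finite_lists_le: "finite {xs :: 'n list. length xs \<le> q}"
  using finite_lists_length_le[of "UNIV :: 'n set" q] by simp

lemma finite_term_index: "finite (term_index p)"
  unfolding term_index_def by (intro finite_SigmaI finite_lists_le) simp

lemma taylor_polynomial:
  "(\<Sum>j\<le>p. ray_family j h 0 y)
    = (\<Sum>(k, xs)\<in>term_index p. taylor_coeff v xs (h *\<^sub>R \<alpha>) * (model_sing k (mi_of xs) y * \<psi> (y /\<^sub>R \<Lambda>0)))"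
proof -
  let ?f = "\<lambda>(k, xs). taylor_coeff v xs (h *\<^sub>R \<alpha>) * (model_sing k (mi_of xs) y * \<psi> (y /\<^sub>R \<Lambda>0))"
  have "ray_family j h 0 y = (\<Sum>q | q \<in> term_index p \<and> fst q + length (snd q) = j. ?f q)" if j: "j \<in> {..p}" for j
  proof -
    have "{q. q \<in> term_index p \<and> fst q + length (snd q) = j} = Sigma {..j} (\<lambda>k. {xs. length xs = j - k})"
      using j by (auto simp: term_index_def)
    then have "(\<Sum>q | q \<in> term_index p \<and> fst q + length (snd q) = j. ?f q)
        = (\<Sum>k\<le>j. \<Sum>xs | length xs = j - k. taylor_coeff v xs (h *\<^sub>R \<alpha>) * (model_sing k (mi_of xs) y * \<psi> (y /\<^sub>R \<Lambda>0)))"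
      by (simp add: sum.Sigma finite_lists_length)
    also have "\<dots> = (\<Sum>k\<le>j. \<psi> (y /\<^sub>R \<Lambda>0) * (norm y powr \<gamma> * ray_deriv k 0 y) * line_deriv v (h *\<^sub>R \<alpha>) (j - k) 0 y)"
      unfolding ray_deriv_0 line_deriv_def sum_distrib_left
      by (intro sum.cong refl) (simp add: model_sing_def mult_ac)
    also have "\<dots> = ray_family j h 0 y"
      unfolding ray_family_def sum_distrib_left by (intro sum.cong refl) (simp add: mult_ac)
    finally show ?thesis by simp
  qed
  then have "(\<Sum>j\<le>p. ray_family j h 0 y) = (\<Sum>j\<le>p. \<Sum>q | q \<in> term_index p \<and> fst q + length (snd q) = j. ?f q)"
    by (rule sum.cong[OF refl])
  also have "\<dots> = (\<Sum>q\<in>term_index p. ?f q)"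
    by (rule sum.group[OF finite_term_index]) (auto simp: term_index_def)
  finally show ?thesis .
qed

lemma quad_error_shifted:
  assumes h: "0 < h" "h < h1"
  shows "quad_error h \<alpha> (shifted h)
    = (\<Sum>(k, xs)\<in>term_index p. taylor_coeff v xs (h *\<^sub>R \<alpha>) * quad_error h \<alpha> (\<lambda>y. model_sing k (mi_of xs) y * \<psi> (y /\<^sub>R \<Lambda>0)))
      + quad_error h \<alpha> (taylor_remainder p h) + quad_error h \<alpha> (outer_part h)"
proof -
  let ?G = "\<lambda>q y. model_sing (fst q) (mi_of (snd q)) y * \<psi> (y /\<^sub>R \<Lambda>0)"
  let ?P = "\<lambda>y. \<Sum>q\<in>term_index p. taylor_coeff v (snd q) (h *\<^sub>R \<alpha>) * ?G q y"
  have Gs: "bounded_support (?G q)" "integrable lborel (?G q)" for q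
    using homogeneous_cutoff.bounded_support_cutoff[OF homogeneous_cutoff_model_sing \<Lambda>0_pos]
      homogeneous_cutoff.integrable_cutoff[OF homogeneous_cutoff_model_sing \<Lambda>0_pos] by auto
  have P: "?P = (\<lambda>y. ray_family 0 h 1 y - taylor_remainder p h y)"
    by (simp add: taylor_remainder_def taylor_polynomial case_prod_unfold)
  have Pi: "integrable lborel ?P" "bounded_support ?P"
    using Gs(2) bounded_support_diff_sum[OF ray_family_support, of "{()}" "\<lambda>_. taylor_remainder p h" 0 h 1] taylor_remainder_support
    by (auto simp: P[symmetric])
  have e: "shifted h = (\<lambda>y. (?P y + 1 * taylor_remainder p h y) + 1 * outer_part h y)"
  proof
    fix y
    have "?P y = ray_family 0 h 1 y - taylor_remainder p h y" using fun_cong[OF P, of y] .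
    then show "shifted h y = (?P y + 1 * taylor_remainder p h y) + 1 * outer_part h y"
      by (simp only: ray_family_start outer_part_def) (simp add: algebra_simps)
  qed
  have PR: "(\<lambda>y. ?P y + 1 * taylor_remainder p h y) = ray_family 0 h 1"
  proof
    fix y
    have "?P y = ray_family 0 h 1 y - taylor_remainder p h y" using fun_cong[OF P, of y] .
    then show "?P y + 1 * taylor_remainder p h y = ray_family 0 h 1 y" by linarith
  qed
  have "integrable lborel (\<lambda>y. ?P y + 1 * taylor_remainder p h y)"
    by (intro Bochner_Integration.integrable_add Pi) (simp add: taylor_remainder_integrable)
  moreover have "bounded_support (\<lambda>y. ?P y + 1 * taylor_remainder p h y)"
    unfolding PR by (rule ray_family_support)
  ultimately have "quad_error h \<alpha> (shifted h) = quad_error h \<alpha> (\<lambda>y. ?P y + 1 * taylor_remainder p h y) + 1 * quad_error h \<alpha> (outer_part h)"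
    unfolding e by (intro quad_error_lincomb2 h outer_part_support outer_part_integrable)
  also have "quad_error h \<alpha> (\<lambda>y. ?P y + 1 * taylor_remainder p h y) = quad_error h \<alpha> ?P + 1 * quad_error h \<alpha> (taylor_remainder p h)"
    by (intro quad_error_lincomb2 h Pi taylor_remainder_support taylor_remainder_integrable)
  also have "quad_error h \<alpha> ?P = (\<Sum>q\<in>term_index p. taylor_coeff v (snd q) (h *\<^sub>R \<alpha>) * quad_error h \<alpha> (?G q))"
    by (intro quad_error_sum h finite_term_index Gs)
  finally show ?thesis by (simp add: case_prod_unfold)
qed

end

section \<open>The error of the composite rule\<close>

lemma bigo_bounded_mult:
  fixes f g :: "real \<Rightarrow> real"
  assumes "\<And>h. \<bar>f h\<bar> \<le> T" "g \<in> O[F](b)"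
  shows "(\<lambda>h. f h * g h) \<in> O[F](b)"
proof -
  have "f \<in> O[F](\<lambda>_. 1)" by (rule bigoI[of _ T]) (use assms(1) in auto)
  from landau_o.big.mult[OF this assms(2)] show ?thesis by simp
qed

context composite_setting
begin

lemma taylor_coeff_bounded: "\<exists>T. \<forall>x. \<bar>taylor_coeff v xs x\<bar> \<le> T"
proof -
  have "taylor_coeff v xs x = 0" if "norm x > L" for x
    by (rule taylor_coeff_vanish[OF v_supp that])
  then show ?thesis
    using compact_support_bounded[OF taylor_coeff_smooth[OF v_smooth], of L xs] by metis
qed

text \<open>
  The limit of the scaled errors \<open>R\<^sub>\<beta>(h)\<close> for \<open>\<phi>\<^sub>k\<close>; by \<open>moment_limit_rate\<close> it is independent of the cutoff
  radius and approached faster than any power of \<open>h\<close>.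
\<close>

definition moment_limit :: "nat \<Rightarrow> nat ^ 'n \<Rightarrow> real" where
  "moment_limit k \<beta> = (SOME E. \<forall>M\<ge>0. \<exists>K\<ge>0. \<forall>s>0. \<bar>dilation_error \<alpha> \<psi> (model_sing k \<beta>) s - E\<bar> \<le> K * s powr (- M))"

lemma moment_limit_rate:
  assumes "M \<ge> 0"
  obtains K where "K \<ge> 0" "\<And>s. s > 0 \<Longrightarrow> \<bar>dilation_error \<alpha> \<psi> (model_sing k \<beta>) s - moment_limit k \<beta>\<bar> \<le> K * s powr (- M)"
proof -
  have "\<exists>E. \<forall>M\<ge>0. \<exists>K\<ge>0. \<forall>s>0. \<bar>dilation_error \<alpha> \<psi> (model_sing k \<beta>) s - E\<bar> \<le> K * s powr (- M)"
    using homogeneous_cutoff.dilation_error_limit[OF homogeneous_cutoff_model_sing, of \<alpha> k \<beta>] by metis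
  from someI_ex[OF this] have "\<exists>K\<ge>0. \<forall>s>0. \<bar>dilation_error \<alpha> \<psi> (model_sing k \<beta>) s - moment_limit k \<beta>\<bar> \<le> K * s powr (- M)"
    using assms unfolding moment_limit_def by blast
  with that show thesis by blast
qed

lemma scaled_error_tendsto:
  assumes \<Lambda>: "\<Lambda> > 0"
  shows "((\<lambda>h. scaled_error \<psi> \<Lambda> \<alpha> (\<gamma> + real k) (radial_coeff l k) \<beta> h) \<longlongrightarrow> moment_limit k \<beta>) (at_right 0)"
proof -
  have eq: "scaled_error \<psi> \<Lambda> \<alpha> (\<gamma> + real k) (radial_coeff l k) \<beta> h = dilation_error \<alpha> \<psi> (model_sing k \<beta>) (\<Lambda> / h)"
    if h: "h > 0" for h
  proof -
    have "quad_error h \<alpha> (\<lambda>y. model_sing k \<beta> y * \<psi> (y /\<^sub>R \<Lambda>))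
        = h powr (\<gamma> + real k + real (mi_order \<beta>) + real CARD('n)) * dilation_error \<alpha> \<psi> (model_sing k \<beta>) (\<Lambda> / h)"
      by (rule homogeneous_cutoff.quad_error_cutoff[OF homogeneous_cutoff_model_sing h \<Lambda>])
    moreover have "\<gamma> + real k + real (mi_order \<beta>) + real CARD('n) = \<gamma> + real k + real CARD('n) + real (mi_order \<beta>)" by simp
    ultimately show ?thesis using h unfolding scaled_error_eq model_sing_def by simp
  qed
  obtain K where K: "K \<ge> 0" "\<And>s. s > 0 \<Longrightarrow> \<bar>dilation_error \<alpha> \<psi> (model_sing k \<beta>) s - moment_limit k \<beta>\<bar> \<le> K * s powr (- 1)"
    using moment_limit_rate[of 1 k \<beta>] by auto
  have "((\<lambda>h. scaled_error \<psi> \<Lambda> \<alpha> (\<gamma> + real k) (radial_coeff l k) \<beta> h - moment_limit k \<beta>) \<longlongrightarrow> 0) (at_right 0)"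
  proof (rule Lim_null_comparison)
    have "norm (scaled_error \<psi> \<Lambda> \<alpha> (\<gamma> + real k) (radial_coeff l k) \<beta> h - moment_limit k \<beta>) \<le> K / \<Lambda> * h" if "h > 0" for h
      using K(2)[of "\<Lambda> / h"] that \<Lambda> by (simp add: eq powr_minus_divide)
    then show "\<forall>\<^sub>F h in at_right 0. norm (scaled_error \<psi> \<Lambda> \<alpha> (\<gamma> + real k) (radial_coeff l k) \<beta> h - moment_limit k \<beta>) \<le> K / \<Lambda> * h"
      by (auto simp: eventually_at_right_field intro: exI[of _ 1])
    have "((\<lambda>h. K / \<Lambda> * h) \<longlongrightarrow> K / \<Lambda> * 0) (at_right 0)" by (intro tendsto_intros)
    then show "((\<lambda>h. K / \<Lambda> * h) \<longlongrightarrow> 0) (at_right 0)" by simp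
  qed
  then show ?thesis by (rule LIM_zero_cancel)
qed

text \<open>
  The term has order \<open>h\<^bsup>\<gamma>+k+n+|xs|\<^esup>\<close>; the missing \<open>p + 1 - k - |xs|\<close> powers of \<open>h\<close> come from the
  fast convergence to \<open>moment_limit\<close>.
\<close>

lemma expansion_term_error:
  assumes "k + length xs \<le> p"
  shows "(\<lambda>h. taylor_coeff v xs (h *\<^sub>R \<alpha>) * (quad_error h \<alpha> (\<lambda>y. model_sing k (mi_of xs) y * \<psi> (y /\<^sub>R \<Lambda>0))
        - h powr (\<gamma> + real k + real CARD('n)) * h ^ length xs * moment_limit k (mi_of xs)))
      \<in> O[at_right 0](\<lambda>h. h powr (\<gamma> + real CARD('n) + real p + 1))"
proof -
  \<comment> \<open>The number of powers of \<open>h\<close> still to be gained.\<close>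
  define M where "M = real p + 1 - real k - real (length xs)"
  have "M \<ge> 0" using assms unfolding M_def by linarith
  then obtain K where K: "K \<ge> 0" "\<And>s. s > 0 \<Longrightarrow> \<bar>dilation_error \<alpha> \<psi> (model_sing k (mi_of xs)) s - moment_limit k (mi_of xs)\<bar> \<le> K * s powr (- M)"
    using moment_limit_rate by metis
  let ?e = "\<gamma> + real k + real (length xs) + real CARD('n)"
  have "\<bar>quad_error h \<alpha> (\<lambda>y. model_sing k (mi_of xs) y * \<psi> (y /\<^sub>R \<Lambda>0))
        - h powr (\<gamma> + real k + real CARD('n)) * h ^ length xs * moment_limit k (mi_of xs)\<bar>
      \<le> K * \<Lambda>0 powr (- M) * h powr (\<gamma> + real CARD('n) + real p + 1)" if h: "h > 0" for h
  proof -
    have "quad_error h \<alpha> (\<lambda>y. model_sing k (mi_of xs) y * \<psi> (y /\<^sub>R \<Lambda>0))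
        = h powr ?e * dilation_error \<alpha> \<psi> (model_sing k (mi_of xs)) (\<Lambda>0 / h)"
      using homogeneous_cutoff.quad_error_cutoff[OF homogeneous_cutoff_model_sing[of k "mi_of xs"] h \<Lambda>0_pos, of \<alpha>]
      by (simp add: mi_order_mi_of)
    moreover have "h powr (\<gamma> + real k + real CARD('n)) * h ^ length xs = h powr ?e"
      using h by (simp add: powr_add powr_realpow)
    ultimately have "\<bar>quad_error h \<alpha> (\<lambda>y. model_sing k (mi_of xs) y * \<psi> (y /\<^sub>R \<Lambda>0))
        - h powr (\<gamma> + real k + real CARD('n)) * h ^ length xs * moment_limit k (mi_of xs)\<bar>
      = h powr ?e * \<bar>dilation_error \<alpha> \<psi> (model_sing k (mi_of xs)) (\<Lambda>0 / h) - moment_limit k (mi_of xs)\<bar>"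
      by (simp add: abs_mult flip: right_diff_distrib)
    also have "\<dots> \<le> h powr ?e * (K * (\<Lambda>0 / h) powr (- M))"
      using K(2)[of "\<Lambda>0 / h"] h \<Lambda>0_pos by (intro mult_left_mono) auto
    also have "\<dots> = K * \<Lambda>0 powr (- M) * (h powr ?e * h powr M)"
      using h \<Lambda>0_pos by (simp add: powr_divide powr_minus field_simps)
    also have "h powr ?e * h powr M = h powr (\<gamma> + real CARD('n) + real p + 1)"
      by (simp add: M_def algebra_simps flip: powr_add)
    finally show ?thesis .
  qed
  then have "(\<lambda>h. quad_error h \<alpha> (\<lambda>y. model_sing k (mi_of xs) y * \<psi> (y /\<^sub>R \<Lambda>0))
        - h powr (\<gamma> + real k + real CARD('n)) * h ^ length xs * moment_limit k (mi_of xs))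
      \<in> O[at_right 0](\<lambda>h. h powr (\<gamma> + real CARD('n) + real p + 1))"
    by (rule bigo_at_right_0I[of 1, rotated]) simp_all
  moreover obtain T where "\<And>x. \<bar>taylor_coeff v xs x\<bar> \<le> T" using taylor_coeff_bounded by blast
  ultimately show ?thesis by (intro bigo_bounded_mult) auto
qed

text \<open>
  Expand \<open>v (h c\<^sub>i)\<close> at \<open>h\<alpha>\<close> to order \<open>q = p - k\<close> and exchange the sums: only moments of the weights up to
  order \<open>q\<close> occur, and these are the limits of the scaled errors.
\<close>

lemma correction_sum_error:
  fixes c :: "nat \<Rightarrow> real ^ 'n" and \<nu> :: "nat \<Rightarrow> nat ^ 'n"
  assumes k: "k \<le> p" and q: "q = p - k" and \<Lambda>: "\<Lambda> > 0"
    and \<nu>: "bij_betw \<nu> {..<num_mi CARD('n) q} {\<beta>. mi_order \<beta> \<le> q}"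
    and inv: "invertible_mat (node_matrix \<alpha> c \<nu> q)"
  shows "(\<lambda>h. h powr (\<gamma> + real k + real CARD('n)) *
        ((\<Sum>i<num_mi CARD('n) q. weight \<psi> \<Lambda> \<alpha> c \<nu> q (\<gamma> + real k) (radial_coeff l k) i * v (h *\<^sub>R c i))
         - (\<Sum>xs | length xs \<le> q. taylor_coeff v xs (h *\<^sub>R \<alpha>) * h ^ length xs * moment_limit k (mi_of xs))))
      \<in> O[at_right 0](\<lambda>h. h powr (\<gamma> + real CARD('n) + real p + 1))"
proof -
  let ?N = "num_mi CARD('n) q"
  let ?w = "weight \<psi> \<Lambda> \<alpha> c \<nu> q (\<gamma> + real k) (radial_coeff l k)"
  let ?T = "\<lambda>h i. \<Sum>j\<le>q. h ^ j * line_deriv v (h *\<^sub>R \<alpha>) j 0 (c i - \<alpha>)"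
  have moments: "(\<Sum>i<?N. ?w i * mi_power (c i - \<alpha>) (mi_of xs)) = moment_limit k (mi_of xs)" if "length xs \<le> q" for xs
  proof -
    have "mi_of xs \<in> {\<beta>. mi_order \<beta> \<le> q}" using that by (simp add: mi_order_mi_of)
    then obtain j where "j < ?N" "\<nu> j = mi_of xs" using \<nu> unfolding bij_betw_def by (metis imageE lessThan_iff)
    with weight_moments[OF inv scaled_error_tendsto[OF \<Lambda>] this(1), of k] show ?thesis by simp
  qed
  have poly: "(\<Sum>i<?N. ?w i * ?T h i) = (\<Sum>xs | length xs \<le> q. taylor_coeff v xs (h *\<^sub>R \<alpha>) * h ^ length xs * moment_limit k (mi_of xs))" for h
  proof -
    have T: "?T h i = (\<Sum>xs | length xs \<le> q. taylor_coeff v xs (h *\<^sub>R \<alpha>) * h ^ length xs * mi_power (c i - \<alpha>) (mi_of xs))" for i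
    proof -
      have "?T h i = (\<Sum>j\<le>q. \<Sum>xs | xs \<in> {xs. length xs \<le> q} \<and> length xs = j.
          taylor_coeff v xs (h *\<^sub>R \<alpha>) * h ^ length xs * mi_power (c i - \<alpha>) (mi_of xs))"
        unfolding line_deriv_def sum_distrib_left by (intro sum.cong refl) (auto simp: mult_ac)
      also have "\<dots> = (\<Sum>xs | length xs \<le> q. taylor_coeff v xs (h *\<^sub>R \<alpha>) * h ^ length xs * mi_power (c i - \<alpha>) (mi_of xs))"
        by (rule sum.group[OF finite_lists_le]) auto
      finally show ?thesis .
    qed
    have "(\<Sum>i<?N. ?w i * ?T h i) = (\<Sum>xs | length xs \<le> q. \<Sum>i<?N. ?w i * (taylor_coeff v xs (h *\<^sub>R \<alpha>) * h ^ length xs * mi_power (c i - \<alpha>) (mi_of xs)))"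
      unfolding T sum_distrib_left by (rule sum.swap)
    also have "\<dots> = (\<Sum>xs | length xs \<le> q. taylor_coeff v xs (h *\<^sub>R \<alpha>) * h ^ length xs * (\<Sum>i<?N. ?w i * mi_power (c i - \<alpha>) (mi_of xs)))"
      unfolding sum_distrib_left by (intro sum.cong refl) (simp add: mult_ac)
    also have "\<dots> = (\<Sum>xs | length xs \<le> q. taylor_coeff v xs (h *\<^sub>R \<alpha>) * h ^ length xs * moment_limit k (mi_of xs))"
      by (intro sum.cong refl) (simp add: moments)
    finally show ?thesis .
  qed
  have "\<exists>C. \<forall>h>0. \<bar>v (h *\<^sub>R c i) - ?T h i\<bar> \<le> C * h ^ Suc q" for i
    using node_taylor[OF v_smooth v_supp, where c="c i" and q=q and \<alpha>=\<alpha>] by metis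
  then obtain C where C: "\<And>i h. h > 0 \<Longrightarrow> \<bar>v (h *\<^sub>R c i) - ?T h i\<bar> \<le> C i * h ^ Suc q" by metis
  have "\<bar>h powr (\<gamma> + real k + real CARD('n)) * ((\<Sum>i<?N. ?w i * v (h *\<^sub>R c i))
         - (\<Sum>xs | length xs \<le> q. taylor_coeff v xs (h *\<^sub>R \<alpha>) * h ^ length xs * moment_limit k (mi_of xs)))\<bar>
      \<le> (\<Sum>i<?N. \<bar>?w i\<bar> * C i) * h powr (\<gamma> + real CARD('n) + real p + 1)" if h: "h > 0" for h
  proof -
    have "\<bar>(\<Sum>i<?N. ?w i * v (h *\<^sub>R c i)) - (\<Sum>i<?N. ?w i * ?T h i)\<bar> = \<bar>\<Sum>i<?N. ?w i * (v (h *\<^sub>R c i) - ?T h i)\<bar>"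
      by (simp add: sum_subtractf right_diff_distrib)
    also have "\<dots> \<le> (\<Sum>i<?N. \<bar>?w i\<bar> * (C i * h ^ Suc q))"
      by (intro order.trans[OF sum_abs] sum_mono) (simp only: abs_mult C[OF h] mult_left_mono abs_ge_zero)
    also have "\<dots> = (\<Sum>i<?N. \<bar>?w i\<bar> * C i) * h ^ Suc q" by (simp only: sum_distrib_right mult.assoc)
    finally have "h powr (\<gamma> + real k + real CARD('n)) * \<bar>(\<Sum>i<?N. ?w i * v (h *\<^sub>R c i)) - (\<Sum>i<?N. ?w i * ?T h i)\<bar>
        \<le> h powr (\<gamma> + real k + real CARD('n)) * ((\<Sum>i<?N. \<bar>?w i\<bar> * C i) * h ^ Suc q)"
      by (rule mult_left_mono) simp
    also have "\<dots> = (\<Sum>i<?N. \<bar>?w i\<bar> * C i) * (h powr (\<gamma> + real k + real CARD('n)) * h powr real (Suc q))"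
      using h by (simp add: powr_realpow del: of_nat_Suc power_Suc)
    also have "h powr (\<gamma> + real k + real CARD('n)) * h powr real (Suc q) = h powr (\<gamma> + real CARD('n) + real p + 1)"
      using k q by (simp add: of_nat_diff algebra_simps flip: powr_add)
    finally show ?thesis unfolding poly[symmetric] by (simp add: abs_mult)
  qed
  then show ?thesis by (rule bigo_at_right_0I[of 1, rotated]) simp_all
qed

text \<open>
  The punctured sums over the \<open>g\<^sub>k\<close> cancel.
\<close>

lemma composite_rule_eq:
  fixes c :: "nat \<Rightarrow> nat \<Rightarrow> real ^ 'n" and \<nu> :: "nat \<Rightarrow> nat \<Rightarrow> nat ^ 'n"
  assumes h: "0 < h"
  shows "composite_rule \<psi> \<Lambda> \<alpha> c \<nu> \<gamma> l v p h = punctured_trapezoidal h (sing_integrand \<gamma> l \<alpha> v h)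
    + (\<Sum>k\<le>p. h powr (\<gamma> + real k + real CARD('n)) *
        (\<Sum>i<num_mi CARD('n) (p - k). weight \<psi> (\<Lambda> (p - k)) \<alpha> (c (p - k)) (\<nu> (p - k)) (p - k) (\<gamma> + real k) (radial_coeff l k) i
           * v (h *\<^sub>R c (p - k) i)))"
proof -
  let ?g = "\<lambda>k x. homogeneous_sing (\<gamma> + real k) (radial_coeff l k) (x - h *\<^sub>R \<alpha>) * v x"
  let ?F = "\<lambda>j. case j of None \<Rightarrow> sing_integrand \<gamma> l \<alpha> v h | Some k \<Rightarrow> ?g k"
  let ?a = "\<lambda>j :: nat option. case j of None \<Rightarrow> 1 | Some k \<Rightarrow> (- 1 :: real)"
  have supp: "bounded_support (?F j)" for j
    unfolding bounded_support_def by (rule exI[of _ L]) (auto simp: sing_integrand_def v_supp split: option.splits)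
  have split: "sum G (insert None (Some ` {0..p})) = G None + (\<Sum>k=0..p. G (Some k))" for G :: "nat option \<Rightarrow> real"
    by (subst sum.insert) (auto simp: sum.reindex o_def)
  have "punctured_trapezoidal h (\<lambda>x. \<Sum>j\<in>insert None (Some ` {0..p}). ?a j * ?F j x)
      = (\<Sum>j\<in>insert None (Some ` {0..p}). ?a j * punctured_trapezoidal h (?F j))"
    by (rule punctured_trapezoidal_sum[OF h]) (auto intro: supp)
  then have "punctured_trapezoidal h (\<lambda>x. sing_integrand \<gamma> l \<alpha> v h x - (\<Sum>k=0..p. ?g k x))
      = punctured_trapezoidal h (sing_integrand \<gamma> l \<alpha> v h) - (\<Sum>k=0..p. punctured_trapezoidal h (?g k))"
    unfolding split by (simp add: sum_negf)
  then show ?thesis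
    by (simp add: composite_rule_def corrected_trapezoidal_def sum.distrib atLeast0AtMost)
qed

lemma full_integral_minus_trapezoidal:
  "full_integral (sing_integrand \<gamma> l \<alpha> v h) - punctured_trapezoidal h (sing_integrand \<gamma> l \<alpha> v h)
    = quad_error h \<alpha> (shifted h)"
proof -
  have "sing_integrand \<gamma> l \<alpha> v h = (\<lambda>x. shifted h (x - h *\<^sub>R \<alpha>))"
    by (simp add: fun_eq_iff sing_integrand_def shifted_def)
  then show ?thesis by (simp add: quad_error_def)
qed

text \<open>
  The expansion of the error on the integrand and that of the correction terms have the same
  coefficients \<open>taylor_coeff v xs (h\<alpha>)\<close> and the same limits \<open>moment_limit\<close>, so their difference is a finite sum of the
  remainders estimated above.
\<close>

lemma composite_rule_error:
  fixes c :: "nat \<Rightarrow> nat \<Rightarrow> real ^ 'n" and \<nu> :: "nat \<Rightarrow> nat \<Rightarrow> nat ^ 'n"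
  assumes \<Lambda>: "\<And>q. q \<le> p \<Longrightarrow> \<Lambda> q > 0"
    and \<nu>: "\<And>q. q \<le> p \<Longrightarrow> bij_betw (\<nu> q) {..<num_mi CARD('n) q} {\<beta>. mi_order \<beta> \<le> q}"
    and inv: "\<And>q. q \<le> p \<Longrightarrow> invertible_mat (node_matrix \<alpha> (c q) (\<nu> q) q)"
  shows "(\<lambda>h. full_integral (sing_integrand \<gamma> l \<alpha> v h) - composite_rule \<psi> \<Lambda> \<alpha> c \<nu> \<gamma> l v p h)
           \<in> O[at_right 0](\<lambda>h. h powr (\<gamma> + real CARD('n) + real p + 1))"
proof -
  let ?O = "O[at_right 0](\<lambda>h. h powr (\<gamma> + real CARD('n) + real p + 1))"
  define W where "W k h = (\<Sum>i<num_mi CARD('n) (p - k). weight \<psi> (\<Lambda> (p - k)) \<alpha> (c (p - k)) (\<nu> (p - k)) (p - k) (\<gamma> + real k) (radial_coeff l k) i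
           * v (h *\<^sub>R c (p - k) i))" for k h
  define S where "S k h = (\<Sum>xs | length xs \<le> p - k. taylor_coeff v xs (h *\<^sub>R \<alpha>) * h ^ length xs * moment_limit k (mi_of xs))" for k h
  define T where "T q h = taylor_coeff v (snd q) (h *\<^sub>R \<alpha>) *
      (quad_error h \<alpha> (\<lambda>y. model_sing (fst q) (mi_of (snd q)) y * \<psi> (y /\<^sub>R \<Lambda>0))
        - h powr (\<gamma> + real (fst q) + real CARD('n)) * h ^ length (snd q) * moment_limit (fst q) (mi_of (snd q)))" for q h
  have "(\<lambda>h. \<Sum>q\<in>term_index p. T q h) \<in> ?O"
    unfolding T_def by (intro big_sum_in_bigo expansion_term_error) (auto simp: term_index_def)
  moreover have "(\<lambda>h. \<Sum>k\<le>p. h powr (\<gamma> + real k + real CARD('n)) * (W k h - S k h)) \<in> ?O"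
    unfolding W_def S_def by (intro big_sum_in_bigo correction_sum_error \<Lambda> \<nu> inv) auto
  ultimately have "(\<lambda>h. (\<Sum>q\<in>term_index p. T q h) + quad_error h \<alpha> (taylor_remainder p h) + quad_error h \<alpha> (outer_part h)
      - (\<Sum>k\<le>p. h powr (\<gamma> + real k + real CARD('n)) * (W k h - S k h))) \<in> ?O"
    by (intro sum_in_bigo quad_error_taylor_remainder quad_error_outer_part)
  moreover have "full_integral (sing_integrand \<gamma> l \<alpha> v h) - composite_rule \<psi> \<Lambda> \<alpha> c \<nu> \<gamma> l v p h
      = (\<Sum>q\<in>term_index p. T q h) + quad_error h \<alpha> (taylor_remainder p h) + quad_error h \<alpha> (outer_part h)
      - (\<Sum>k\<le>p. h powr (\<gamma> + real k + real CARD('n)) * (W k h - S k h))" if h: "0 < h" "h < h1" for h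
  proof -
    let ?Q = "\<lambda>q. taylor_coeff v (snd q) (h *\<^sub>R \<alpha>) * quad_error h \<alpha> (\<lambda>y. model_sing (fst q) (mi_of (snd q)) y * \<psi> (y /\<^sub>R \<Lambda>0))"
    have "(\<Sum>q\<in>term_index p. T q h) = (\<Sum>q\<in>term_index p. ?Q q)
        - (\<Sum>(k, xs)\<in>term_index p. h powr (\<gamma> + real k + real CARD('n)) * (taylor_coeff v xs (h *\<^sub>R \<alpha>) * h ^ length xs * moment_limit k (mi_of xs)))"
      unfolding T_def sum_subtractf[symmetric] by (intro sum.cong refl) (simp add: case_prod_unfold right_diff_distrib mult_ac)
    also have "(\<Sum>(k, xs)\<in>term_index p. h powr (\<gamma> + real k + real CARD('n)) * (taylor_coeff v xs (h *\<^sub>R \<alpha>) * h ^ length xs * moment_limit k (mi_of xs)))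
        = (\<Sum>k\<le>p. h powr (\<gamma> + real k + real CARD('n)) * S k h)"
      unfolding term_index_def S_def sum_distrib_left by (rule sum.Sigma[symmetric]) (auto simp: finite_lists_le)
    finally have "(\<Sum>q\<in>term_index p. ?Q q) = (\<Sum>q\<in>term_index p. T q h) + (\<Sum>k\<le>p. h powr (\<gamma> + real k + real CARD('n)) * S k h)" by simp
    moreover have "full_integral (sing_integrand \<gamma> l \<alpha> v h) - composite_rule \<psi> \<Lambda> \<alpha> c \<nu> \<gamma> l v p h
        = quad_error h \<alpha> (shifted h) - (\<Sum>k\<le>p. h powr (\<gamma> + real k + real CARD('n)) * W k h)"
      unfolding composite_rule_eq[OF h(1)] W_def using full_integral_minus_trapezoidal[of h] by simp
    ultimately show ?thesis
      unfolding quad_error_shifted[OF h, of p] by (simp add: case_prod_unfold right_diff_distrib sum_subtractf)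
  qed
  then have "\<forall>\<^sub>F h in at_right 0. full_integral (sing_integrand \<gamma> l \<alpha> v h) - composite_rule \<psi> \<Lambda> \<alpha> c \<nu> \<gamma> l v p h
      = (\<Sum>q\<in>term_index p. T q h) + quad_error h \<alpha> (taylor_remainder p h) + quad_error h \<alpha> (outer_part h)
      - (\<Sum>k\<le>p. h powr (\<gamma> + real k + real CARD('n)) * (W k h - S k h))"
    unfolding eventually_at_right_field using h1_pos by blast
  ultimately show ?thesis by (subst landau_o.big.in_cong)
qed

end

lemma test_function_supportD:
  assumes "test_function_on U v" "x \<notin> U" shows "v x = 0"
  using assms closure_subset[of "{x. v x \<noteq> 0}"] by (auto simp: test_function_on_def)

theorem theorem4p7:
  fixes p :: nat and L L' h0 \<gamma> :: real
    and \<alpha> :: "real ^ 'n"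
    and v \<psi> :: "real ^ 'n \<Rightarrow> real"
    and l :: "real \<times> (real ^ 'n) \<Rightarrow> real"
    and \<nu> :: "nat \<Rightarrow> nat \<Rightarrow> nat ^ 'n"
    and c :: "nat \<Rightarrow> nat \<Rightarrow> real ^ 'n"
    and \<Lambda> :: "nat \<Rightarrow> real"
  assumes "0 < L + 3 / 2 * h0 * sqrt (real CARD('n))"
    and "L + 3 / 2 * h0 * sqrt (real CARD('n)) < L'"
    and "0 < h0" and "h0 \<le> 1"
    and "infnorm \<alpha> \<le> 1 / 2"
    and "test_function_on (ball 0 L) v"
    and "smooth_on_subset ({-L'<..<L'} \<times> sphere 0 1) l"
    and "bounded (l ` ({-L'<..<L'} \<times> sphere 0 1))"
    and "\<gamma> > - real CARD('n)"
    and "test_function_on UNIV \<psi>"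
    and "\<And>x. infnorm x \<le> 3 / 4 \<Longrightarrow> \<psi> x = 1"
    and "\<And>x. infnorm x \<ge> 1 \<Longrightarrow> \<psi> x = 0"
    and "\<And>q. q \<le> p \<Longrightarrow>
           bij_betw (\<nu> q) {..<num_mi CARD('n) q} {\<beta>. mi_order \<beta> \<le> q}"
    and "\<And>q i. q \<le> p \<Longrightarrow> i < num_mi CARD('n) q \<Longrightarrow> c q i \<in> int_lattice"
    and "\<And>q. q \<le> p \<Longrightarrow> invertible_mat (node_matrix \<alpha> (c q) (\<nu> q) q)"
    and "\<And>q. q \<le> p \<Longrightarrow> \<Lambda> q > 0"
    and "\<And>q. q \<le> p \<Longrightarrow>
           \<Lambda> q \<ge> 4 / 3 * h0 * Max ((\<lambda>i. norm (c q i)) ` {..<num_mi CARD('n) q})"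
  shows "(\<lambda>h. full_integral (sing_integrand \<gamma> l \<alpha> v h) - composite_rule \<psi> \<Lambda> \<alpha> c \<nu> \<gamma> l v p h)
           \<in> O[at_right 0](\<lambda>h. h powr (\<gamma> + real CARD('n) + real p + 1))"
proof -
  have "0 \<le> 3 / 2 * h0 * sqrt (real CARD('n))" using \<open>0 < h0\<close> by simp
  then have "max L 0 < L'" using assms(1,2) by linarith
  interpret composite_setting l L' \<psi> v \<alpha> "max L 0" \<gamma>
  proof
    show "\<psi> x = 1" if "norm x < 3 / 4" for x
      using assms(11)[of x] infnorm_le_norm[of x] that by linarith
    show "\<psi> x = 0" if "norm x > real CARD('n)" for x
    proof -
      have "norm x \<le> sqrt (real CARD('n)) * infnorm x" using norm_le_infnorm[of x] by simp
      also have "\<dots> \<le> real CARD('n) * infnorm x"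
        by (intro mult_right_mono infnorm_pos_le) (simp add: real_le_lsqrt[of _ "real CARD('n)"] real_sqrt_le_iff power2_eq_square)
      finally have le: "norm x \<le> real CARD('n) * infnorm x" .
      have "infnorm x \<ge> 1"
      proof (rule ccontr)
        assume "\<not> infnorm x \<ge> 1"
        then have "real CARD('n) * infnorm x \<le> real CARD('n) * 1" by (intro mult_left_mono) auto
        then show False using le that by linarith
      qed
      then show ?thesis using assms(12) by simp
    qed
    show "v x = 0" if "norm x > max L 0" for x
      using test_function_supportD[OF assms(6), of x] that by simp
  qed (use assms \<open>max L 0 < L'\<close> in \<open>auto simp: test_function_on_def\<close>)
  show ?thesis using assms(13,15,16) by (intro composite_rule_error)
qed

end
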